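(* Let $A$ be an $SU(2)^3$-invariant $G_2$-instanton with gauge group $SU(2)$ on the Bryant--Salamon $G_2$-manifold $\mathbb{R}^4\times S^3$, which smoothly extends over the singular orbit on $P_1$. Then $A$ is one of Clarke's examples, in which case there is $x_1\in\mathbb{R}$ such that, writing (up to an invariant gauge transformation) $$A=A_1x\sum_{i=1}^3T_i\otimes\eta_i^++B_1y\sum_{i=1}^3T_i\otimes\eta_i^-,$$ one has $$x(t)=\frac{2x_1A_1(t)}{1+x_1\left(B_1^2(t)-\frac13\right)}\quad\text{and}\quad y(t)=0 .$$ Given such an $x_1\in\mathbb{R}$, denote the resulting instanton by $A^{x_1}$. Then $A^{x_1}$ is defined globally on $\mathbb{R}^4\times S^3$ if and only if $x_1\ge0$, and $A^0$ is the trivial flat connection.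
   Context: Conventions: $SU(2)$ is identified with the unit quaternions; $\{T_i\}_{i=1}^3$ is a basis of $\mathfrak{su}(2)$ with $[T_i,T_j]=2\epsilon_{ijk}T_k$; $T_i^{\pm}=(T_i,\pm T_i)$; $\{\eta_i^{\pm}\}$ are the left-invariant 1-forms on $SU(2)^2$ dual to $\{T_i^{\pm}\}$, and $\eta^\pm_{123}=\eta_1^\pm\wedge\eta_2^\pm\wedge\eta_3^\pm$. Manifold: $\mathbb{R}^4\times S^3\subset\mathbb{H}\times\mathbb{H}$ with $SU(2)^2$ acting by $(a_1,a_2)\cdot(p,q)=(a_1p,a_1q\bar a_2)$; the complement of the singular orbit $\{0\}\times S^3\cong SU(2)^2/\Delta SU(2)$ is identified with $\mathbb{R}^+_t\times SU(2)^2$ via $(t,a_1,a_2)\mapsto(ta_1,a_1\bar a_2)$. The group $SU(2)^3$ acts on $SU(2)^2\cong SU(2)^3/\Delta SU(2)$ by $(h_1,h_2,h_3)\cdot(g_1,g_2)=(h_1g_1h_3^{-1},h_2g_2h_3^{-1})$. Bryant--Salamon structure: define $r\in[1,\infty)$ by $t(r)=\int_1^r(1-s^{-3})^{-1/2}ds$ and $A_1=A_2=A_3=\frac r3\sqrt{1-r^{-3}}$, $B_1=B_2=B_3=\frac{r}{\sqrt3}$. With $\omega=4\sum_iA_iB_i\eta_i^-\wedge\eta_i^+$, $\Omega_1=8B_1B_2B_3\eta_{123}^--4\sum\epsilon_{ijk}A_iA_jB_k\eta_i^+\wedge\eta_j^+\wedge\eta_k^-$, $\Omega_2=-8A_1A_2A_3\eta_{123}^++4\sum\epsilon_{ijk}B_iB_jA_k\eta_i^-\wedge\eta_j^-\wedge\eta_k^+$,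 the $G_2$-structure is $\varphi=dt\wedge\omega+\Omega_1$, $\psi=*\varphi=\frac12\omega^2-dt\wedge\Omega_2$. A $G_2$-instanton is a connection with $F_A\wedge\psi=0$. Invariance is with respect to a lift of the group action to the bundle. $P_1=SU(2)^2\times_{(\Delta SU(2),1)}SU(2)$ is the homogeneous bundle over $S^3=SU(2)^2/\Delta SU(2)$ with trivial isotropy homomorphism, pulled back to $\mathbb{R}^4\times S^3$; over $\mathbb{R}^+\times SU(2)^2$ it is canonically trivial and connections are written there as $\mathfrak{su}(2)$-valued 1-forms. Clarke's examples are the 1-parameter family of $G_2$-instantons on the Bryant--Salamon $\mathbb{R}^4\times S^3$ constructed by A. Clarke, given by the formula in the claim. *)

theory Defs
  imports "HOL-Analysis.Analysis"
begin

section \<open>Quaternions, \<open>SU(2)\<close> and its Lie algebra\<close>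

text \<open>
  A quaternion \<open>a + u\<close> with real part \<open>a\<close> and imaginary part \<open>u\<close> is the pair \<open>(a, u)\<close>; the
  library's Euclidean norm on pairs is the quaternion norm.
\<close>

type_synonym quat = "real \<times> (real ^ 3)"

definition qmul :: "quat \<Rightarrow> quat \<Rightarrow> quat"  (infixl "\<odot>" 70)
  where "p \<odot> q = (fst p * fst q - snd p \<bullet> snd q,
                  fst p *\<^sub>R snd q + fst q *\<^sub>R snd p + cross3 (snd p) (snd q))"

definition qone :: quat
  where "qone = (1, 0)"

definition qcnj :: "quat \<Rightarrow> quat"
  where "qcnj q = (fst q, - snd q)"

definition SU2 :: "quat set"
  where "SU2 = {q. norm q = 1}"

definition su2 :: "quat set"
  where "su2 = {q. fst q = 0}"

definition su2_bracket :: "quat \<Rightarrow> quat \<Rightarrow> quat"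
  where "su2_bracket X Y = X \<odot> Y - Y \<odot> X"

definition T_su2 :: "3 \<Rightarrow> quat"
  where "T_su2 i = (0, axis i 1)"

definition eps :: "3 \<Rightarrow> 3 \<Rightarrow> 3 \<Rightarrow> real"
  where "eps i j k = cross3 (axis i 1) (axis j 1) $ k"

lemma T_su2_bracket: "su2_bracket (T_su2 i) (T_su2 j) = 2 *\<^sub>R (\<Sum>k\<in>UNIV. eps i j k *\<^sub>R T_su2 k)"
  using exhaust_3[of i] exhaust_3[of j]
  by (auto simp: su2_bracket_def qmul_def T_su2_def eps_def sum_3 prod_eq_iff vec_eq_iff forall_3
      cross3_def axis_def inner_vec_def)

lemma qmul_assoc: "p \<odot> q \<odot> r = p \<odot> (q \<odot> r)"
  by (simp add: prod_eq_iff qmul_def vec_eq_iff forall_3 cross3_def inner_vec_def sum_3)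
    (simp add: algebra_simps)

lemma qcnj_qmul: "qcnj (p \<odot> q) = qcnj q \<odot> qcnj p"
  by (simp add: prod_eq_iff qcnj_def qmul_def vec_eq_iff forall_3 cross3_def inner_vec_def sum_3
      algebra_simps)

lemma qcnj_cancel:
  assumes "q \<in> SU2"
  shows "qcnj q \<odot> (q \<odot> x) = x"
proof -
  have "inner q q = 1"
    using assms by (simp add: SU2_def dot_square_norm)
  then have "qcnj q \<odot> q = qone"
    by (simp add: qcnj_def qmul_def qone_def inner_prod_def)
  moreover have "qone \<odot> x = x"
    by (simp add: qone_def qmul_def)
  ultimately show ?thesis
    by (simp flip: qmul_assoc)
qed


section \<open>Smooth maps, tangent vectors and forms on submanifolds of Euclidean space\<close>

text \<open>The next predicate is meant for open \<open>S\<close>.\<close>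

primrec Ck_on :: "nat \<Rightarrow> 'a::euclidean_space set \<Rightarrow> ('a \<Rightarrow> 'b::real_normed_vector) \<Rightarrow> bool"
  where
    "Ck_on 0 S f \<longleftrightarrow> continuous_on S f"
  | "Ck_on (Suc k) S f \<longleftrightarrow>
       f differentiable_on S \<and> (\<forall>v. Ck_on k S (\<lambda>x. frechet_derivative f (at x) v))"

definition smooth_map_on :: "'a::euclidean_space set \<Rightarrow> ('a \<Rightarrow> 'b::real_normed_vector) \<Rightarrow> bool"
  where "smooth_map_on S f \<longleftrightarrow>
    (\<forall>x\<in>S. \<exists>U g. open U \<and> x \<in> U \<and> (\<forall>k. Ck_on k U g) \<and> (\<forall>y\<in>S \<inter> U. g y = f y))"

definition tangent_space :: "'a::euclidean_space set \<Rightarrow> 'a \<Rightarrow> 'a set"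
  where "tangent_space S x =
    {v. \<exists>\<gamma>. \<gamma> 0 = x \<and> (\<forall>\<^sub>F s in at (0::real). \<gamma> s \<in> S) \<and> (\<gamma> has_vector_derivative v) (at 0)}"

text \<open>
  The value on a tangent vector does not depend on which derivative within \<open>S\<close> is chosen, when
  \<open>S\<close> is a submanifold.
\<close>

definition differential_on ::
    "'a::euclidean_space set \<Rightarrow> ('a \<Rightarrow> 'b::real_normed_vector) \<Rightarrow> 'a \<Rightarrow> 'a \<Rightarrow> 'b"
  where "differential_on S f x v = frechet_derivative f (at x within S) v"

text \<open>
  A smooth 1-form on a submanifold \<open>S\<close> is represented by a smooth field of linear maps on the ambient
  space along \<open>S\<close>; only its values on tangent vectors matter, and every smooth 1-form on \<open>S\<close> has
  such a representative (compose with the orthogonal projection onto the tangent space). The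
  exterior derivative below, evaluated on tangent vectors, is independent of the representative.
\<close>

definition one_form_on :: "'a::euclidean_space set \<Rightarrow> 'b::euclidean_space set \<Rightarrow> ('a \<Rightarrow> 'a \<Rightarrow> 'b) \<Rightarrow> bool"
  where "one_form_on S L \<alpha> \<longleftrightarrow>
    (\<forall>x\<in>S. linear (\<alpha> x) \<and> range (\<alpha> x) \<subseteq> L) \<and> (\<forall>v. smooth_map_on S (\<lambda>x. \<alpha> x v))"

definition ext_deriv ::
    "'a::euclidean_space set \<Rightarrow> ('a \<Rightarrow> 'a \<Rightarrow> 'b::euclidean_space) \<Rightarrow> 'a \<Rightarrow> 'a \<Rightarrow> 'a \<Rightarrow> 'b"
  where "ext_deriv S \<alpha> x v w =
    differential_on S (\<lambda>y. \<alpha> y w) x v - differential_on S (\<lambda>y. \<alpha> y v) x w"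

text \<open>
  A \<open>k\<close>-covector takes its arguments as a sequence, of which only entries \<open>0, \<dots>, k - 1\<close> matter.
  The normalisation of the wedge product is \<open>(\<alpha> \<and> \<beta>)(v, w) = \<alpha>(v) \<beta>(w) - \<alpha>(w) \<beta>(v)\<close> for 1-forms.
\<close>

type_synonym ('a, 'b) covector = "(nat \<Rightarrow> 'a) \<Rightarrow> 'b"

definition wedge :: "nat \<Rightarrow> nat \<Rightarrow> ('a, 'b::real_vector) covector \<Rightarrow> ('a, real) covector
    \<Rightarrow> ('a, 'b) covector"
  where "wedge k l \<alpha> \<beta> = (\<lambda>v. (1 / (fact k * fact l)) *\<^sub>R
    (\<Sum>\<sigma> | \<sigma> permutes {..<k + l}.
       (of_int (sign \<sigma>) * \<beta> (\<lambda>i. v (\<sigma> (k + i)))) *\<^sub>R \<alpha> (\<lambda>i. v (\<sigma> i))))"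

definition wedge3 :: "('a, real) covector \<Rightarrow> ('a, real) covector \<Rightarrow> ('a, real) covector
    \<Rightarrow> ('a, real) covector"
  where "wedge3 \<alpha> \<beta> \<gamma> = wedge 2 1 (wedge 1 1 \<alpha> \<beta>) \<gamma>"


section \<open>The manifold \<open>\<real>\<^sup>4 \<times> S\<^sup>3\<close> and its group actions\<close>

text \<open>
  \<open>tube R\<close> is the invariant neighbourhood of radius \<open>R\<close> of the singular orbit \<open>{0} \<times> S\<^sup>3\<close>, and
  \<open>tube \<infinity>\<close> is all of \<open>\<real>\<^sup>4 \<times> S\<^sup>3\<close>. Its complement of the singular orbit is identified by \<open>emb\<close>
  with \<open>cyl R = (0, R) \<times> SU(2)\<^sup>2\<close>.
\<close>

definition tube :: "ereal \<Rightarrow> (quat \<times> quat) set"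
  where "tube R = {(p, q). ereal (norm p) < R \<and> norm q = 1}"

definition cyl :: "ereal \<Rightarrow> (real \<times> quat \<times> quat) set"
  where "cyl R = {(t, a, b). 0 < t \<and> ereal t < R \<and> a \<in> SU2 \<and> b \<in> SU2}"

definition emb :: "real \<times> quat \<times> quat \<Rightarrow> quat \<times> quat"
  where "emb = (\<lambda>(t, a, b). (t *\<^sub>R a, a \<odot> qcnj b))"

definition emb_diff :: "real \<times> quat \<times> quat \<Rightarrow> real \<times> quat \<times> quat \<Rightarrow> quat \<times> quat"
  where "emb_diff n v = frechet_derivative emb (at n) v"

definition SU2_3 :: "(quat \<times> quat \<times> quat) set"
  where "SU2_3 = SU2 \<times> SU2 \<times> SU2"

definition mul3 :: "quat \<times> quat \<times> quat \<Rightarrow> quat \<times> quat \<times> quat \<Rightarrow> quat \<times> quat \<times> quat"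
  where "mul3 = (\<lambda>(h1, h2, h3) (k1, k2, k3). (h1 \<odot> k1, h2 \<odot> k2, h3 \<odot> k3))"

definition act :: "quat \<times> quat \<times> quat \<Rightarrow> quat \<times> quat \<Rightarrow> quat \<times> quat"
  where "act = (\<lambda>(h1, h2, h3) (p, q). (h1 \<odot> p \<odot> qcnj h3, h1 \<odot> q \<odot> qcnj h2))"

text \<open>
  On \<open>(0, \<infinity>) \<times> SU(2)\<^sup>2\<close> the action above is the action of \<open>SU(2)\<^sup>3\<close> on
  \<open>SU(2)\<^sup>2 \<cong> SU(2)\<^sup>3 / \<Delta>SU(2)\<close>.
\<close>

lemma act_emb:
  assumes "h3 \<in> SU2"
  shows "act (h1, h2, h3) (emb (t, g1, g2)) = emb (t, h1 \<odot> g1 \<odot> qcnj h3, h2 \<odot> g2 \<odot> qcnj h3)"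
proof -
  have "qcnj (qcnj x) = x" for x
    by (simp add: qcnj_def)
  moreover have "x \<odot> (t *\<^sub>R y) = t *\<^sub>R (x \<odot> y)" "(t *\<^sub>R y) \<odot> x = t *\<^sub>R (y \<odot> x)" for x y
    by (simp_all add: qmul_def cross_mult_left cross_mult_right algebra_simps)
  ultimately show ?thesis
    by (simp add: act_def emb_def qcnj_qmul qmul_assoc qcnj_cancel[OF assms])
qed


section \<open>The bundle \<open>P\<^sub>1\<close>, connections, lifts and gauge transformations\<close>

text \<open>
  Since the isotropy homomorphism of \<open>P\<^sub>1 = SU(2)\<^sup>2 \<times>\<^bsub>(\<Delta>SU(2), 1)\<^esub> SU(2)\<close> is trivial, the map
  \<open>[(a\<^sub>1, a\<^sub>2), u] \<mapsto> (a\<^sub>1 a\<^sub>2\<^sup>-\<^sup>1, u)\<close> identifies \<open>P\<^sub>1\<close> with \<open>S\<^sup>3 \<times> SU(2)\<close>, where \<open>SU(2)\<^sup>2\<close> acts on the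
  first factor only. Its pullback to the tube is the product below, in which the principal right
  action is right multiplication on the last factor.
\<close>

definition P1 :: "ereal \<Rightarrow> ((quat \<times> quat) \<times> quat) set"
  where "P1 R = tube R \<times> SU2"

definition P1_act2 :: "quat \<Rightarrow> quat \<Rightarrow> (quat \<times> quat) \<times> quat \<Rightarrow> (quat \<times> quat) \<times> quat"
  where "P1_act2 h1 h2 = (\<lambda>(m, u). (act (h1, h2, qone) m, u))"

text \<open>
  A connection on \<open>P\<^sub>1\<close> is given by its \<open>su(2)\<close>-valued 1-form \<open>A\<close> on the base in this trivialisation;
  \<open>conn_form A\<close> is the corresponding principal connection form on the total space.
\<close>

definition connection_on :: "ereal \<Rightarrow> (quat \<times> quat \<Rightarrow> quat \<times> quat \<Rightarrow> quat) \<Rightarrow> bool"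
  where "connection_on R A \<longleftrightarrow> one_form_on (tube R) su2 A"

definition conn_form :: "(quat \<times> quat \<Rightarrow> quat \<times> quat \<Rightarrow> quat)
    \<Rightarrow> (quat \<times> quat) \<times> quat \<Rightarrow> (quat \<times> quat) \<times> quat \<Rightarrow> quat"
  where "conn_form A = (\<lambda>(m, u) (v, w). qcnj u \<odot> A m v \<odot> u + qcnj u \<odot> w)"

definition curvature :: "ereal \<Rightarrow> (quat \<times> quat \<Rightarrow> quat \<times> quat \<Rightarrow> quat)
    \<Rightarrow> quat \<times> quat \<Rightarrow> quat \<times> quat \<Rightarrow> quat \<times> quat \<Rightarrow> quat"
  where "curvature R A m v w = ext_deriv (tube R) A m v w + su2_bracket (A m v) (A m w)"

text \<open>\<open>f\<close> pulls the connection \<open>A\<close> back to the connection \<open>A'\<close>.\<close>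

definition pulls_back :: "ereal \<Rightarrow> ((quat \<times> quat) \<times> quat \<Rightarrow> (quat \<times> quat) \<times> quat)
    \<Rightarrow> (quat \<times> quat \<Rightarrow> quat \<times> quat \<Rightarrow> quat) \<Rightarrow> (quat \<times> quat \<Rightarrow> quat \<times> quat \<Rightarrow> quat) \<Rightarrow> bool"
  where "pulls_back R f A A' \<longleftrightarrow>
    (\<forall>z\<in>P1 R. \<forall>w\<in>tangent_space (P1 R) z.
       conn_form A (f z) (differential_on (P1 R) f z w) = conn_form A' z w)"

text \<open>
  All principal \<open>SU(2)\<close>-bundles over the tube are trivial, and \<open>P\<^sub>1\<close> is distinguished only by its
  homogeneous structure. So a lift of the \<open>SU(2)\<^sup>3\<close>-action to \<open>P\<^sub>1\<close> is required to restrict to the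
  given action of \<open>SU(2)\<^sup>2 = SU(2)\<^sup>2 \<times> {1}\<close>; otherwise it is arbitrary.
\<close>

definition lift_on ::
    "ereal \<Rightarrow> (quat \<times> quat \<times> quat \<Rightarrow> (quat \<times> quat) \<times> quat \<Rightarrow> (quat \<times> quat) \<times> quat) \<Rightarrow> bool"
  where "lift_on R \<Phi> \<longleftrightarrow>
    smooth_map_on (SU2_3 \<times> P1 R) (\<lambda>(h, z). \<Phi> h z) \<and>
    (\<forall>h\<in>SU2_3. \<forall>z\<in>P1 R. \<Phi> h z \<in> P1 R \<and> fst (\<Phi> h z) = act h (fst z)) \<and>
    (\<forall>h\<in>SU2_3. \<forall>m\<in>tube R. \<forall>u\<in>SU2. \<forall>g\<in>SU2. snd (\<Phi> h (m, u \<odot> g)) = snd (\<Phi> h (m, u)) \<odot> g) \<and>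
    (\<forall>z\<in>P1 R. \<Phi> (qone, qone, qone) z = z) \<and>
    (\<forall>h\<in>SU2_3. \<forall>k\<in>SU2_3. \<forall>z\<in>P1 R. \<Phi> (mul3 h k) z = \<Phi> h (\<Phi> k z)) \<and>
    (\<forall>h1\<in>SU2. \<forall>h2\<in>SU2. \<forall>z\<in>P1 R. \<Phi> (h1, h2, qone) z = P1_act2 h1 h2 z)"

definition SU2_3_invariant :: "ereal \<Rightarrow> (quat \<times> quat \<Rightarrow> quat \<times> quat \<Rightarrow> quat) \<Rightarrow> bool"
  where "SU2_3_invariant R A \<longleftrightarrow> (\<exists>\<Phi>. lift_on R \<Phi> \<and> (\<forall>h\<in>SU2_3. pulls_back R (\<Phi> h) A A))"

text \<open>
  Gauge transformations are bundle automorphisms covering the identity; such a map is automatically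
  a diffeomorphism. They are called invariant if they commute with the \<open>SU(2)\<^sup>2\<close>-action on \<open>P\<^sub>1\<close>;
  commuting with a lift of \<open>SU(2)\<^sup>3\<close> would be too restrictive, as different lifts have to be brought
  to a common form.
\<close>

definition invariant_gauge_on ::
    "ereal \<Rightarrow> ((quat \<times> quat) \<times> quat \<Rightarrow> (quat \<times> quat) \<times> quat) \<Rightarrow> bool"
  where "invariant_gauge_on R f \<longleftrightarrow>
    smooth_map_on (P1 R) f \<and>
    (\<forall>z\<in>P1 R. f z \<in> P1 R \<and> fst (f z) = fst z) \<and>
    (\<forall>m\<in>tube R. \<forall>u\<in>SU2. \<forall>g\<in>SU2. snd (f (m, u \<odot> g)) = snd (f (m, u)) \<odot> g) \<and>
    (\<forall>h1\<in>SU2. \<forall>h2\<in>SU2. \<forall>z\<in>P1 R. f (P1_act2 h1 h2 z) = P1_act2 h1 h2 (f z))"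


section \<open>The Bryant--Salamon structure\<close>

text \<open>
  The integrand is unbounded near \<open>1\<close>; the (gauge) integral is the improper one.
\<close>

definition bs_t :: "real \<Rightarrow> real"
  where "bs_t r = integral {1..r} (\<lambda>s. 1 / sqrt (1 - 1 / s ^ 3))"

definition bs_r :: "real \<Rightarrow> real"
  where "bs_r t = inv_into {1..} bs_t t"

text \<open>\<open>A\<^sub>1 = A\<^sub>2 = A\<^sub>3\<close> and \<open>B\<^sub>1 = B\<^sub>2 = B\<^sub>3\<close> as functions of \<open>t\<close>:\<close>

definition bs_A :: "real \<Rightarrow> real"
  where "bs_A t = bs_r t / 3 * sqrt (1 - 1 / bs_r t ^ 3)"

definition bs_B :: "real \<Rightarrow> real"
  where "bs_B t = bs_r t / sqrt 3"

text \<open>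
  A tangent vector \<open>(v\<^sub>1, v\<^sub>2)\<close> of \<open>SU(2)\<^sup>2\<close> at \<open>(a, b)\<close> corresponds to \<open>(a\<^sup>-\<^sup>1 v\<^sub>1, b\<^sup>-\<^sup>1 v\<^sub>2)\<close> in the Lie
  algebra, whose coefficients with respect to \<open>(T\<^sub>i, \<plusminus>T\<^sub>i)\<close> are half the sums and half the
  differences of the coefficients of the two components.
\<close>

type_synonym cylpt = "real \<times> quat \<times> quat"

definition eta_p :: "3 \<Rightarrow> cylpt \<Rightarrow> cylpt \<Rightarrow> real"
  where "eta_p i = (\<lambda>(t, a, b) (\<tau>, v, w). (snd (qcnj a \<odot> v) $ i + snd (qcnj b \<odot> w) $ i) / 2)"

definition eta_m :: "3 \<Rightarrow> cylpt \<Rightarrow> cylpt \<Rightarrow> real"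
  where "eta_m i = (\<lambda>(t, a, b) (\<tau>, v, w). (snd (qcnj a \<odot> v) $ i - snd (qcnj b \<odot> w) $ i) / 2)"

lemma eta_dual:
  assumes "a \<in> SU2" "b \<in> SU2"
  shows "eta_p i (t, a, b) (0, a \<odot> T_su2 j, b \<odot> T_su2 j) = (if i = j then 1 else 0)"
    and "eta_p i (t, a, b) (0, a \<odot> T_su2 j, - (b \<odot> T_su2 j)) = 0"
    and "eta_m i (t, a, b) (0, a \<odot> T_su2 j, b \<odot> T_su2 j) = 0"
    and "eta_m i (t, a, b) (0, a \<odot> T_su2 j, - (b \<odot> T_su2 j)) = (if i = j then 1 else 0)"
proof -
  have minus: "x \<odot> (- y) = - (x \<odot> y)" for x y
    by (simp add: qmul_def cross_minus_right)
  show "eta_p i (t, a, b) (0, a \<odot> T_su2 j, b \<odot> T_su2 j) = (if i = j then 1 else 0)"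
    "eta_p i (t, a, b) (0, a \<odot> T_su2 j, - (b \<odot> T_su2 j)) = 0"
    "eta_m i (t, a, b) (0, a \<odot> T_su2 j, b \<odot> T_su2 j) = 0"
    "eta_m i (t, a, b) (0, a \<odot> T_su2 j, - (b \<odot> T_su2 j)) = (if i = j then 1 else 0)"
    using assms by (auto simp: eta_p_def eta_m_def minus qcnj_cancel T_su2_def axis_def)
qed

definition ep :: "3 \<Rightarrow> cylpt \<Rightarrow> (cylpt, real) covector"
  where "ep i n v = eta_p i n (v 0)"

definition em :: "3 \<Rightarrow> cylpt \<Rightarrow> (cylpt, real) covector"
  where "em i n v = eta_m i n (v 0)"

definition dt :: "(cylpt, real) covector"
  where "dt v = fst (v 0)"

definition omega :: "cylpt \<Rightarrow> (cylpt, real) covector"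
  where "omega n v = 4 * (\<Sum>i\<in>UNIV. bs_A (fst n) * bs_B (fst n) * wedge 1 1 (em i n) (ep i n) v)"

definition Omega2 :: "cylpt \<Rightarrow> (cylpt, real) covector"
  where "Omega2 n v =
    - 8 * bs_A (fst n) ^ 3 * wedge3 (ep 1 n) (ep 2 n) (ep 3 n) v
    + 4 * (\<Sum>i\<in>UNIV. \<Sum>j\<in>UNIV. \<Sum>k\<in>UNIV. eps i j k * bs_B (fst n) ^ 2 * bs_A (fst n)
             * wedge3 (em i n) (em j n) (ep k n) v)"

definition psi :: "cylpt \<Rightarrow> (cylpt, real) covector"
  where "psi n v = 1 / 2 * wedge 2 2 (omega n) (omega n) v - wedge 1 3 dt (Omega2 n) v"

text \<open>
  The equation \<open>F \<and> \<psi> = 0\<close> is imposed off the singular orbit, where \<open>\<psi>\<close> is given by the formula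
  above; as both sides are smooth this is the same as imposing it everywhere.
\<close>

definition G2_instanton :: "ereal \<Rightarrow> (quat \<times> quat \<Rightarrow> quat \<times> quat \<Rightarrow> quat) \<Rightarrow> bool"
  where "G2_instanton R A \<longleftrightarrow>
    (\<forall>n\<in>cyl R. \<forall>v. (\<forall>i<6. v i \<in> tangent_space (cyl R) n) \<longrightarrow>
       wedge 2 4 (\<lambda>u. curvature R A (emb n) (emb_diff n (u 0)) (emb_diff n (u 1))) (psi n) v = 0)"


section \<open>The invariant ansatz and Clarke's family\<close>

definition ansatz :: "(real \<Rightarrow> real) \<Rightarrow> (real \<Rightarrow> real) \<Rightarrow> cylpt \<Rightarrow> cylpt \<Rightarrow> quat"
  where "ansatz x y n v =
    (bs_A (fst n) * x (fst n)) *\<^sub>R (\<Sum>i\<in>UNIV. eta_p i n v *\<^sub>R T_su2 i)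
    + (bs_B (fst n) * y (fst n)) *\<^sub>R (\<Sum>i\<in>UNIV. eta_m i n v *\<^sub>R T_su2 i)"

text \<open>The connection \<open>A\<close> on the tube is \<open>\<alpha>\<close> over the points of the cylinder with \<open>t \<in> I\<close>:\<close>

definition restricts_to :: "ereal \<Rightarrow> real set \<Rightarrow> (quat \<times> quat \<Rightarrow> quat \<times> quat \<Rightarrow> quat)
    \<Rightarrow> (cylpt \<Rightarrow> cylpt \<Rightarrow> quat) \<Rightarrow> bool"
  where "restricts_to R I A \<alpha> \<longleftrightarrow>
    (\<forall>n\<in>cyl R. fst n \<in> I \<longrightarrow>
       (\<forall>v\<in>tangent_space (cyl R) n. A (emb n) (emb_diff n v) = \<alpha> n v))"

definition clarke_denom :: "real \<Rightarrow> real \<Rightarrow> real"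
  where "clarke_denom x1 t = 1 + x1 * (bs_B t ^ 2 - 1 / 3)"

definition clarke_x :: "real \<Rightarrow> real \<Rightarrow> real"
  where "clarke_x x1 t = 2 * x1 * bs_A t / clarke_denom x1 t"

definition clarke :: "real \<Rightarrow> cylpt \<Rightarrow> cylpt \<Rightarrow> quat"
  where "clarke x1 = ansatz (clarke_x x1) (\<lambda>t. 0)"

text \<open>
  The maximal interval starting at the singular orbit on which the formula makes sense. For
  \<open>x\<^sub>1 < 0\<close> it is bounded, and the connection being defined globally would mean that it
  extends smoothly beyond this interval.
\<close>

definition clarke_interval :: "real \<Rightarrow> real set"
  where "clarke_interval x1 = {t. 0 < t \<and> (\<forall>s. 0 < s \<and> s \<le> t \<longrightarrow> clarke_denom x1 s \<noteq> 0)}"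

definition clarke_defined_on :: "ereal \<Rightarrow> real \<Rightarrow> bool"
  where "clarke_defined_on R x1 \<longleftrightarrow>
    (\<exists>A. connection_on R A \<and> SU2_3_invariant R A \<and> G2_instanton R A \<and>
         restricts_to R (clarke_interval x1) A (clarke x1))"

end

theory Submission
  imports Defs
begin

text \<open>
  Off the singular orbit, a connection invariant under \<open>SU(2)\<^sup>2\<close> is determined by its values along the
  ray \<open>(t, 1, 1)\<close>. Parallel transport along this ray gives a temporal gauge in which the \<open>dt\<close>-component
  vanishes and the isotropy representation no longer depends on \<open>t\<close>; Schur's lemma then brings the
  connection to the form \<open>\<phi> \<Sum> T\<^sub>i \<otimes> \<eta>\<^sub>i\<^sup>+ + \<theta> \<Sum> T\<^sub>i \<otimes> \<eta>\<^sub>i\<^sup>-\<close> with \<open>\<phi> = A\<^sub>1 x\<close> and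
  \<open>\<theta> = B\<^sub>1 y\<close>. The instanton equation becomes
  \<open>\<phi>' = (\<phi> - \<phi>\<^sup>2) / A + A (\<theta>\<^sup>2 - \<phi>) / B\<^sup>2\<close> and \<open>\<theta>' = 2 (\<phi> - 1) \<theta> / A\<close>. As \<open>P\<^sub>1\<close> has trivial isotropy
  homomorphism, the connection vanishes on the fibres of \<open>\<real>\<^sup>4 \<times> S\<^sup>3\<close> along the singular orbit, so that
  \<open>\<phi> \<rightarrow> 0\<close> and \<open>\<theta>\<close> stays bounded as \<open>t \<rightarrow> 0\<close>. Since \<open>A \<approx> t / 2\<close>, a nonzero \<open>\<theta>\<close> would grow like a
  negative power of \<open>t\<close>, hence \<open>\<theta> = 0\<close>; then \<open>w = \<phi> / A\<^sup>2\<close> satisfies \<open>w' = - A w\<^sup>2 = - w\<^sup>2 (B\<^sup>2 / 2)'\<close>,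
  which is solved by Clarke's formula. Conversely, \<open>r\<close> is a smooth function of \<open>p \<in> \<real>\<^sup>4\<close> because
  \<open>r' = t \<integral>\<^sub>0\<^sup>1 (3 / 2) r(s t)\<^sup>-\<^sup>4 ds\<close>, so that Clarke's connections are smooth as long as the denominator
  does not vanish.
\<close>

section \<open>Smooth maps\<close>

text \<open>A gauge transformation has to be smooth across the singular orbit, whereas the reduction
  to an ordinary differential equation takes place off it. Two devices bridge this. The parallel
  transport g gives G(p) = g(|p|) with DG = - (radial part of A) G, and the radial part is smooth at
  p = 0, being an average of four conjugates of A. Schur's lemma is applied to all times and both
  kinds of directions at once, so that a single constant c serves everywhere and G c stays smooth.
  That A vanishes on the fibres comes from (-1, -1, 1), which fixes (0, 1), acts as -1 on the fibre
  \<real>^4 and trivially on P_1; it is what makes G differentiable at p = 0. The equation for w has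
  one more solution than the family contains, 2 / w = B^2 - 1/3, formally x_1 = \<infinity>; there
  \<phi> tends to 1 instead of 0. The number 1/3 is the value of B^2 at t = 0. The 6-form F \<and>
  \<psi> is computed by rewriting lists of indices into the coframe dt, \<eta>^+, \<eta>^-.\<close>

lemma Ck_on_cong:
  assumes "open S" "\<And>x. x \<in> S \<Longrightarrow> f x = g x"
  shows "Ck_on k S f \<longleftrightarrow> Ck_on k S g"
  using assms(2)
proof (induction k arbitrary: f g)
  case 0
  then show ?case by (simp cong: continuous_on_cong)
next
  case (Suc k)
  have "f differentiable_on S \<longleftrightarrow> g differentiable_on S"
    using Suc.prems unfolding differentiable_on_def differentiable_def
    by (metis has_derivative_transform)
  moreover have "frechet_derivative f (at x) v = frechet_derivative g (at x) v" if "x \<in> S" for x v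
  proof -
    have "(f has_derivative D) (at x) \<longleftrightarrow> (g has_derivative D) (at x)" for D
      using has_derivative_transform_within_open[OF _ assms(1) that] Suc.prems by metis
    then show ?thesis
      by (simp add: frechet_derivative_def)
  qed
  ultimately show ?case
    using Suc.IH[of "\<lambda>x. frechet_derivative f (at x) v" "\<lambda>x. frechet_derivative g (at x) v" for v]
    by simp
qed

text \<open>\<open>Ck_on\<close> iterates the choice operator \<open>frechet_derivative\<close>;
  here an explicit derivative may take its place. The closure properties below rest on
  differentiation formulas whose right-hand sides are again covered by the induction.\<close>

lemma Ck_on_SucI:
  assumes "open S" "\<And>x. x \<in> S \<Longrightarrow> (f has_derivative f' x) (at x)"
    and "\<And>v. Ck_on k S (\<lambda>x. f' x v)"
  shows "Ck_on (Suc k) S f"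
proof -
  have "frechet_derivative f (at x) = f' x" if "x \<in> S" for x
    using frechet_derivative_at[OF assms(2)[OF that]] by simp
  then have "Ck_on k S (\<lambda>x. frechet_derivative f (at x) v)" for v
    using assms(3)[of v] by (subst Ck_on_cong[OF assms(1)]) auto
  moreover have "f differentiable_on S"
    using assms by (auto simp: differentiable_on_def differentiable_def intro: has_derivative_at_withinI)
  ultimately show ?thesis by simp
qed

lemma Ck_on_SucD:
  assumes "open S" "Ck_on (Suc k) S f" "x \<in> S"
  shows "(f has_derivative frechet_derivative f (at x)) (at x)"
  using assms by (auto simp: differentiable_on_eq_differentiable_at frechet_derivative_works)

lemma Ck_on_less: "Ck_on (Suc k) S f \<Longrightarrow> Ck_on k S f"
proof (induction k arbitrary: f)
  case 0
  then show ?case by (simp add: differentiable_imp_continuous_on)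
next
  case (Suc k)
  then show ?case
    by (metis Ck_on.simps(2))
qed

lemma Ck_on_continuous: "Ck_on k S f \<Longrightarrow> continuous_on S f"
  by (induction k) (use Ck_on_less in auto)

lemma Ck_on_subset: "Ck_on k S f \<Longrightarrow> T \<subseteq> S \<Longrightarrow> Ck_on k T f"
  by (induction k arbitrary: f) (auto intro: continuous_on_subset differentiable_on_subset)

lemma Ck_on_local:
  assumes "open S" "\<And>x. x \<in> S \<Longrightarrow> \<exists>U. open U \<and> x \<in> U \<and> Ck_on k U f"
  shows "Ck_on k S f"
  using assms(2)
proof (induction k arbitrary: f)
  case 0
  then show ?case
    by (metis Ck_on.simps(1) assms(1) continuous_on_eq_continuous_at continuous_at_imp_continuous_on)
next
  case (Suc k)
  have "Ck_on k S (\<lambda>x. frechet_derivative f (at x) v)" for v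
    by (rule Suc.IH) (use Suc.prems in fastforce)
  moreover have "f differentiable_on S"
    using Suc.prems assms(1)
    by (metis Ck_on.simps(2) differentiable_on_eq_differentiable_at)
  ultimately show ?case by simp
qed

lemma Ck_on_const [simp]: "open S \<Longrightarrow> Ck_on k S (\<lambda>x. c)"
proof (induction k arbitrary: c)
  case 0
  then show ?case by simp
next
  case (Suc k)
  then show ?case
    by (intro Ck_on_SucI[where f' = "\<lambda>x v. 0"]) auto
qed

lemma Ck_on_bounded_linear:
  assumes "open S" "bounded_linear L"
  shows "Ck_on k S L"
proof (cases k)
  case 0
  then show ?thesis
    using assms by (simp add: linear_continuous_on)
next
  case (Suc j)
  have "Ck_on (Suc j) S L"
    by (rule Ck_on_SucI[where f' = "\<lambda>x. L"])
      (use assms in \<open>auto intro: bounded_linear_imp_has_derivative\<close>)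
  then show ?thesis using Suc by simp
qed

lemma Ck_on_add:
  assumes "open S"
  shows "Ck_on k S f \<Longrightarrow> Ck_on k S g \<Longrightarrow> Ck_on k S (\<lambda>x. f x + g x)"
proof (induction k arbitrary: f g)
  case 0
  then show ?case by (auto intro: continuous_intros)
next
  case (Suc k)
  have "Ck_on k S (\<lambda>x. frechet_derivative f (at x) v + frechet_derivative g (at x) v)" for v
    using Suc by auto
  moreover have "((\<lambda>x. f x + g x) has_derivative
      (\<lambda>v. frechet_derivative f (at x) v + frechet_derivative g (at x) v)) (at x)" if "x \<in> S" for x
    by (intro has_derivative_add Ck_on_SucD[OF assms Suc.prems(1) that] Ck_on_SucD[OF assms Suc.prems(2) that])
  ultimately show ?case
    by (intro Ck_on_SucI[OF assms])
qed

text \<open>One product rule for scaling, real multiplication and the quaternion product. Each term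
  of the derivative keeps one factor undifferentiated, which is why \<open>Ck_on_less\<close>
  enters.\<close>

lemma Ck_on_bilinear:
  assumes "open S" "bounded_bilinear P"
  shows "Ck_on k S f \<Longrightarrow> Ck_on k S g \<Longrightarrow> Ck_on k S (\<lambda>x. P (f x) (g x))"
proof (induction k arbitrary: f g)
  case 0
  then show ?case
    by (simp add: bounded_bilinear.continuous_on[OF assms(2)])
next
  case (Suc k)
  let ?D = "\<lambda>x v. P (f x) (frechet_derivative g (at x) v) + P (frechet_derivative f (at x) v) (g x)"
  have "Ck_on k S (\<lambda>x. ?D x v)" for v
    using Suc.IH Suc.prems Ck_on_less[OF Suc.prems(1)] Ck_on_less[OF Suc.prems(2)]
    by (intro Ck_on_add assms) auto
  moreover have "((\<lambda>x. P (f x) (g x)) has_derivative ?D x) (at x)" if "x \<in> S" for x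
    by (intro bounded_bilinear.FDERIV[OF assms(2)] Ck_on_SucD[OF assms(1) Suc.prems(1) that]
        Ck_on_SucD[OF assms(1) Suc.prems(2) that])
  ultimately show ?case
    by (intro Ck_on_SucI[OF assms(1), where f' = ?D]) auto
qed

lemma Ck_on_scaleR:
  "open S \<Longrightarrow> Ck_on k S f \<Longrightarrow> Ck_on k S g \<Longrightarrow> Ck_on k S (\<lambda>x. f x *\<^sub>R g x)"
  by (rule Ck_on_bilinear[OF _ bounded_bilinear_scaleR])

lemma Ck_on_mult:
  fixes f g :: "_ \<Rightarrow> real"
  shows "open S \<Longrightarrow> Ck_on k S f \<Longrightarrow> Ck_on k S g \<Longrightarrow> Ck_on k S (\<lambda>x. f x * g x)"
  by (rule Ck_on_bilinear[OF _ bounded_bilinear_mult])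

lemma Ck_on_linear_compose:
  assumes "open S" "bounded_linear L"
  shows "Ck_on k S f \<Longrightarrow> Ck_on k S (\<lambda>x. L (f x))"
proof (induction k arbitrary: f)
  case 0
  then show ?case
    using assms by (simp add: bounded_linear.continuous_on)
next
  case (Suc k)
  have "Ck_on k S (\<lambda>x. L (frechet_derivative f (at x) v))" for v
    using Suc by simp
  moreover have "((\<lambda>x. L (f x)) has_derivative (\<lambda>v. L (frechet_derivative f (at x) v))) (at x)"
    if "x \<in> S" for x
    by (intro bounded_linear.has_derivative[OF assms(2)] Ck_on_SucD[OF assms(1) Suc.prems that])
  ultimately show ?case
    by (intro Ck_on_SucI[OF assms(1)])
qed

lemma Ck_on_sum:
  assumes "open S" "finite I" "\<And>i. i \<in> I \<Longrightarrow> Ck_on k S (f i)"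
  shows "Ck_on k S (\<lambda>x. \<Sum>i\<in>I. f i x)"
  using assms(2,3) by (induction I) (auto intro: Ck_on_add assms(1) Ck_on_const[OF assms(1)])

lemma Ck_on_diff:
  assumes "open S" "Ck_on k S f" "Ck_on k S g"
  shows "Ck_on k S (\<lambda>x. f x - g x)"
  using Ck_on_add[OF assms(1,2)
      Ck_on_linear_compose[OF assms(1) bounded_linear_minus[OF bounded_linear_ident] assms(3)]]
  by simp

lemma Ck_on_inverse:
  fixes f :: "_ \<Rightarrow> real"
  assumes "open S" "\<And>x. x \<in> S \<Longrightarrow> f x \<noteq> 0"
  shows "Ck_on k S f \<Longrightarrow> Ck_on k S (\<lambda>x. inverse (f x))"
proof (induction k)
  case 0
  then show ?case using assms by (auto intro: continuous_intros)
next
  case (Suc k)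
  let ?D = "\<lambda>x v. - (inverse (f x) * frechet_derivative f (at x) v * inverse (f x))"
  have "Ck_on k S (\<lambda>x. ?D x v)" for v
    using Suc.IH[OF Ck_on_less[OF Suc.prems]] Suc.prems
    by (intro Ck_on_linear_compose[OF assms(1) bounded_linear_minus[OF bounded_linear_ident]]
        Ck_on_mult assms(1)) auto
  moreover have "((\<lambda>x. inverse (f x)) has_derivative ?D x) (at x)" if "x \<in> S" for x
    using Deriv.has_derivative_inverse[OF assms(2)[OF that] Ck_on_SucD[OF assms(1) Suc.prems that]]
    by simp
  ultimately show ?case
    by (intro Ck_on_SucI[OF assms(1), where f' = ?D]) auto
qed

lemma Ck_on_power:
  fixes f :: "_ \<Rightarrow> real"
  shows "open S \<Longrightarrow> Ck_on k S f \<Longrightarrow> Ck_on k S (\<lambda>x. f x ^ n)"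
  by (induction n) (auto intro: Ck_on_mult)

text \<open>In the chain rule both the point and the direction of \<open>Dg (f x) (Df x v)\<close>
  vary with \<open>x\<close>. Expanding the direction in \<open>Basis\<close> leaves products of
  scalar functions with \<open>Dg (f x) b\<close> for fixed \<open>b\<close>, to which the induction
  hypothesis applies.\<close>

lemma Ck_on_compose:
  fixes f :: "'a::euclidean_space \<Rightarrow> 'b::euclidean_space" and g :: "'b \<Rightarrow> 'c::real_normed_vector"
  assumes "open S" "open U" "f ` S \<subseteq> U"
  shows "Ck_on k S f \<Longrightarrow> Ck_on k U g \<Longrightarrow> Ck_on k S (\<lambda>x. g (f x))"
proof (induction k arbitrary: g)
  case 0
  then show ?case using assms by (auto intro: continuous_on_compose2)
next
  case (Suc k)
  let ?Df = "\<lambda>x. frechet_derivative f (at x)" and ?Dg = "\<lambda>y. frechet_derivative g (at y)"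
  have Df: "(f has_derivative ?Df x) (at x)" if "x \<in> S" for x
    using Ck_on_SucD[OF assms(1) Suc.prems(1) that] .
  have Dg: "(g has_derivative ?Dg (f x)) (at (f x))" if "x \<in> S" for x
    using Ck_on_SucD[OF assms(2) Suc.prems(2)] that assms(3) by auto
  have "?Dg (f x) (?Df x v) = (\<Sum>b\<in>Basis. (?Df x v \<bullet> b) *\<^sub>R ?Dg (f x) b)" if "x \<in> S" for x v
  proof -
    have lin: "linear (?Dg (f x))"
      using Dg[OF that] has_derivative_linear by blast
    show ?thesis
      by (subst euclidean_representation[symmetric, of "?Df x v"])
        (simp add: linear_sum[OF lin] linear_scale[OF lin] del: euclidean_representation)
  qed
  then have "((\<lambda>x. g (f x)) has_derivative (\<lambda>v. \<Sum>b\<in>Basis. (?Df x v \<bullet> b) *\<^sub>R ?Dg (f x) b)) (at x)"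
    if "x \<in> S" for x
    using has_derivative_compose[OF Df[OF that] Dg[OF that]] that by simp
  moreover have "Ck_on k S (\<lambda>x. \<Sum>b\<in>Basis. (?Df x v \<bullet> b) *\<^sub>R ?Dg (f x) b)" for v
  proof (intro Ck_on_sum Ck_on_scaleR assms(1) finite_Basis)
    show "Ck_on k S (\<lambda>x. ?Df x v \<bullet> b)" for b
      using Suc.prems by (intro Ck_on_linear_compose[OF assms(1) bounded_linear_inner_left]) auto
    show "Ck_on k S (\<lambda>x. ?Dg (f x) b)" for b
      using Suc.IH[of "\<lambda>y. ?Dg y b"] Suc.prems Ck_on_less[OF Suc.prems(1)] by auto
  qed
  ultimately show ?case
    by (intro Ck_on_SucI[OF assms(1)])
qed

text \<open>Averages along the segment from the origin occur as quotients v(t) / t. Differentiating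
  \<open>h (s *\<^sub>R x)\<close> releases a factor \<open>s\<close>, so the family of weights
  \<open>s ^ m\<close> is closed under differentiation.\<close>

lemma has_derivative_integral_ray:
  fixes h :: "'a::euclidean_space \<Rightarrow> real"
  assumes "Ck_on (Suc 0) UNIV h"
  shows "((\<lambda>x. integral {0..1} (\<lambda>s. s ^ m * h (s *\<^sub>R x))) has_derivative
    (\<lambda>v. integral {0..1} (\<lambda>s. s ^ Suc m * frechet_derivative h (at (s *\<^sub>R x)) v))) (at x)"
proof -
  let ?D = "\<lambda>x. frechet_derivative h (at x)"
  have D: "(h has_derivative ?D x) (at x)" for x
    using Ck_on_SucD[OF open_UNIV assms] by simp
  have blin: "bounded_linear (?D x)" for x
    using D has_derivative_bounded_linear by blast
  \<comment> \<open>The Leibniz rule asks for a jointly continuous family of bounded linear maps; in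
    finite dimension continuity can be checked on each vector separately.\<close>
  define fx where "fx x s = s ^ Suc m *\<^sub>R Blinfun (?D (s *\<^sub>R x))" for x and s :: real
  have fx: "fx x s v = s ^ Suc m * ?D (s *\<^sub>R x) v" for x s v
    by (simp add: fx_def scaleR_blinfun.rep_eq bounded_linear_Blinfun_apply[OF blin])
  have cont_D: "continuous_on UNIV (\<lambda>x. ?D x v)" for v
    using assms by simp
  have cont: "continuous_on (UNIV \<times> cbox 0 1) (\<lambda>(x, s). fx x s)"
    unfolding split_beta
    by (intro continuous_on_blinfun_componentwise)
      (auto simp: fx intro!: continuous_intros continuous_on_compose2[OF cont_D])
  have cont_h: "continuous_on UNIV h"
    using Ck_on_continuous[OF assms] .
  have "((\<lambda>x. integral (cbox 0 1) (\<lambda>s. s ^ m * h (s *\<^sub>R x))) has_derivative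
      integral (cbox 0 1) (fx x)) (at x within UNIV)"
  proof (rule leibniz_rule[OF _ _ cont])
    fix x :: 'a and s :: real
    have "((\<lambda>x. h (s *\<^sub>R x)) has_derivative (\<lambda>v. ?D (s *\<^sub>R x) (s *\<^sub>R v))) (at x)"
      by (rule has_derivative_compose[OF _ D]) (auto intro!: derivative_eq_intros)
    then have "((\<lambda>x. s ^ m * h (s *\<^sub>R x)) has_derivative (\<lambda>v. s ^ m * ?D (s *\<^sub>R x) (s *\<^sub>R v))) (at x)"
      by (intro has_derivative_mult_right)
    moreover have "(\<lambda>v. s ^ m * ?D (s *\<^sub>R x) (s *\<^sub>R v)) = blinfun_apply (fx x s)"
      by (simp add: fun_eq_iff fx linear_scale[OF bounded_linear.linear[OF blin]])
    ultimately show "((\<lambda>x. s ^ m * h (s *\<^sub>R x)) has_derivative blinfun_apply (fx x s)) (at x within UNIV)"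
      by simp
  next
    show "(\<lambda>s. s ^ m * h (s *\<^sub>R x)) integrable_on cbox 0 1" for x
      by (rule integrable_continuous) (auto intro!: continuous_intros continuous_on_compose2[OF cont_h])
  qed auto
  moreover have "blinfun_apply (integral (cbox 0 1) (fx x)) v
      = integral {0..1} (\<lambda>s. s ^ Suc m * ?D (s *\<^sub>R x) v)" for v
  proof -
    have "continuous_on (cbox 0 1) (\<lambda>s. case (x, s) of (x, s) \<Rightarrow> fx x s)"
      by (rule continuous_on_compose2[OF cont]) (auto intro!: continuous_intros)
    then have "continuous_on (cbox 0 1) (fx x)"
      by simp
    then have "fx x integrable_on cbox 0 1"
      by (rule integrable_continuous)
    from integral_linear[OF this blinfun.bounded_linear_left[of v]] show ?thesis
      by (simp add: o_def fx)
  qed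
  ultimately show ?thesis
    by (simp add: has_derivative_eq_rhs[OF _ ext])
qed

lemma Ck_on_integral_ray:
  fixes h :: "'a::euclidean_space \<Rightarrow> real"
  shows "Ck_on k UNIV h \<Longrightarrow> Ck_on k UNIV (\<lambda>x. integral {0..1} (\<lambda>s. s ^ m * h (s *\<^sub>R x)))"
proof (induction k arbitrary: h m)
  case 0
  then have cont: "continuous_on UNIV h" by simp
  have "continuous_on (UNIV \<times> cbox 0 1) (\<lambda>(x, s). s ^ m * h (s *\<^sub>R x))"
    unfolding split_beta by (auto intro!: continuous_intros continuous_on_compose2[OF cont])
  from integral_continuous_on_param[OF this] show ?case by simp
next
  case (Suc k)
  have "Ck_on (Suc 0) UNIV h"
    using Suc.prems Ck_on_continuous by auto
  moreover have "Ck_on k UNIV (\<lambda>x. integral {0..1} (\<lambda>s. s ^ Suc m * frechet_derivative h (at (s *\<^sub>R x)) v))" for v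
    using Suc.prems by (intro Suc.IH) simp
  ultimately show ?case
    by (intro Ck_on_SucI[OF open_UNIV has_derivative_integral_ray])
qed

section \<open>Smooth maps on arbitrary subsets\<close>

lemma smooth_map_onI:
  assumes "open U" "S \<subseteq> U" "\<And>k. Ck_on k U f"
  shows "smooth_map_on S f"
  using assms unfolding smooth_map_on_def by blast

lemma smooth_map_onE:
  assumes "smooth_map_on S f" "x \<in> S"
  obtains U g where "open U" "x \<in> U" "\<forall>k. Ck_on k U g" "\<forall>y\<in>S \<inter> U. g y = f y"
proof -
  have "\<exists>U g. open U \<and> x \<in> U \<and> (\<forall>k. Ck_on k U g) \<and> (\<forall>y\<in>S \<inter> U. g y = f y)"
    by (rule bspec[OF assms(1)[unfolded smooth_map_on_def] assms(2)])
  then show thesis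
    by (elim exE conjE) (rule that)
qed

text \<open>On an open set a local extension agrees with \<open>f\<close> near each point and
  therefore has the same iterated derivatives.\<close>

lemma smooth_map_on_open:
  assumes "open S" "smooth_map_on S f"
  shows "Ck_on k S f"
proof (rule Ck_on_local[OF assms(1)])
  fix x assume "x \<in> S"
  obtain U g where U: "open U" "x \<in> U" "\<forall>k. Ck_on k U g" "\<forall>y\<in>S \<inter> U. g y = f y"
    by (rule smooth_map_onE[OF assms(2) \<open>x \<in> S\<close>])
  have "Ck_on k (S \<inter> U) g"
    by (rule Ck_on_subset[OF spec[OF U(3)]]) simp
  then have "Ck_on k (S \<inter> U) f"
    using Ck_on_cong[of "S \<inter> U" g f] U assms(1) by (simp add: open_Int)
  then show "\<exists>U. open U \<and> x \<in> U \<and> Ck_on k U f"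
    using U(1,2) \<open>x \<in> S\<close> assms(1) by (intro exI[of _ "S \<inter> U"]) auto
qed

lemma smooth_map_on_differentiable:
  assumes "smooth_map_on S f" "x \<in> S"
  shows "f differentiable (at x within S)"
proof -
  obtain U g where U: "open U" "x \<in> U" "\<forall>k. Ck_on k U g" "\<forall>y\<in>S \<inter> U. g y = f y"
    by (rule smooth_map_onE[OF assms])
  obtain D where "(g has_derivative D) (at x)"
    using Ck_on_SucD[OF U(1) spec[OF U(3)] U(2)] by blast
  then have "(g has_derivative D) (at x within S)"
    by (rule has_derivative_at_withinI)
  moreover obtain d where "d > 0" "ball x d \<subseteq> U"
    using U openE by blast
  moreover have "g y = f y" if "y \<in> S" "dist y x < d" for y
    using that \<open>ball x d \<subseteq> U\<close> U(4) by (auto simp: dist_commute)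
  ultimately have "(f has_derivative D) (at x within S)"
    using has_derivative_transform_within[OF _ _ assms(2)] by blast
  then show ?thesis
    by (rule differentiableI)
qed

lemma smooth_map_on_continuous: "smooth_map_on S f \<Longrightarrow> continuous_on S f"
  by (simp add: continuous_on_eq_continuous_within differentiable_imp_continuous_within
      smooth_map_on_differentiable)

lemma smooth_map_on_bilinear:
  assumes "bounded_bilinear P" "smooth_map_on S f" "smooth_map_on S g"
  shows "smooth_map_on S (\<lambda>x. P (f x) (g x))"
  unfolding smooth_map_on_def
proof
  fix x assume "x \<in> S"
  obtain U f' where U: "open U" "x \<in> U" "\<forall>k. Ck_on k U f'" "\<forall>y\<in>S \<inter> U. f' y = f y"
    by (rule smooth_map_onE[OF assms(2) \<open>x \<in> S\<close>])
  obtain V g' where V: "open V" "x \<in> V" "\<forall>k. Ck_on k V g'" "\<forall>y\<in>S \<inter> V. g' y = g y"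
    by (rule smooth_map_onE[OF assms(3) \<open>x \<in> S\<close>])
  have "Ck_on k (U \<inter> V) (\<lambda>x. P (f' x) (g' x))" for k
    using U V by (intro Ck_on_bilinear[OF _ assms(1)])
      (auto intro: Ck_on_subset[OF spec[OF U(3)]] Ck_on_subset[OF spec[OF V(3)]])
  then show "\<exists>U h. open U \<and> x \<in> U \<and> (\<forall>k. Ck_on k U h) \<and> (\<forall>y\<in>S \<inter> U. h y = P (f y) (g y))"
    using U V by (intro exI[of _ "U \<inter> V"] exI[of _ "\<lambda>x. P (f' x) (g' x)"]) auto
qed

lemma smooth_map_on_add:
  assumes "smooth_map_on S f" "smooth_map_on S g"
  shows "smooth_map_on S (\<lambda>x. f x + g x)"
  unfolding smooth_map_on_def
proof
  fix x assume "x \<in> S"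
  obtain U f' where U: "open U" "x \<in> U" "\<forall>k. Ck_on k U f'" "\<forall>y\<in>S \<inter> U. f' y = f y"
    by (rule smooth_map_onE[OF assms(1) \<open>x \<in> S\<close>])
  obtain V g' where V: "open V" "x \<in> V" "\<forall>k. Ck_on k V g'" "\<forall>y\<in>S \<inter> V. g' y = g y"
    by (rule smooth_map_onE[OF assms(2) \<open>x \<in> S\<close>])
  have "Ck_on k (U \<inter> V) (\<lambda>x. f' x + g' x)" for k
    using U V by (intro Ck_on_add)
      (auto intro: Ck_on_subset[OF spec[OF U(3)]] Ck_on_subset[OF spec[OF V(3)]])
  then show "\<exists>U h. open U \<and> x \<in> U \<and> (\<forall>k. Ck_on k U h) \<and> (\<forall>y\<in>S \<inter> U. h y = f y + g y)"
    using U V by (intro exI[of _ "U \<inter> V"] exI[of _ "\<lambda>x. f' x + g' x"]) auto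
qed

lemma smooth_map_on_compose:
  assumes "smooth_map_on T g" "\<And>k. Ck_on k UNIV f" "f ` S \<subseteq> T"
  shows "smooth_map_on S (\<lambda>x. g (f x))"
  unfolding smooth_map_on_def
proof
  fix x assume "x \<in> S"
  then have "f x \<in> T" using assms(3) by blast
  obtain U g' where U: "open U" "f x \<in> U" "\<forall>k. Ck_on k U g'" "\<forall>y\<in>T \<inter> U. g' y = g y"
    by (rule smooth_map_onE[OF assms(1) \<open>f x \<in> T\<close>])
  have "open (f -` U)"
    using Ck_on_continuous[OF assms(2)] U(1) by (simp add: continuous_on_open_vimage)
  moreover from this have "Ck_on k (f -` U) (\<lambda>x. g' (f x))" for k
    by (rule Ck_on_compose[OF _ U(1)]) (auto intro: Ck_on_subset[OF assms(2)] simp: U(3))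
  ultimately show "\<exists>U h. open U \<and> x \<in> U \<and> (\<forall>k. Ck_on k U h) \<and> (\<forall>y\<in>S \<inter> U. h y = g (f y))"
    using U assms(3) by (intro exI[of _ "f -` U"] exI[of _ "\<lambda>x. g' (f x)"]) auto
qed

section \<open>Derivatives along curves\<close>

text \<open>The curve lies in \<open>S\<close> on a whole ball around 0, so the chain rule within
  the image of that ball applies, although \<open>f\<close> is differentiable only within
  \<open>S\<close>.\<close>

lemma has_derivative_along_curve:
  assumes f: "(f has_derivative D) (at x within S)" and "x \<in> S"
    and \<gamma>: "\<gamma> 0 = x" "\<forall>\<^sub>F s in at (0::real). \<gamma> s \<in> S" "(\<gamma> has_vector_derivative v) (at 0)"
  shows "((\<lambda>s. f (\<gamma> s)) has_vector_derivative D v) (at 0)"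
proof -
  obtain d where d: "d > 0" "\<And>s. s \<noteq> 0 \<Longrightarrow> dist s 0 < d \<Longrightarrow> \<gamma> s \<in> S"
    using \<gamma>(2) unfolding eventually_at by auto
  have sub: "\<gamma> ` ball 0 d \<subseteq> S"
  proof
    fix y assume "y \<in> \<gamma> ` ball 0 d"
    then obtain s where "y = \<gamma> s" "dist s 0 < d"
      by (auto simp: dist_commute)
    then show "y \<in> S"
      using d(2)[of s] \<gamma>(1) \<open>x \<in> S\<close> by (cases "s = 0") auto
  qed
  have "(\<gamma> has_derivative (\<lambda>s. s *\<^sub>R v)) (at 0 within ball 0 d)"
    using \<gamma>(3) unfolding has_vector_derivative_def by (rule has_derivative_at_withinI)
  moreover have "(f has_derivative D) (at (\<gamma> 0) within \<gamma> ` ball 0 d)"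
    using f sub \<gamma>(1) by (auto intro: has_derivative_subset)
  ultimately have "((\<lambda>s. f (\<gamma> s)) has_derivative (\<lambda>s. D (s *\<^sub>R v))) (at 0 within ball 0 d)"
    by (rule has_derivative_in_compose)
  moreover have "at 0 within ball 0 d = at (0::real)"
    using d(1) by (intro at_within_open) auto
  ultimately show ?thesis
    by (simp add: has_vector_derivative_def linear_scale[OF has_derivative_linear[OF f]])
qed

lemma differential_on_along_curve:
  assumes "f differentiable (at x within S)" "x \<in> S"
    and "\<gamma> 0 = x" "\<forall>\<^sub>F s in at (0::real). \<gamma> s \<in> S" "(\<gamma> has_vector_derivative v) (at 0)"
  shows "((\<lambda>s. f (\<gamma> s)) has_vector_derivative differential_on S f x v) (at 0)"
  using has_derivative_along_curve[OF _ assms(2-)] assms(1)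
  by (simp add: differential_on_def frechet_derivative_works)

text \<open>A derivative within \<open>S\<close> may fail to be unique, but every one of them gives
  the velocity of \<open>f\<close> along a curve with the prescribed tangent, and that velocity is
  unique.\<close>

lemma differential_on_eq:
  assumes "(f has_derivative D) (at x within S)" "x \<in> S" "v \<in> tangent_space S x"
  shows "differential_on S f x v = D v"
proof -
  obtain \<gamma> where \<gamma>: "\<gamma> 0 = x" "\<forall>\<^sub>F s in at (0::real). \<gamma> s \<in> S" "(\<gamma> has_vector_derivative v) (at 0)"
    using assms(3) unfolding tangent_space_def by auto
  have "f differentiable (at x within S)"
    using assms(1) differentiableI by blast
  from vector_derivative_unique_at[OF differential_on_along_curve[OF this assms(2) \<gamma>]
      has_derivative_along_curve[OF assms(1,2) \<gamma>]]
  show ?thesis .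
qed

text \<open>Leibniz rule for a moving base point and a moving argument. Splitting \<open>V s\<close>
  as \<open>w + (V s - w)\<close>, the second part vanishes at 0, so only its derivative
  \<open>m\<close> contributes.\<close>

lemma form_along_curve:
  fixes \<alpha> :: "'a::euclidean_space \<Rightarrow> 'a \<Rightarrow> 'b::euclidean_space"
  assumes \<alpha>: "one_form_on S L \<alpha>" and "x \<in> S"
    and \<gamma>: "\<gamma> 0 = x" "\<forall>\<^sub>F s in at (0::real). \<gamma> s \<in> S" "(\<gamma> has_vector_derivative v) (at 0)"
    and V: "V 0 = w" "(V has_vector_derivative m) (at 0)"
  shows "((\<lambda>s. \<alpha> (\<gamma> s) (V s)) has_vector_derivative
    differential_on S (\<lambda>y. \<alpha> y w) x v + \<alpha> x m) (at 0)"
proof -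
  have lin: "linear (\<alpha> y)" if "y \<in> S" for y
    using \<alpha> that unfolding one_form_on_def by blast
  have diff: "(\<lambda>y. \<alpha> y u) differentiable (at x within S)" for u
    using \<alpha> \<open>x \<in> S\<close> unfolding one_form_on_def by (blast intro: smooth_map_on_differentiable)
  note d = differential_on_along_curve[OF diff \<open>x \<in> S\<close> \<gamma>]
  let ?r = "\<lambda>s. \<Sum>b\<in>Basis. ((V s - w) \<bullet> b) *\<^sub>R \<alpha> (\<gamma> s) b"
  have "((\<lambda>s. (V s - w) \<bullet> b) has_real_derivative m \<bullet> b) (at 0)" for b
    using bounded_linear.has_vector_derivative[OF bounded_linear_inner_left
        has_vector_derivative_diff[OF V(2) has_vector_derivative_const[of w]], of b]
    by (simp add: has_real_derivative_iff_has_vector_derivative)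
  then have "((\<lambda>s. ((V s - w) \<bullet> b) *\<^sub>R \<alpha> (\<gamma> s) b) has_vector_derivative (m \<bullet> b) *\<^sub>R \<alpha> x b) (at 0)" for b
    using has_vector_derivative_scaleR[OF _ d[of b]] V(1) \<gamma>(1) by fastforce
  then have "(?r has_vector_derivative (\<Sum>b\<in>Basis. (m \<bullet> b) *\<^sub>R \<alpha> x b)) (at 0)"
    by (intro has_vector_derivative_sum)
  moreover have expand: "(\<Sum>b\<in>Basis. (u \<bullet> b) *\<^sub>R \<alpha> y b) = \<alpha> y u" if "y \<in> S" for u y
    by (subst (2) euclidean_representation[symmetric])
      (simp add: linear_sum[OF lin[OF that]] linear_scale[OF lin[OF that]] del: euclidean_representation)
  ultimately have "((\<lambda>s. \<alpha> (\<gamma> s) w + ?r s) has_vector_derivative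
      differential_on S (\<lambda>y. \<alpha> y w) x v + \<alpha> x m) (at 0)"
    using \<open>x \<in> S\<close> by (intro has_vector_derivative_add d) auto
  moreover have "\<alpha> (\<gamma> s) w + ?r s = \<alpha> (\<gamma> s) (V s)" if "\<gamma> s \<in> S" for s
    using that by (simp only: expand linear_diff[OF lin[OF that]]) simp
  moreover from this have "\<forall>\<^sub>F s in at 0. \<alpha> (\<gamma> s) w + ?r s = \<alpha> (\<gamma> s) (V s)"
    using \<gamma>(2) by (auto elim: eventually_mono)
  ultimately show ?thesis
    using \<gamma>(1) \<open>x \<in> S\<close> unfolding has_vector_derivative_def
    by (elim has_derivative_transform_eventually) auto
qed

text \<open>The invariant formula for d\<alpha>, in which \<open>m - n\<close>, the difference of
  the derivatives of the two extended vectors, plays the role of the Lie bracket. It allows the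
  constant extensions used by \<open>ext_deriv\<close> to be replaced by left-invariant or
  tangential ones.\<close>

lemma ext_deriv_along_curves:
  fixes \<alpha> :: "'a::euclidean_space \<Rightarrow> 'a \<Rightarrow> 'b::euclidean_space"
  assumes \<alpha>: "one_form_on S L \<alpha>" and "x \<in> S"
    and \<gamma>: "\<gamma> 0 = x" "\<forall>\<^sub>F s in at (0::real). \<gamma> s \<in> S" "(\<gamma> has_vector_derivative v) (at 0)"
    and V: "V 0 = w" "(V has_vector_derivative m) (at 0)"
    and \<delta>: "\<delta> 0 = x" "\<forall>\<^sub>F s in at (0::real). \<delta> s \<in> S" "(\<delta> has_vector_derivative w) (at 0)"
    and W: "W 0 = v" "(W has_vector_derivative n) (at 0)"
    and d: "((\<lambda>s. \<alpha> (\<gamma> s) (V s)) has_vector_derivative d1) (at 0)"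
      "((\<lambda>s. \<alpha> (\<delta> s) (W s)) has_vector_derivative d2) (at 0)"
  shows "ext_deriv S \<alpha> x v w = d1 - d2 - \<alpha> x (m - n)"
proof -
  have lin: "linear (\<alpha> x)"
    using \<alpha> \<open>x \<in> S\<close> unfolding one_form_on_def by blast
  show ?thesis
    using vector_derivative_unique_at[OF form_along_curve[OF \<alpha> \<open>x \<in> S\<close> \<gamma> V] d(1)]
      vector_derivative_unique_at[OF form_along_curve[OF \<alpha> \<open>x \<in> S\<close> \<delta> W] d(2)]
    by (simp add: ext_deriv_def linear_diff[OF lin] algebra_simps)
qed

text \<open>The curve is the normalised straight line; the norm of \<open>x + s *\<^sub>R v\<close>
  is stationary at \<open>s = 0\<close> because \<open>v\<close> is orthogonal to
  \<open>x\<close>.\<close>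

lemma sphere_curve:
  fixes x v :: "'a::euclidean_space"
  assumes "norm x = 1" "x \<bullet> v = 0"
  obtains \<gamma> where "\<gamma> 0 = x" "\<forall>s::real. norm (\<gamma> s) = 1" "(\<gamma> has_vector_derivative v) (at 0)"
proof -
  let ?\<gamma> = "\<lambda>s. inverse (norm (x + s *\<^sub>R v)) *\<^sub>R (x + s *\<^sub>R v)"
  have ne: "x + s *\<^sub>R v \<noteq> 0" for s
  proof
    assume "x + s *\<^sub>R v = 0"
    then have "x \<bullet> (x + s *\<^sub>R v) = 0" by simp
    then show False
      using assms by (simp add: inner_add_right dot_square_norm)
  qed
  have line: "((\<lambda>s. x + s *\<^sub>R v) has_derivative (\<lambda>s. s *\<^sub>R v)) (at 0)"
    by (auto intro!: derivative_eq_intros)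
  have "((\<lambda>s. norm (x + s *\<^sub>R v)) has_derivative (\<lambda>s. (s *\<^sub>R v) \<bullet> sgn x)) (at 0)"
    using has_derivative_compose[OF line, of norm "\<lambda>h. h \<bullet> sgn x"] ne[of 0]
    by (simp add: has_derivative_norm)
  moreover have "(\<lambda>s. (s *\<^sub>R v) \<bullet> sgn x) = (*) 0"
    using assms by (simp add: fun_eq_iff sgn_div_norm inner_commute)
  ultimately have "((\<lambda>s. norm (x + s *\<^sub>R v)) has_real_derivative 0) (at 0)"
    by (simp add: has_field_derivative_def)
  then have "((\<lambda>s. inverse (norm (x + s *\<^sub>R v))) has_real_derivative 0) (at 0)"
    using DERIV_inverse'[of "\<lambda>s. norm (x + s *\<^sub>R v)" 0 0 UNIV] ne[of 0] by simp
  from has_vector_derivative_scaleR[OF this, of "\<lambda>s. x + s *\<^sub>R v" v] line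
  have "(?\<gamma> has_vector_derivative v) (at 0)"
    using assms(1) by (simp add: has_vector_derivative_def)
  then show thesis
    using assms(1) ne by (intro that[of ?\<gamma>]) auto
qed

lemma sphere_velocity:
  fixes \<gamma> :: "real \<Rightarrow> 'a::euclidean_space"
  assumes "norm (\<gamma> 0) = 1" "\<forall>\<^sub>F s in at (0::real). norm (\<gamma> s) = 1" "(\<gamma> has_vector_derivative v) (at 0)"
  shows "\<gamma> 0 \<bullet> v = 0"
proof -
  have "((\<lambda>s. \<gamma> s \<bullet> \<gamma> s) has_vector_derivative \<gamma> 0 \<bullet> v + v \<bullet> \<gamma> 0) (at 0)"
    using bounded_bilinear.has_vector_derivative[OF bounded_bilinear_inner assms(3,3)] .
  moreover have "((\<lambda>s. \<gamma> s \<bullet> \<gamma> s) has_vector_derivative 0) (at 0)"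
  proof -
    have "((\<lambda>s::real. 1::real) has_derivative (\<lambda>x. x *\<^sub>R 0)) (at 0)"
      by simp
    then show ?thesis
      unfolding has_vector_derivative_def
    proof (rule has_derivative_transform_eventually)
      show "\<forall>\<^sub>F s in at 0. 1 = \<gamma> s \<bullet> \<gamma> s"
        using assms(2) by (rule eventually_mono) (simp add: dot_square_norm)
    qed (use assms(1) in \<open>auto simp: dot_square_norm\<close>)
  qed
  ultimately have "\<gamma> 0 \<bullet> v + v \<bullet> \<gamma> 0 = 0"
    by (rule vector_derivative_unique_at)
  then show ?thesis by (simp add: inner_commute)
qed


section \<open>Quaternions\<close>

lemma bounded_bilinear_qmul: "bounded_bilinear qmul"
  unfolding bilinear_conv_bounded_bilinear[symmetric] bilinear_def
  by (auto intro!: linearI simp: qmul_def inner_add_left inner_add_right scaleR_add_right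
      scaleR_add_left cross_add_left cross_add_right cross_mult_left cross_mult_right algebra_simps)

interpretation qmul: bounded_bilinear qmul
  by (rule bounded_bilinear_qmul)

lemma bounded_linear_qcnj: "bounded_linear qcnj"
  unfolding linear_conv_bounded_linear[symmetric]
  by (auto intro!: linearI simp: qcnj_def)

lemma qcnj_linear:
  "qcnj (x + y) = qcnj x + qcnj y" "qcnj (x - y) = qcnj x - qcnj y" "qcnj (- x) = - qcnj x"
  "qcnj (r *\<^sub>R x) = r *\<^sub>R qcnj x" "qcnj 0 = 0"
  by (simp_all add: qcnj_def prod_eq_iff)

lemma qcnj_qcnj [simp]: "qcnj (qcnj x) = x"
  by (simp add: qcnj_def)

lemma qone_qmul [simp]: "qone \<odot> x = x" "x \<odot> qone = x" "qcnj qone = qone"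
  by (simp_all add: qone_def qmul_def qcnj_def)

lemma norm_qcnj [simp]: "norm (qcnj q) = norm q"
  by (cases q) (simp add: qcnj_def norm_Pair)

lemma norm_quat_sq: "(norm q)\<^sup>2 = fst q ^ 2 + snd q \<bullet> snd q" for q :: quat
  by (cases q) (simp add: norm_Pair dot_square_norm)

text \<open>Euler's four-square identity.\<close>

lemma norm_qmul: "norm (p \<odot> q) = norm p * norm q"
proof -
  have "(norm (p \<odot> q))\<^sup>2 = (norm p * norm q)\<^sup>2"
    unfolding power_mult_distrib norm_quat_sq
    by (simp add: qmul_def inner_vec_def sum_3 cross3_def power2_eq_square algebra_simps)
  then show ?thesis
    by (simp add: power2_eq_iff_nonneg)
qed

lemma qmul_qcnj: "q \<odot> qcnj q = (norm q)\<^sup>2 *\<^sub>R qone" "qcnj q \<odot> q = (norm q)\<^sup>2 *\<^sub>R qone"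
  unfolding norm_quat_sq by (simp_all add: qcnj_def qmul_def qone_def power2_eq_square)

lemma SU2_closed [simp]:
  "qone \<in> SU2" "a \<in> SU2 \<Longrightarrow> b \<in> SU2 \<Longrightarrow> a \<odot> b \<in> SU2" "a \<in> SU2 \<Longrightarrow> qcnj a \<in> SU2"
  by (simp_all add: SU2_def norm_qmul qone_def norm_Pair)

lemma SU2_inverse [simp]: "a \<in> SU2 \<Longrightarrow> a \<odot> qcnj a = qone" "a \<in> SU2 \<Longrightarrow> qcnj a \<odot> a = qone"
  by (simp_all add: SU2_def qmul_qcnj)

lemma SU2_cancel [simp]:
  assumes "a \<in> SU2"
  shows "qcnj a \<odot> (a \<odot> x) = x" "a \<odot> (qcnj a \<odot> x) = x"
  using assms by (simp_all flip: qmul_assoc)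

lemma norm_qone [simp]: "norm qone = 1"
  by (simp add: qone_def norm_Pair)

lemma su2_iff_qcnj: "u \<in> su2 \<longleftrightarrow> qcnj u = - u"
  by (auto simp: su2_def qcnj_def prod_eq_iff)

lemma subspace_su2: "subspace su2"
  by (auto simp: subspace_def su2_def)

lemma su2_conj: "u \<in> su2 \<Longrightarrow> a \<odot> u \<odot> qcnj a \<in> su2"
  by (simp add: su2_iff_qcnj qcnj_qmul qmul_assoc qmul.minus_left qmul.minus_right)

lemma inner_polarization: "x \<bullet> y = ((norm (x + y))\<^sup>2 - (norm x)\<^sup>2 - (norm y)\<^sup>2) / 2"
  by (simp add: power2_norm_eq_inner inner_add_left inner_add_right inner_commute)

lemma inner_qmul_left: "(a \<odot> x) \<bullet> (a \<odot> y) = (norm a)\<^sup>2 * (x \<bullet> y)"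
proof -
  show ?thesis
    unfolding inner_polarization[of x y] inner_polarization[of "a \<odot> x"]
    by (simp add: norm_qmul power_mult_distrib algebra_simps flip: qmul.add_right)
qed

lemma inner_qone: "qone \<bullet> u = fst u"
  by (cases u) (simp add: qone_def)

lemma su2_inner_SU2: "a \<in> SU2 \<Longrightarrow> a \<bullet> (a \<odot> u) = fst u"
  using inner_qmul_left[of a qone u] by (simp add: SU2_def inner_qone)

lemma tangent_SU2:
  assumes "a \<in> SU2" "a \<bullet> v = 0"
  obtains u where "u \<in> su2" "v = a \<odot> u"
proof -
  have "fst (qcnj a \<odot> v) = 0"
    using su2_inner_SU2[OF assms(1), of "qcnj a \<odot> v"] assms by simp
  then show thesis
    using assms by (intro that[of "qcnj a \<odot> v"]) (auto simp: su2_def)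
qed

lemma bounded_linear_qmul_both: "bounded_linear (\<lambda>x. a \<odot> x \<odot> b)"
  by (intro bounded_linear_compose[OF qmul.bounded_linear_left qmul.bounded_linear_right])

section \<open>Radial functions\<close>

lemma radial_has_derivative:
  fixes p :: "'a::real_inner" and g :: "real \<Rightarrow> 'b::real_normed_vector"
  assumes "(g has_vector_derivative d) (at (norm p))" "p \<noteq> 0"
  shows "((\<lambda>p. g (norm p)) has_derivative (\<lambda>v. (p \<bullet> v / norm p) *\<^sub>R d)) (at p)"
proof -
  have "((\<lambda>p. g (norm p)) has_derivative (\<lambda>v. (v \<bullet> sgn p) *\<^sub>R d)) (at p)"
    using has_derivative_compose[OF has_derivative_norm[OF assms(2)]] assms(1)
    unfolding has_vector_derivative_def by blast
  then show ?thesis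
    by (simp add: sgn_div_norm inner_commute divide_inverse mult.commute)
qed

text \<open>The norm is not differentiable at the origin, but a vanishing one-sided derivative says
  that g(s) - g(0) = o(s), and this passes to s = |p|.\<close>

lemma radial_has_derivative_0:
  fixes g :: "real \<Rightarrow> 'b::real_normed_vector"
  assumes "(g has_vector_derivative 0) (at 0 within {0..})"
  shows "((\<lambda>p::'a::real_inner. g (norm p)) has_derivative (\<lambda>v. 0)) (at 0)"
  unfolding has_derivative_at_alt
proof (intro conjI allI impI)
  fix e :: real assume "e > 0"
  then obtain d where "d > 0" "\<And>s. s \<in> {0..} \<Longrightarrow> norm (s - 0) < d \<Longrightarrow> norm (g s - g 0) \<le> e * norm (s - 0)"
    using assms unfolding has_vector_derivative_def has_derivative_within_alt by auto
  then show "\<exists>d>0. \<forall>y::'a. norm (y - 0) < d \<longrightarrow> norm (g (norm y) - g (norm (0::'a)) - 0) \<le> e * norm (y - 0)"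
    by (intro exI[of _ d]) auto
qed simp


section \<open>The Bryant--Salamon functions\<close>

definition bs_f :: "real \<Rightarrow> real" where "bs_f s = 1 / sqrt (1 - 1 / s ^ 3)"

lemma bs_f_pos: "1 < s \<Longrightarrow> 1 < bs_f s"
proof -
  assume "1 < s"
  then have "1 < s ^ 3" by simp
  then have "0 < 1 - 1 / s ^ 3" "1 - 1 / s ^ 3 < 1"
    using \<open>1 < s\<close> by (auto simp: field_simps)
  then show ?thesis
    unfolding bs_f_def by (subst less_divide_eq_1_pos) auto
qed

text \<open>On (1, r] one has 1 - s^-3 \<ge> (s - 1) / s \<ge> (s - 1) / r, so the integrand is
  dominated by a multiple of (s - 1)^(-1/2), which has the antiderivative 2 (s - 1)^(1/2).\<close>

lemma bs_f_integrable: "bs_f integrable_on {1..r}"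
proof (cases "1 \<le> r")
  case True
  let ?g = "\<lambda>s. sqrt r / sqrt (s - 1)"
  have "(?g has_integral 2 * sqrt r * sqrt (r - 1) - 2 * sqrt r * sqrt (1 - 1)) {1..r}"
  proof (rule fundamental_theorem_of_calculus_interior)
    show "continuous_on {1..r} (\<lambda>s. 2 * sqrt r * sqrt (s - 1))"
      by (intro continuous_intros)
    fix s assume "s \<in> {1<..<r}"
    then show "((\<lambda>s. 2 * sqrt r * sqrt (s - 1)) has_vector_derivative ?g s) (at s)"
      unfolding has_real_derivative_iff_has_vector_derivative[symmetric]
      by (auto intro!: derivative_eq_intros simp: field_simps)
  qed (use True in auto)
  then have g: "?g integrable_on {1..r}"
    by blast
  show ?thesis
  proof (rule measurable_bounded_by_integrable_imp_integrable[OF _ g])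
    have "bs_f \<in> borel_measurable borel"
      unfolding bs_f_def by measurable
    then have "bs_f \<in> borel_measurable lebesgue"
      by (simp add: borel_measurable_if_D measurable_completion)
    then show "bs_f \<in> borel_measurable (lebesgue_on {1..r})"
      by (rule measurable_restrict_space1)
    fix s assume s: "s \<in> {1..r}"
    show "norm (bs_f s) \<le> ?g s"
    \<comment> \<open>At \<open>s = 1\<close> both sides are 0, by division by zero.\<close>
    proof (cases "s = 1")
      case True
      then show ?thesis by (simp add: bs_f_def)
    next
      case False
      with s have "s > 1" by simp
      have "(s - 1) / r \<le> (s - 1) / s"
        using s \<open>s > 1\<close> by (intro divide_left_mono) auto
      also have "(s - 1) / s \<le> 1 - 1 / s ^ 3"
      proof -
        have "1 / s ^ 3 \<le> 1 / s"
          using \<open>s > 1\<close> power_increasing[of 1 3 s] by (intro divide_left_mono) auto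
        then show ?thesis
          using \<open>s > 1\<close> by (simp add: diff_divide_distrib)
      qed
      finally have "sqrt ((s - 1) / r) \<le> sqrt (1 - 1 / s ^ 3)"
        by (rule real_sqrt_le_mono)
      moreover have "0 < sqrt ((s - 1) / r)"
        using s \<open>s > 1\<close> by simp
      ultimately have "bs_f s \<le> 1 / sqrt ((s - 1) / r)"
        unfolding bs_f_def by (intro divide_left_mono) auto
      then show ?thesis
        using bs_f_pos[OF \<open>s > 1\<close>] by (simp add: real_sqrt_divide)
    qed
  qed auto
qed auto

lemma bs_t_alt: "bs_t r = integral {1..r} bs_f"
  by (simp add: bs_t_def bs_f_def[abs_def])

lemma bs_t_continuous: "continuous_on {1..r} bs_t"
  using indefinite_integral_continuous_1[OF bs_f_integrable] by (simp add: bs_t_alt[abs_def])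

lemma bs_t_deriv:
  assumes "1 < r"
  shows "(bs_t has_real_derivative bs_f r) (at r)"
proof -
  have "r ^ 3 \<noteq> 1"
    using one_less_power[OF assms, of 3] by linarith
  then have "1 - 1 / r ^ 3 \<noteq> 0"
    using assms by (simp add: field_simps)
  then have "isCont bs_f r"
    using assms unfolding bs_f_def
    by (intro continuous_intros) (simp_all only: real_sqrt_eq_0_iff, auto)
  then have "((\<lambda>u. integral {1..u} bs_f) has_vector_derivative bs_f r) (at r within ({1..r + 1} - {}))"
    using assms by (intro integral_has_vector_derivative_continuous_at bs_f_integrable)
      (auto intro: continuous_at_imp_continuous_within)
  moreover have "at r within {1..r + 1} = at r"
    using assms by (intro at_within_interior) auto
  ultimately show ?thesis
    by (simp add: bs_t_alt[abs_def] has_real_derivative_iff_has_vector_derivative)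
qed

lemma bs_t_1 [simp]: "bs_t 1 = 0"
  by (simp add: bs_t_alt)

lemma bs_t_strict_mono:
  assumes "1 \<le> r" "r < s"
  shows "bs_t r < bs_t s"
proof (rule DERIV_pos_imp_increasing_open[OF assms(2)])
  fix x assume "r < x" "x < s"
  then show "\<exists>y. (bs_t has_real_derivative y) (at x) \<and> 0 < y"
    using bs_t_deriv[of x] bs_f_pos[of x] assms by (intro exI[of _ "bs_f x"]) auto
next
  show "continuous_on {r..s} bs_t"
    using bs_t_continuous assms by (rule_tac continuous_on_subset) auto
qed

text \<open>The integrand exceeds 1. The resulting growth makes every t \<ge> 0 a value of
  \<open>bs_t\<close>.\<close>

lemma bs_t_ge:
  assumes "1 \<le> r"
  shows "r - 1 \<le> bs_t r"
proof (cases "r = 1")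
  case False
  have "bs_t 1 - 1 < bs_t r - r"
  proof (rule DERIV_pos_imp_increasing_open[of 1 r "\<lambda>x. bs_t x - x"])
    fix x assume "1 < x" "x < r"
    then show "\<exists>y. ((\<lambda>x. bs_t x - x) has_real_derivative y) (at x) \<and> 0 < y"
      using bs_t_deriv[of x] bs_f_pos[of x]
      by (intro exI[of _ "bs_f x - 1"]) (auto intro!: derivative_eq_intros)
  qed (use False assms in \<open>auto intro!: continuous_intros bs_t_continuous\<close>)
  then show ?thesis by simp
qed simp

lemma bs_t_inj: "inj_on bs_t {1..}"
  by (metis atLeast_iff bs_t_strict_mono inj_onI less_irrefl linorder_neqE_linordered_idom)

lemma bs_t_surj:
  assumes "0 \<le> t"
  shows "t \<in> bs_t ` {1..}"
proof -
  have "\<exists>x\<ge>1. x \<le> t + 1 \<and> bs_t x = t"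
    using assms bs_t_ge[of "t + 1"] by (intro IVT' bs_t_continuous) auto
  then show ?thesis by auto
qed

lemma bs_r:
  assumes "0 \<le> t"
  shows "1 \<le> bs_r t" "bs_t (bs_r t) = t"
  using inv_into_into[OF bs_t_surj[OF assms]] f_inv_into_f[OF bs_t_surj[OF assms]]
  by (simp_all add: bs_r_def)

lemma bs_r_bs_t: "1 \<le> r \<Longrightarrow> bs_r (bs_t r) = r"
  by (simp add: bs_r_def inv_into_f_f[OF bs_t_inj])

lemma bs_r_0 [simp]: "bs_r 0 = 1"
  using bs_r_bs_t[of 1] by simp

lemma bs_r_gt: "0 < t \<Longrightarrow> 1 < bs_r t"
  by (metis bs_r bs_t_1 less_eq_real_def less_irrefl)

lemma bs_r_continuous: "continuous_on {0..} bs_r"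
proof -
  have "continuous_on {0..bs_t b} bs_r" if "1 \<le> b" for b
  proof -
    have "continuous_on (bs_t ` {1..b}) bs_r"
      by (rule continuous_on_inv[OF bs_t_continuous]) (auto simp: bs_r_bs_t)
    moreover have "{0..bs_t b} \<subseteq> bs_t ` {1..b}"
    proof
      fix t assume t: "t \<in> {0..bs_t b}"
      then have "bs_r t \<le> b"
        using bs_r[of t] bs_t_strict_mono[OF that, of "bs_r t"] by force
      then show "t \<in> bs_t ` {1..b}"
        using bs_r[of t] t by (metis atLeastAtMost_iff image_eqI)
    qed
    ultimately show ?thesis
      by (rule continuous_on_subset)
  qed
  then have "continuous (at t within {0..}) bs_r" if "0 \<le> t" for t
  proof -
    \<comment> \<open>The bound \<open>bs_t_ge\<close> gives bs_t(t + 2) \<ge> t + 1, so the compact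
      interval contains a one-sided or full neighbourhood of t in [0, \<infinity>).\<close>
    have "continuous_on {0..bs_t (t + 2)} bs_r" "t < bs_t (t + 2)"
      using \<open>\<And>b. 1 \<le> b \<Longrightarrow> continuous_on {0..bs_t b} bs_r\<close> bs_t_ge[of "t + 2"] that by auto
    moreover from this have "at t within {0..bs_t (t + 2)} = at t within {0..}"
      using that by (intro at_within_nhd[of _ "{..<bs_t (t + 2)}"]) auto
    ultimately show ?thesis
      using that by (simp add: continuous_on_eq_continuous_within) (metis atLeastAtMost_iff less_imp_le)
  qed
  then show ?thesis
    by (simp add: continuous_on_eq_continuous_within)
qed

text \<open>This is dr/dt, by \<open>bs_r_deriv\<close>, and A = r v / 3.\<close>

definition bs_v :: "real \<Rightarrow> real" where "bs_v t = sqrt (1 - 1 / bs_r t ^ 3)"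

lemma bs_v_sq: "0 \<le> t \<Longrightarrow> bs_v t ^ 2 = 1 - 1 / bs_r t ^ 3"
  using bs_r(1)[of t] by (simp add: bs_v_def field_simps)

lemma bs_v_pos: "0 < t \<Longrightarrow> 0 < bs_v t"
  using bs_r_gt[of t] by (simp add: bs_v_def field_simps)

lemma bs_v_0 [simp]: "bs_v 0 = 0"
  by (simp add: bs_v_def)

lemma bs_v_continuous: "continuous_on {0..} bs_v"
proof -
  have "bs_r t \<noteq> 0" if "t \<in> {0..}" for t
    using bs_r(1)[of t] that by force
  then show ?thesis
    unfolding bs_v_def[abs_def] by (intro continuous_intros bs_r_continuous) auto
qed

lemma bs_r_deriv:
  assumes "0 < t"
  shows "(bs_r has_real_derivative bs_v t) (at t)"
proof -
  have "(bs_r has_real_derivative inverse (bs_f (bs_r t))) (at t)"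
  proof (rule DERIV_inverse_function)
    show "(bs_t has_real_derivative bs_f (bs_r t)) (at (bs_r t))"
      using bs_t_deriv bs_r_gt[OF assms] by blast
    show "isCont bs_r t"
      using bs_r_continuous assms continuous_on_interior[of "{0..}" bs_r t] by simp
    show "bs_f (bs_r t) \<noteq> 0"
      using bs_f_pos[OF bs_r_gt[OF assms]] by simp
    show "0 < t" "t < t + 1" "\<And>y. 0 < y \<Longrightarrow> bs_t (bs_r y) = y"
      using assms bs_r by auto
  qed
  then show ?thesis
    by (simp add: bs_f_def bs_v_def)
qed

text \<open>Differentiating v^2 = 1 - r^-3 with r' = v gives 2 v v' = 3 r^-4 v. The cancellation of
  v is what keeps v' regular as t tends to 0, where the square root in v vanishes.\<close>

lemma bs_v_deriv:
  assumes "0 < t"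
  shows "(bs_v has_real_derivative 3 / 2 / bs_r t ^ 4) (at t)"
proof -
  have r: "1 < bs_r t" by (rule bs_r_gt[OF assms])
  then have pos: "0 < 1 - 1 / bs_r t ^ 3" by (simp add: field_simps)
  have d1: "((\<lambda>t. 1 - 1 / bs_r t ^ 3) has_real_derivative 3 * bs_v t / bs_r t ^ 4) (at t)"
    using r by (auto intro!: derivative_eq_intros bs_r_deriv[OF assms] simp: field_simps power_numeral_reduce)
  have "(bs_v has_real_derivative (3 * bs_v t / bs_r t ^ 4) * (inverse (sqrt (1 - 1 / bs_r t ^ 3)) / 2)) (at t)"
    unfolding bs_v_def[abs_def] using DERIV_chain2[OF DERIV_real_sqrt[OF pos] d1]
    by (simp add: mult.commute bs_v_def)
  then show ?thesis
    using bs_v_pos[OF assms] by (simp add: bs_v_def[symmetric] field_simps)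
qed

text \<open>The quotient v(t) / t, written as the average of v' over [0, t] so that it makes sense
  at t = 0, with value 3/2.\<close>

definition bs_k :: "real \<Rightarrow> real" where "bs_k t = integral {0..1} (\<lambda>s. 3 / 2 / bs_r (s * t) ^ 4)"

lemma bs_v_eq:
  assumes "0 \<le> t"
  shows "bs_v t = t * bs_k t"
proof (cases "t = 0")
  case False
  with assms have "t > 0" by simp
  have "((\<lambda>s. t * (3 / 2 / bs_r (s * t) ^ 4)) has_integral bs_v (1 * t) - bs_v (0 * t)) {0..1}"
  proof (rule fundamental_theorem_of_calculus_interior)
    show "continuous_on {0..1} (\<lambda>s. bs_v (s * t))"
      using assms by (intro continuous_on_compose2[OF bs_v_continuous] continuous_intros) auto
    fix s :: real assume "s \<in> {0<..<1}"
    then have "s * t > 0" using \<open>t > 0\<close> by simp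
    have "((\<lambda>s. bs_v (s * t)) has_real_derivative 3 / 2 / bs_r (s * t) ^ 4 * t) (at s)"
      by (rule DERIV_chain2[where g = "\<lambda>s. s * t", OF bs_v_deriv[OF \<open>s * t > 0\<close>]])
        (auto intro!: derivative_eq_intros)
    then show "((\<lambda>s. bs_v (s * t)) has_vector_derivative t * (3 / 2 / bs_r (s * t) ^ 4)) (at s)"
      by (simp add: has_real_derivative_iff_has_vector_derivative mult.commute)
  qed simp
  then have "integral {0..1} (\<lambda>s. t * (3 / 2 / bs_r (s * t) ^ 4)) = bs_v t"
    by (simp add: integral_unique)
  then show ?thesis
    by (simp add: bs_k_def del: times_divide_eq_right)
qed simp

lemma bs_k_le:
  assumes "0 \<le> t"
  shows "bs_k t \<le> 3 / 2"
proof -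
  have r: "1 \<le> bs_r (s * t)" if "0 \<le> s" for s
    using bs_r(1)[of "s * t"] assms that by simp
  have "continuous_on {0..1} (\<lambda>s. 3 / 2 / bs_r (s * t) ^ 4)"
    using assms r by (intro continuous_intros continuous_on_compose2[OF bs_r_continuous]) fastforce+
  then have "bs_k t \<le> integral {0..1} (\<lambda>s::real. 3 / 2)"
    unfolding bs_k_def
  proof (intro integral_le integrable_continuous_interval)
    fix s :: real assume "s \<in> {0..1}"
    then have "1 \<le> bs_r (s * t) ^ 4" using r by (simp add: one_le_power)
    then have "(3 / 2) / bs_r (s * t) ^ 4 \<le> (3 / 2) / 1"
      by (intro divide_left_mono) auto
    then show "3 / 2 / bs_r (s * t) ^ 4 \<le> 3 / 2"
      by (simp only: div_by_1)
  qed auto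
  then show ?thesis by simp
qed

text \<open>By the mean value theorem r(y) - 1 = v(z) y for some z in (0, y), and v(z) \<le> 3 z /
  2.\<close>

lemma bs_r_deriv_0: "(bs_r has_vector_derivative 0) (at 0 within {0..})"
  unfolding has_vector_derivative_def has_derivative_within_alt
proof (intro conjI allI impI)
  fix e :: real assume "e > 0"
  have "norm (bs_r y - bs_r 0 - (y - 0) *\<^sub>R 0) \<le> e * norm (y - 0)"
    \<comment> \<open>The radius turns the bound 3 z / 2 on v(z) into e.\<close>
    if "y \<in> {0..}" "norm (y - 0) < e * 2 / 3" for y
  proof (cases "y = 0")
    case False
    with that have "y > 0" by simp
    obtain z where "0 < z" "z < y" "bs_r y - bs_r 0 = bs_v z * (y - 0)"
    proof (rule mvt[of 0 y bs_r "\<lambda>z. (*) (bs_v z)", OF \<open>y > 0\<close>])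
      show "continuous_on {0..y} bs_r"
        by (rule continuous_on_subset[OF bs_r_continuous]) auto
    qed (use bs_r_deriv in \<open>auto simp: has_field_derivative_def\<close>)
    then have z: "0 < z" "z < y" "bs_r y - bs_r 0 = bs_v z * y"
      by simp_all
    have "bs_v z \<le> z * (3 / 2)"
      using z bs_k_le[of z] by (subst bs_v_eq) (auto intro: mult_left_mono)
    also have "\<dots> \<le> e"
      using z that by simp
    finally show ?thesis
      using z bs_v_pos[OF z(1)] by (simp add: mult_right_mono)
  qed simp
  then show "\<exists>d>0. \<forall>y\<in>{0..}. norm (y - 0) < d \<longrightarrow> norm (bs_r y - bs_r 0 - (y - 0) *\<^sub>R 0) \<le> e * norm (y - 0)"
    using \<open>e > 0\<close> by (intro exI[of _ "e * 2 / 3"]) auto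
qed simp

text \<open>The factor v(|p|) = |p| k(|p|) cancels the denominator of the differential of the norm,
  so that one formula covers the origin as well.\<close>

lemma bs_r_norm_has_derivative:
  fixes p :: "'a::real_inner"
  shows "((\<lambda>p. bs_r (norm p)) has_derivative (\<lambda>v. bs_k (norm p) * (p \<bullet> v))) (at p)"
proof (cases "p = 0")
  case True
  then show ?thesis using radial_has_derivative_0[OF bs_r_deriv_0] by simp
next
  case False
  then have "(bs_r has_vector_derivative norm p * bs_k (norm p)) (at (norm p))"
    using bs_r_deriv[of "norm p"] bs_v_eq[of "norm p"]
    by (simp add: has_real_derivative_iff_has_vector_derivative)
  from radial_has_derivative[OF this False] show ?thesis
    using False by (simp add: mult.commute)
qed

text \<open>Bootstrapping: if r(|p|) is C^k, so is k(|p|), an average of (3/2) r^-4 along rays; and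
  the derivative of r(|p|) is k(|p|) times a linear function of p, so r(|p|) is C^(k+1).\<close>

lemma bs_r_norm_Ck: "Ck_on k UNIV (\<lambda>p::'a::euclidean_space. bs_r (norm p))"
  and bs_k_norm_Ck: "Ck_on k UNIV (\<lambda>p::'a::euclidean_space. bs_k (norm p))"
proof -
  have k: "Ck_on k UNIV (\<lambda>p::'a. bs_k (norm p))" if "Ck_on k UNIV (\<lambda>p::'a. bs_r (norm p))" for k
  proof -
    have "Ck_on k UNIV (\<lambda>p::'a. 3 / 2 * inverse (bs_r (norm p)) ^ 4)"
    proof (intro Ck_on_mult Ck_on_power Ck_on_inverse open_UNIV Ck_on_const that)
      show "bs_r (norm x) \<noteq> 0" for x :: 'a
        using bs_r(1)[OF norm_ge_zero, of x] by linarith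
    qed
    from Ck_on_integral_ray[OF this, of 0]
    have "Ck_on k UNIV (\<lambda>x::'a. integral {0..1}
        (\<lambda>s. s ^ 0 * (3 / 2 * inverse (bs_r (norm (s *\<^sub>R x))) ^ 4)))" .
    moreover have "integral {0..1} (\<lambda>s. s ^ 0 * (3 / 2 * inverse (bs_r (norm (s *\<^sub>R x))) ^ 4))
        = bs_k (norm x)" for x :: 'a
      unfolding bs_k_def by (rule integral_cong) (simp add: field_simps)
    ultimately show ?thesis by (simp only:)
  qed
  show "Ck_on k UNIV (\<lambda>p::'a. bs_r (norm p))" for k
  proof (induction k)
    case 0
    show ?case
      by (auto intro!: continuous_at_imp_continuous_on has_derivative_continuous[OF bs_r_norm_has_derivative])
  next
    case (Suc k)
    show ?case
      by (rule Ck_on_SucI[OF open_UNIV bs_r_norm_has_derivative])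
        (intro Ck_on_mult k[OF Suc] Ck_on_bounded_linear bounded_linear_inner_left open_UNIV)
  qed
  then show "Ck_on k UNIV (\<lambda>p::'a. bs_k (norm p))"
    by (rule k)
qed

section \<open>The coefficients A and B\<close>

lemma bs_A_eq: "bs_A t = bs_r t * bs_v t / 3"
  by (simp add: bs_A_def bs_v_def)

lemma bs_B_sq: "bs_B t ^ 2 = bs_r t ^ 2 / 3"
  by (simp add: bs_B_def power_divide)

lemma bs_A_pos: "0 < t \<Longrightarrow> 0 < bs_A t"
  using bs_v_pos[of t] bs_r_gt[of t] by (simp add: bs_A_eq)

lemma bs_B_pos: "0 < t \<Longrightarrow> 0 < bs_B t"
  using bs_r_gt[of t] by (simp add: bs_B_def)

text \<open>Both A^2 / B^2 = v^2 / 3 and A' reduce to functions of r, with common value 1/3 + 1/(6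
  r^3). The derivative is stated in A and B because the instanton equation has its coefficients in
  this form.\<close>

lemma bs_A_deriv:
  assumes "0 < t"
  shows "(bs_A has_real_derivative (1 - bs_A t ^ 2 / bs_B t ^ 2) / 2) (at t)"
proof -
  have r: "1 < bs_r t" by (rule bs_r_gt[OF assms])
  have "bs_A t ^ 2 / bs_B t ^ 2 = bs_v t ^ 2 / 3"
    using r by (simp add: bs_B_sq bs_A_eq power_mult_distrib power_divide)
  then have AB: "(1 - bs_A t ^ 2 / bs_B t ^ 2) / 2 = 1 / 3 + 1 / (6 * bs_r t ^ 3)"
    using assms by (simp add: bs_v_sq field_simps)
  have "(bs_A has_real_derivative (bs_v t * bs_v t + bs_r t * (3 / 2 / bs_r t ^ 4)) / 3) (at t)"
    unfolding bs_A_eq[abs_def]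
    by (auto intro!: derivative_eq_intros bs_r_deriv[OF assms] bs_v_deriv[OF assms])
  moreover have "(bs_v t * bs_v t + bs_r t * (3 / 2 / bs_r t ^ 4)) / 3 = 1 / 3 + 1 / (6 * bs_r t ^ 3)"
    using assms r by (simp add: bs_v_sq flip: power2_eq_square) (simp add: field_simps power_numeral_reduce)
  ultimately show ?thesis
    unfolding AB by (rule DERIV_cong)
qed

lemma bs_B_sq_deriv:
  assumes "0 < t"
  shows "((\<lambda>t. bs_B t ^ 2) has_real_derivative 2 * bs_A t) (at t)"
  unfolding bs_B_sq bs_A_eq
  by (auto intro!: derivative_eq_intros bs_r_deriv[OF assms])

lemma bs_A_le: "0 \<le> t \<Longrightarrow> bs_A t \<le> bs_r t * t / 2"
  using bs_k_le[of t] bs_r(1)[of t] mult_mono[of t t "bs_k t" "3/2"]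
  by (simp add: bs_A_eq bs_v_eq field_simps mult_left_mono)

lemma bs_A_sq:
  assumes "0 < t"
  shows "bs_A t ^ 2 = (bs_r t ^ 3 - 1) / (9 * bs_r t)"
  using assms bs_r_gt[OF assms]
  by (simp add: bs_A_eq power_mult_distrib power_divide bs_v_sq) (simp add: field_simps power_numeral_reduce)

section \<open>Wedge products of antisymmetrised tensors\<close>

text \<open>There is no factor 1 / k!: in the normalisation of \<open>wedge\<close>, the
  antisymmetrisation of a tensor product of 1-forms is then exactly their wedge product.\<close>

definition alt :: "nat \<Rightarrow> ('a, 'b::real_vector) covector \<Rightarrow> ('a, 'b) covector"
  where "alt k a v = (\<Sum>\<sigma> | \<sigma> permutes {..<k}. of_int (sign \<sigma>) *\<^sub>R a (\<lambda>i. v (\<sigma> i)))"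

lemma sign_compose_lessThan:
  "\<sigma> permutes {..<k} \<Longrightarrow> \<tau> permutes {..<k} \<Longrightarrow> sign (\<sigma> \<circ> \<tau>) = sign \<sigma> * sign \<tau>" for k :: nat
  by (intro sign_compose) (auto simp: permutation_permutes)

lemma alt_permute:
  assumes "\<tau> permutes {..<k}"
  shows "alt k (\<lambda>v. a (\<lambda>i. v (\<tau> i))) v = of_int (sign \<tau>) *\<^sub>R alt k a v"
proof -
  have "alt k a v = (\<Sum>\<sigma> | \<sigma> permutes {..<k}. of_int (sign (\<sigma> \<circ> \<tau>)) *\<^sub>R a (\<lambda>i. v ((\<sigma> \<circ> \<tau>) i)))"
    unfolding alt_def by (rule sum_permutations_compose_right[OF assms])
  also have "\<dots> = of_int (sign \<tau>) *\<^sub>R alt k (\<lambda>v. a (\<lambda>i. v (\<tau> i))) v"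
    unfolding alt_def scaleR_sum_right
    by (rule sum.cong) (auto simp: sign_compose_lessThan assms)
  finally show ?thesis
    by (auto simp: sign_def)
qed

text \<open>A permutation \<pi> of the first k slots can be absorbed into the outer permutation: the
  pair (\<sigma>, \<pi>) contributes the term of \<sigma> \<circ> \<pi>. Each of the k! choices of
  \<pi> gives the same sum, which cancels the factor 1 / k!.\<close>

lemma wedge_alt_left:
  "wedge k l (alt k a) \<beta> v = (1 / fact l) *\<^sub>R (\<Sum>\<sigma> | \<sigma> permutes {..<k + l}.
     (of_int (sign \<sigma>) * \<beta> (\<lambda>i. v (\<sigma> (k + i)))) *\<^sub>R a (\<lambda>i. v (\<sigma> i)))"
proof -
  define G where "G \<sigma> = (of_int (sign \<sigma>) * \<beta> (\<lambda>i. v (\<sigma> (k + i)))) *\<^sub>R a (\<lambda>i. v (\<sigma> i))" for \<sigma>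
  let ?S = "\<lambda>n. {\<sigma>. \<sigma> permutes {..<n::nat}}"
  have "(\<Sum>\<sigma>\<in>?S (k + l). (of_int (sign \<sigma>) * \<beta> (\<lambda>i. v (\<sigma> (k + i)))) *\<^sub>R alt k a (\<lambda>i. v (\<sigma> i)))
      = (\<Sum>\<sigma>\<in>?S (k + l). \<Sum>\<pi>\<in>?S k. G (\<sigma> \<circ> \<pi>))"
  proof (rule sum.cong[OF refl])
    fix \<sigma> assume \<sigma>: "\<sigma> \<in> ?S (k + l)"
    have "(of_int (sign \<sigma>) * \<beta> (\<lambda>i. v (\<sigma> (k + i)))) *\<^sub>R of_int (sign \<pi>) *\<^sub>R a (\<lambda>i. v (\<sigma> (\<pi> i)))
        = G (\<sigma> \<circ> \<pi>)" if "\<pi> \<in> ?S k" for \<pi>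
    proof -
      have \<pi>: "\<pi> permutes {..<k}" using that by simp
      then have "\<pi> permutes {..<k + l}"
        by (rule permutes_subset) auto
      moreover have "\<pi> (k + i) = k + i" for i
        using \<pi> by (simp add: permutes_not_in)
      ultimately show ?thesis
        using \<sigma> by (simp add: G_def sign_compose_lessThan)
    qed
    then show "(of_int (sign \<sigma>) * \<beta> (\<lambda>i. v (\<sigma> (k + i)))) *\<^sub>R alt k a (\<lambda>i. v (\<sigma> i))
        = (\<Sum>\<pi>\<in>?S k. G (\<sigma> \<circ> \<pi>))"
      unfolding alt_def scaleR_sum_right by (intro sum.cong) auto
  qed
  also have "\<dots> = (\<Sum>\<pi>\<in>?S k. \<Sum>\<sigma>\<in>?S (k + l). G (\<sigma> \<circ> \<pi>))"
    by (rule sum.swap)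
  also have "\<dots> = (\<Sum>\<pi>\<in>?S k. \<Sum>\<sigma>\<in>?S (k + l). G \<sigma>)"
  proof (rule sum.cong[OF refl])
    fix \<pi> assume "\<pi> \<in> ?S k"
    then have "\<pi> permutes {..<k + l}"
      by (auto intro: permutes_subset)
    then show "(\<Sum>\<sigma>\<in>?S (k + l). G (\<sigma> \<circ> \<pi>)) = (\<Sum>\<sigma>\<in>?S (k + l). G \<sigma>)"
      using sum_permutations_compose_right by metis
  qed
  also have "\<dots> = fact k *\<^sub>R (\<Sum>\<sigma>\<in>?S (k + l). G \<sigma>)"
    by (simp add: card_permutations sum_constant_scaleR)
  finally show ?thesis
    by (simp add: wedge_def G_def)
qed

text \<open>Shifting a permutation to the last l of k + l slots takes transpositions to
  transpositions, so the sign survives an induction over transpositions.\<close>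

lemma permutes_shift:
  fixes \<rho> :: "nat \<Rightarrow> nat" and k :: nat
  assumes "\<rho> permutes {..<l}"
  defines "\<rho>' \<equiv> (\<lambda>i. if i < k then i else k + \<rho> (i - k))"
  shows "\<rho>' permutes {..<k + l}" "sign \<rho>' = sign \<rho>"
proof -
  have "(\<lambda>i. if i < k then i else k + \<rho> (i - k)) permutes {..<k + l} \<and>
      sign (\<lambda>i. if i < k then i else k + \<rho> (i - k)) = sign \<rho>"
    using assms(1) finite_lessThan
  proof (induction rule: permutes_induct)
    case id
    have "(\<lambda>i. if i < k then i else k + id (i - k)) = id"
      by (auto simp: fun_eq_iff)
    then show ?case by (simp add: permutes_id)
  next
    case (swap a b p)
    let ?p = "\<lambda>i. if i < k then i else k + p (i - k)"
    have "(\<lambda>i. if i < k then i else k + (Transposition.transpose a b \<circ> p) (i - k))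
        = Transposition.transpose (k + a) (k + b) \<circ> ?p"
      by (auto simp: fun_eq_iff Transposition.transpose_def)
    moreover have t: "Transposition.transpose (k + a) (k + b) permutes {..<k + l}"
      using swap by (intro permutes_swap_id) auto
    moreover have "sign (Transposition.transpose (k + a) (k + b) \<circ> ?p) = sign (Transposition.transpose a b \<circ> p)"
    proof -
      have "Transposition.transpose a b permutes {..<l}"
        using swap by (intro permutes_swap_id) auto
      then show ?thesis
        using swap t by (simp add: sign_compose_lessThan sign_swap_id)
    qed
    moreover have "Transposition.transpose (k + a) (k + b) \<circ> ?p permutes {..<k + l}"
      using swap by (intro permutes_compose t) simp
    ultimately show ?case
      by (simp only: simp_thms)
  qed
  then show "\<rho>' permutes {..<k + l}" "sign \<rho>' = sign \<rho>"
    by (simp_all add: \<rho>'_def)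
qed

text \<open>The permutations of the last l slots are absorbed in the same way; they leave
  \<open>a\<close> alone because it reads only the first k entries. No numerical factor
  remains.\<close>

lemma wedge_alt:
  fixes a :: "('a, 'b::real_vector) covector"
  assumes a: "\<And>v w. (\<And>i. i < k \<Longrightarrow> v i = w i) \<Longrightarrow> a v = a w"
  shows "wedge k l (alt k a) (alt l b) = alt (k + l) (\<lambda>v. b (\<lambda>i. v (k + i)) *\<^sub>R a v)"
proof
  fix v :: "nat \<Rightarrow> 'a"
  define G where "G \<sigma> = (of_int (sign \<sigma>) * b (\<lambda>i. v (\<sigma> (k + i)))) *\<^sub>R a (\<lambda>i. v (\<sigma> i))" for \<sigma>
  let ?S = "\<lambda>n. {\<sigma>. \<sigma> permutes {..<n::nat}}"
  let ?sh = "\<lambda>\<rho> i. if i < k then i else k + \<rho> (i - k)"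
  have "(\<Sum>\<sigma>\<in>?S (k + l). (of_int (sign \<sigma>) * alt l b (\<lambda>i. v (\<sigma> (k + i)))) *\<^sub>R a (\<lambda>i. v (\<sigma> i)))
      = (\<Sum>\<sigma>\<in>?S (k + l). \<Sum>\<rho>\<in>?S l. G (\<sigma> \<circ> ?sh \<rho>))"
  proof (rule sum.cong[OF refl])
    fix \<sigma> assume \<sigma>: "\<sigma> \<in> ?S (k + l)"
    have "(of_int (sign \<sigma>) * (of_int (sign \<rho>) * b (\<lambda>i. v (\<sigma> (k + \<rho> i))))) *\<^sub>R a (\<lambda>i. v (\<sigma> i))
        = G (\<sigma> \<circ> ?sh \<rho>)" if "\<rho> \<in> ?S l" for \<rho>
    proof -
      have "a (\<lambda>i. v ((\<sigma> \<circ> ?sh \<rho>) i)) = a (\<lambda>i. v (\<sigma> i))"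
        by (rule a) simp
      then show ?thesis
        using \<sigma> that permutes_shift[of \<rho> l k] by (simp add: G_def sign_compose_lessThan)
    qed
    then show "(of_int (sign \<sigma>) * alt l b (\<lambda>i. v (\<sigma> (k + i)))) *\<^sub>R a (\<lambda>i. v (\<sigma> i))
        = (\<Sum>\<rho>\<in>?S l. G (\<sigma> \<circ> ?sh \<rho>))"
      unfolding alt_def sum_distrib_left scaleR_sum_left by (intro sum.cong) auto
  qed
  also have "\<dots> = (\<Sum>\<rho>\<in>?S l. \<Sum>\<sigma>\<in>?S (k + l). G (\<sigma> \<circ> ?sh \<rho>))"
    by (rule sum.swap)
  also have "\<dots> = (\<Sum>\<rho>\<in>?S l. \<Sum>\<sigma>\<in>?S (k + l). G \<sigma>)"
  proof (rule sum.cong[OF refl])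
    fix \<rho> assume "\<rho> \<in> ?S l"
    then have "?sh \<rho> permutes {..<k + l}"
      using permutes_shift(1) by simp
    from sum_permutations_compose_right[OF this, of G]
    show "(\<Sum>\<sigma>\<in>?S (k + l). G (\<sigma> \<circ> ?sh \<rho>)) = (\<Sum>\<sigma>\<in>?S (k + l). G \<sigma>)"
      by simp
  qed
  also have "\<dots> = fact l *\<^sub>R (\<Sum>\<sigma>\<in>?S (k + l). G \<sigma>)"
    by (simp add: card_permutations sum_constant_scaleR)
  finally show "wedge k l (alt k a) (alt l b) v = alt (k + l) (\<lambda>v. b (\<lambda>i. v (k + i)) *\<^sub>R a v) v"
    unfolding wedge_alt_left by (simp add: G_def alt_def)
qed

text \<open>This separates the su(2)-valued curvature into real 2-forms with constant coefficient
  vectors.\<close>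

lemma wedge_sum_left:
  assumes "finite I"
  shows "wedge k l (\<lambda>u. \<Sum>i\<in>I. F i u *\<^sub>R c i) \<beta> v = (\<Sum>i\<in>I. wedge k l (F i) \<beta> v *\<^sub>R c i)"
proof -
  have "wedge k l (\<lambda>u. \<Sum>i\<in>I. F i u *\<^sub>R c i) \<beta> v
     = (1 / (fact k * fact l)) *\<^sub>R (\<Sum>i\<in>I. \<Sum>\<sigma> | \<sigma> permutes {..<k + l}.
       (of_int (sign \<sigma>) * \<beta> (\<lambda>i. v (\<sigma> (k + i)))) *\<^sub>R F i (\<lambda>i. v (\<sigma> i)) *\<^sub>R c i)"
    unfolding wedge_def scaleR_sum_right by (subst sum.swap) simp
  then show ?thesis
    by (simp add: wedge_def scaleR_sum_right scaleR_sum_left sum_distrib_left sum_distrib_right mult.assoc)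
qed

text \<open>
  The list \<open>[i\<^sub>1, \<dots>, i\<^sub>k]\<close> encodes the tensor product of the covectors \<open>m i\<^sub>1, \<dots>, m i\<^sub>k\<close>, and a list
  of such lists with coefficients encodes a linear combination.
\<close>

primrec mono_tensor :: "(nat \<Rightarrow> 'a \<Rightarrow> real) \<Rightarrow> nat list \<Rightarrow> ('a, real) covector"
  where
    "mono_tensor m [] v = 1"
  | "mono_tensor m (i # is) v = m i (v 0) * mono_tensor m is (\<lambda>j. v (Suc j))"

definition tensor :: "(nat \<Rightarrow> 'a \<Rightarrow> real) \<Rightarrow> (real \<times> nat list) list \<Rightarrow> ('a, real) covector"
  where "tensor m L v = (\<Sum>(c, is)\<leftarrow>L. c * mono_tensor m is v)"

definition tensor_prod :: "(real \<times> nat list) list \<Rightarrow> (real \<times> nat list) list \<Rightarrow> (real \<times> nat list) list"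
  where "tensor_prod L K = concat (map (\<lambda>(c, is). map (\<lambda>(d, js). (c * d, is @ js)) K) L)"

lemma tensor_Nil [simp]: "tensor m [] v = 0"
  and tensor_Cons: "tensor m ((c, is) # L) v = c * mono_tensor m is v + tensor m L v"
  and tensor_append: "tensor m (L @ K) v = tensor m L v + tensor m K v"
  by (simp_all add: tensor_def)

lemma mono_tensor_append:
  "mono_tensor m (is @ js) v = mono_tensor m is v * mono_tensor m js (\<lambda>i. v (length is + i))"
  by (induction "is" arbitrary: v) auto

lemma mono_tensor_cong:
  "(\<And>i. i < length is \<Longrightarrow> v i = w i) \<Longrightarrow> mono_tensor m is v = mono_tensor m is w"
  by (induction "is" arbitrary: v w) fastforce+

lemma tensor_cong:
  "\<lbrakk>\<And>c is. (c, is) \<in> set L \<Longrightarrow> length is = k; \<And>i. i < k \<Longrightarrow> v i = w i\<rbrakk> \<Longrightarrow> tensor m L v = tensor m L w"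
  unfolding tensor_def by (intro arg_cong[of _ _ sum_list] map_cong) (auto intro!: mono_tensor_cong)

lemma tensor_prod:
  "(\<And>c is. (c, is) \<in> set L \<Longrightarrow> length is = k) \<Longrightarrow>
    tensor m (tensor_prod L K) v = tensor m K (\<lambda>i. v (k + i)) * tensor m L v"
proof (induction L)
  case Nil
  then show ?case by (simp add: tensor_prod_def)
next
  case (Cons x L)
  obtain c "is" where x: "x = (c, is)" by force
  have len: "length is = k" using Cons.prems x by auto
  have "tensor m (map (\<lambda>(d, js). (c * d, is @ js)) K) v = tensor m K (\<lambda>i. v (k + i)) * (c * mono_tensor m is v)"
    by (induction K) (auto simp: tensor_Cons mono_tensor_append len algebra_simps)
  moreover have "tensor m (tensor_prod L K) v = tensor m K (\<lambda>i. v (k + i)) * tensor m L v"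
    using Cons by auto
  ultimately show ?case
    by (simp add: x tensor_prod_def tensor_append tensor_Cons algebra_simps)
qed

lemma wedge_tensor:
  assumes "\<And>c is. (c, is) \<in> set L \<Longrightarrow> length is = k"
  shows "wedge k l (alt k (tensor m L)) (alt l (tensor m K)) = alt (k + l) (tensor m (tensor_prod L K))"
proof -
  have "tensor m (tensor_prod L K) = (\<lambda>v. tensor m K (\<lambda>i. v (k + i)) *\<^sub>R tensor m L v)"
    by (simp add: fun_eq_iff tensor_prod[OF assms])
  then show ?thesis
    using wedge_alt[of k "tensor m L" l "tensor m K", OF tensor_cong[OF assms]] by simp
qed

lemma alt_tensor: "alt k (tensor m L) v = (\<Sum>(c, is)\<leftarrow>L. c * alt k (mono_tensor m is) v)"
proof (induction L)
  case Nil
  then show ?case by (simp add: alt_def)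
next
  case (Cons x L)
  then show ?case
    by (cases x) (simp add: alt_def tensor_Cons distrib_left sum.distrib sum_distrib_left mult.left_commute)
qed

lemma alt_1 [simp]: "alt (Suc 0) a = a"
proof
  fix v :: "nat \<Rightarrow> 'a"
  have "{\<sigma>. \<sigma> permutes {..<Suc 0}} = {id}"
    by (auto simp: lessThan_Suc permutes_sing)
  then show "alt (Suc 0) a v = a v"
    by (simp add: alt_def)
qed

definition D6 :: "(nat \<Rightarrow> 'a \<Rightarrow> real) \<Rightarrow> nat \<Rightarrow> nat \<Rightarrow> nat \<Rightarrow> nat \<Rightarrow> nat \<Rightarrow> nat \<Rightarrow> ('a, real) covector"
  where "D6 m a b c d e f = alt 6 (mono_tensor m [a, b, c, d, e, f])"

lemma mono_tensor_6: "mono_tensor m [a, b, c, d, e, f] w = (\<Prod>k<6. m ([a, b, c, d, e, f] ! k) (w k))"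
  by (simp add: eval_nat_numeral lessThan_Suc mult_ac)

text \<open>As conditional rewrite rules these sort the six indices by adjacent swaps: the strict
  inequalities prevent loops, and repeated indices give 0. Every 6-form thereby reaches a normal
  form in which like terms can be collected.\<close>

lemma D6_swap:
  "b < a \<Longrightarrow> D6 m a b c d e f v = - D6 m b a c d e f v"
  "c < b \<Longrightarrow> D6 m a b c d e f v = - D6 m a c b d e f v"
  "d < c \<Longrightarrow> D6 m a b c d e f v = - D6 m a b d c e f v"
  "e < d \<Longrightarrow> D6 m a b c d e f v = - D6 m a b c e d f v"
  "f < e \<Longrightarrow> D6 m a b c d e f v = - D6 m a b c d f e v"
  and D6_repeat:
  "D6 m a a c d e f v = 0" "D6 m a b b d e f v = 0" "D6 m a b c c e f v = 0"
  "D6 m a b c d d f v = 0" "D6 m a b c d e e v = 0"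
proof -
  have sw: "alt 6 (mono_tensor m js) v = - alt 6 (mono_tensor m is) v"
    if "i < 5" "mono_tensor m js = (\<lambda>v. mono_tensor m is (\<lambda>k. v (Transposition.transpose i (Suc i) k)))"
    for i "is" js
    unfolding that(2) using that(1)
    by (subst alt_permute) (auto intro!: permutes_swap_id simp: sign_swap_id)
  have *: "D6 m a b c d e f v = - D6 m b a c d e f v" "D6 m a b c d e f v = - D6 m a c b d e f v"
    "D6 m a b c d e f v = - D6 m a b d c e f v" "D6 m a b c d e f v = - D6 m a b c e d f v"
    "D6 m a b c d e f v = - D6 m a b c d f e v" for a b c d e f
    unfolding D6_def
    by (rule sw[of 0], simp, simp add: Transposition.transpose_def fun_eq_iff,
        rule sw[of 1], simp, simp add: Transposition.transpose_def fun_eq_iff eval_nat_numeral,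
        rule sw[of 2], simp, simp add: Transposition.transpose_def fun_eq_iff eval_nat_numeral,
        rule sw[of 3], simp, simp add: Transposition.transpose_def fun_eq_iff eval_nat_numeral,
        rule sw[of 4], simp, simp add: Transposition.transpose_def fun_eq_iff eval_nat_numeral)
  from *(1) show "D6 m a b c d e f v = - D6 m b a c d e f v" .
  from *(2) show "D6 m a b c d e f v = - D6 m a c b d e f v" .
  from *(3) show "D6 m a b c d e f v = - D6 m a b d c e f v" .
  from *(4) show "D6 m a b c d e f v = - D6 m a b c e d f v" .
  from *(5) show "D6 m a b c d e f v = - D6 m a b c d f e v" .
  show "D6 m a a c d e f v = 0" using *(1)[of a a c d e f] by simp
  show "D6 m a b b d e f v = 0" using *(2)[of a b b d e f] by simp
  show "D6 m a b c c e f v = 0" using *(3)[of a b c c e f] by simp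
  show "D6 m a b c d d f v = 0" using *(4)[of a b c d d f] by simp
  show "D6 m a b c d e e v = 0" using *(5)[of a b c d e e] by simp
qed

text \<open>A permutation other than the identity puts some covector on a vector with a different
  index, so only one term of the sum survives.\<close>

lemma D6_dual:
  assumes "distinct [a, b, c, d, e, f]"
    and "\<And>i j. i \<in> {a, b, c, d, e, f} \<Longrightarrow> j \<in> {a, b, c, d, e, f} \<Longrightarrow> m i (B j) = (if i = j then 1 else 0)"
  shows "D6 m a b c d e f (\<lambda>k. B ([a, b, c, d, e, f] ! k)) = 1"
proof -
  let ?l = "[a, b, c, d, e, f]"
  note mono = mono_tensor_6
  have "mono_tensor m ?l (\<lambda>k. B (?l ! \<sigma> k)) = (if \<sigma> = id then 1 else 0)"
    if \<sigma>: "\<sigma> permutes {..<6}" for \<sigma>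
  proof (cases "\<sigma> = id")
    case True
    have "m (?l ! k) (B (?l ! k)) = 1" if "k < 6" for k
      using assms(2)[of "?l ! k" "?l ! k"] nth_mem[of k ?l] that by auto
    with True show ?thesis by (simp only: mono) simp
  next
    case False
    then obtain k where k: "\<sigma> k \<noteq> k" by (auto simp: fun_eq_iff)
    then have "k < 6" using \<sigma> by (metis lessThan_iff permutes_not_in)
    then have "\<sigma> k < 6" using \<sigma> by (metis lessThan_iff permutes_in_image)
    then have "?l ! k \<noteq> ?l ! \<sigma> k"
      using nth_eq_iff_index_eq[OF assms(1), of k "\<sigma> k"] k \<open>k < 6\<close> by simp
    moreover have "?l ! k \<in> set ?l" "?l ! \<sigma> k \<in> set ?l"
      using \<open>k < 6\<close> \<open>\<sigma> k < 6\<close> by (intro nth_mem; simp)+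
    ultimately have "m (?l ! k) (B (?l ! \<sigma> k)) = 0"
      using assms(2)[of "?l ! k" "?l ! \<sigma> k"] by auto
    then have "(\<Prod>k<6. m (?l ! k) (B (?l ! \<sigma> k))) = 0"
      using \<open>k < 6\<close> by (intro prod_zero) auto
    with False show ?thesis by (simp only: mono) simp
  qed
  then have "D6 m a b c d e f (\<lambda>k. B (?l ! k))
      = (\<Sum>\<sigma> | \<sigma> permutes {..<6::nat}. if \<sigma> = id then 1 else 0)"
    unfolding D6_def alt_def by (intro sum.cong) (auto simp: sign_id)
  also have "\<dots> = 1"
    by (subst sum.delta) (auto simp: finite_permutations permutes_id)
  finally show ?thesis .
qed

lemma D6_zero:
  assumes "\<And>k. k < 6 \<Longrightarrow> m i (v k) = 0" "i \<in> {a, b, c, d, e, f}"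
  shows "D6 m a b c d e f v = 0"
proof -
  have "mono_tensor m [a, b, c, d, e, f] (\<lambda>k. v (\<sigma> k)) = 0" if "\<sigma> permutes {..<6}" for \<sigma>
  proof -
    have "\<sigma> k < 6" if "k < 6" for k
      using \<open>\<sigma> permutes {..<6}\<close> that by (metis lessThan_iff permutes_in_image)
    moreover obtain k where "k < 6" "[a, b, c, d, e, f] ! k = i"
    proof -
      have "i \<in> set [a, b, c, d, e, f]" "length [a, b, c, d, e, f] = 6"
        using assms(2) by simp_all
      then show thesis
        using that by (metis in_set_conv_nth)
    qed
    ultimately show ?thesis
      using assms(1) unfolding mono_tensor_6 by (intro prod_zero) auto
  qed
  then show ?thesis
    unfolding D6_def alt_def by (intro sum.neutral) (simp del: mono_tensor.simps)
qed

text \<open>Numbering used in all index lists below: 0 is dt, the indices 1 to 3 are the \<eta>_i^+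
  and 4 to 6 the \<eta>_i^-.\<close>

definition coframe :: "cylpt \<Rightarrow> nat \<Rightarrow> cylpt \<Rightarrow> real"
  where "coframe n i = [fst, eta_p 1 n, eta_p 2 n, eta_p 3 n, eta_m 1 n, eta_m 2 n, eta_m 3 n] ! i"

lemma wedge_mono_tensor:
  assumes "length is = k"
  shows "wedge k l (alt k (mono_tensor m is)) (alt l (mono_tensor m js)) = alt (k + l) (mono_tensor m (is @ js))"
proof -
  have "mono_tensor m (is @ js) = (\<lambda>v. mono_tensor m js (\<lambda>i. v (k + i)) *\<^sub>R mono_tensor m is v)"
    by (simp add: fun_eq_iff mono_tensor_append assms)
  then show ?thesis
    by (simp only:) (rule wedge_alt, rule mono_tensor_cong, simp add: assms)
qed

lemma alt_lin: "alt k (\<lambda>v. c * a v - b v) v = c * alt k a v - alt k b v" for c :: real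
  by (simp add: alt_def sum_subtractf sum_distrib_left algebra_simps)

definition omega_L :: "real \<Rightarrow> real \<Rightarrow> (real \<times> nat list) list"
  where "omega_L A B = [(4 * A * B, [4, 1]), (4 * A * B, [5, 2]), (4 * A * B, [6, 3])]"

definition Omega2_L :: "real \<Rightarrow> real \<Rightarrow> (real \<times> nat list) list"
  where "Omega2_L A B = [(- 8 * A ^ 3, [1, 2, 3]),
    (4 * B ^ 2 * A, [4, 5, 3]), (- 4 * B ^ 2 * A, [5, 4, 3]),
    (4 * B ^ 2 * A, [5, 6, 1]), (- 4 * B ^ 2 * A, [6, 5, 1]),
    (4 * B ^ 2 * A, [6, 4, 2]), (- 4 * B ^ 2 * A, [4, 6, 2])]"

definition psi_L :: "real \<Rightarrow> real \<Rightarrow> (real \<times> nat list) list"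
  where "psi_L A B = map (\<lambda>(c, is). (1 / 2 * c, is)) (tensor_prod (omega_L A B) (omega_L A B))
    @ map (\<lambda>(c, is). (- c, is)) (tensor_prod [(1, [0])] (Omega2_L A B))"

lemma coframe_form:
  "ep 1 n = alt 1 (mono_tensor (coframe n) [1])" "em 1 n = alt 1 (mono_tensor (coframe n) [4])"
  "ep 2 n = alt 1 (mono_tensor (coframe n) [2])" "em 2 n = alt 1 (mono_tensor (coframe n) [5])"
  "ep 3 n = alt 1 (mono_tensor (coframe n) [3])" "em 3 n = alt 1 (mono_tensor (coframe n) [6])"
  "dt = alt 1 (mono_tensor (coframe n) [0])"
  by (simp_all add: fun_eq_iff ep_def em_def dt_def coframe_def)

lemma omega_eq: "omega n = alt 2 (tensor (coframe n) (omega_L (bs_A (fst n)) (bs_B (fst n))))"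
  by (simp add: fun_eq_iff omega_def sum_3 coframe_form wedge_mono_tensor alt_tensor omega_L_def
      numeral_2_eq_2 algebra_simps del: alt_1 mono_tensor.simps One_nat_def)

lemma Omega2_eq: "Omega2 n = alt 3 (tensor (coframe n) (Omega2_L (bs_A (fst n)) (bs_B (fst n))))"
  by (simp add: fun_eq_iff Omega2_def sum_3 wedge3_def coframe_form wedge_mono_tensor alt_tensor Omega2_L_def
      eps_def cross3_def axis_def algebra_simps del: alt_1 mono_tensor.simps One_nat_def)

lemma psi_eq: "psi n = alt 4 (tensor (coframe n) (psi_L (bs_A (fst n)) (bs_B (fst n))))"
proof
  fix v
  let ?A = "bs_A (fst n)" and ?B = "bs_B (fst n)" and ?m = "coframe n"
  have "wedge 2 2 (omega n) (omega n) = alt (2 + 2) (tensor ?m (tensor_prod (omega_L ?A ?B) (omega_L ?A ?B)))"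
    unfolding omega_eq by (rule wedge_tensor) (auto simp: omega_L_def)
  moreover have dt: "dt = alt 1 (tensor ?m [(1, [0])])"
    by (simp add: fun_eq_iff tensor_Cons dt_def coframe_def)
  have "wedge 1 3 dt (Omega2 n) = alt (1 + 3) (tensor ?m (tensor_prod [(1, [0])] (Omega2_L ?A ?B)))"
    unfolding Omega2_eq dt by (rule wedge_tensor) simp
  moreover have "tensor ?m (psi_L ?A ?B) = (\<lambda>w. 1 / 2 * tensor ?m (tensor_prod (omega_L ?A ?B) (omega_L ?A ?B)) w
      - tensor ?m (tensor_prod [(1, [0])] (Omega2_L ?A ?B)) w)"
    by (simp add: fun_eq_iff psi_L_def tensor_append tensor_def o_def split_def sum_list_const_mult[symmetric]
        uminus_sum_list_map mult.assoc)
  ultimately show "psi n v = alt 4 (tensor ?m (psi_L ?A ?B)) v"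
    by (simp only: psi_def alt_lin) simp
qed

text \<open>The T_i-component of the curvature of the ansatz: for (i, j, k) cyclic, \<open>p\<close>
  and \<open>q\<close> are the coefficients of dt \<and> \<eta>_i^+ and dt \<and> \<eta>_i^-,
  \<open>x\<close> and \<open>y\<close> those of \<eta>_j^+ \<and> \<eta>_k^+ and \<eta>_j^- \<and>
  \<eta>_k^-, and \<open>z\<close> that of the two mixed terms.\<close>

definition curv_L :: "real \<Rightarrow> real \<Rightarrow> real \<Rightarrow> real \<Rightarrow> real \<Rightarrow> 3 \<Rightarrow> (real \<times> nat list) list"
  where "curv_L p q x y z i =
    (if i = 1 then [(p, [0, 1]), (q, [0, 4]), (x, [2, 3]), (y, [5, 6]), (z, [2, 6]), (z, [5, 3])]
     else if i = 2 then [(p, [0, 2]), (q, [0, 5]), (x, [3, 1]), (y, [6, 4]), (z, [3, 4]), (z, [6, 1])]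
     else [(p, [0, 3]), (q, [0, 6]), (x, [1, 2]), (y, [4, 5]), (z, [1, 5]), (z, [4, 2])])"

lemma length_curv_L: "(c, is) \<in> set (curv_L p q x y z i) \<Longrightarrow> length is = 2"
  by (auto simp: curv_L_def split: if_splits)

text \<open>In the T_i-component only the 6-forms omitting \<eta>_i^- or \<eta>_i^+ survive, and up
  to sign their coefficients do not depend on i. The instanton equation for the ansatz thus amounts
  to the two scalar equations K = 0 and M = 0.\<close>

lemma wedge_curv_psi:
  fixes n p q x y z
  defines "K \<equiv> - 16 * bs_A (fst n) ^ 2 * bs_B (fst n) ^ 2 * p - 8 * bs_B (fst n) ^ 2 * bs_A (fst n) * x
      + 8 * bs_A (fst n) ^ 3 * y"
    and "M \<equiv> - 16 * bs_A (fst n) ^ 2 * bs_B (fst n) ^ 2 * q + 16 * bs_B (fst n) ^ 2 * bs_A (fst n) * z"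
  shows "wedge 2 4 (alt 2 (tensor (coframe n) (curv_L p q x y z 1))) (psi n) v
      = K * D6 (coframe n) 0 1 2 3 5 6 v + M * D6 (coframe n) 0 2 3 4 5 6 v" (is ?thesis1)
    and "wedge 2 4 (alt 2 (tensor (coframe n) (curv_L p q x y z 2))) (psi n) v
      = - K * D6 (coframe n) 0 1 2 3 4 6 v - M * D6 (coframe n) 0 1 3 4 5 6 v" (is ?thesis2)
    and "wedge 2 4 (alt 2 (tensor (coframe n) (curv_L p q x y z 3))) (psi n) v
      = K * D6 (coframe n) 0 1 2 3 4 5 v + M * D6 (coframe n) 0 1 2 4 5 6 v" (is ?thesis3)
proof -
  have w: "wedge 2 4 (alt 2 (tensor (coframe n) (curv_L p q x y z i))) (psi n) v
      = alt 6 (tensor (coframe n) (tensor_prod (curv_L p q x y z i) (psi_L (bs_A (fst n)) (bs_B (fst n))))) v" for i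
    unfolding psi_eq by (subst wedge_tensor) (use length_curv_L in auto)
  note [simp del] = mono_tensor.simps
  show ?thesis1 ?thesis2 ?thesis3
    unfolding w alt_tensor K_def M_def
    by (simp_all add: curv_L_def psi_L_def omega_L_def Omega2_L_def tensor_prod_def D6_swap D6_repeat flip: D6_def)
      (simp_all add: power2_eq_square power3_eq_cube algebra_simps)
qed

section \<open>Tangent spaces\<close>

lemma open_norm_less: "open {p::'a::real_normed_vector. ereal (norm p) < R}"
proof (cases R)
  case (real r)
  then show ?thesis by (simp add: open_Collect_less continuous_intros)
qed auto

lemma eventually_norm_less:
  fixes \<gamma> :: "real \<Rightarrow> 'a::real_normed_vector"
  assumes "isCont \<gamma> s0" "ereal (norm (\<gamma> s0)) < R"
  shows "\<forall>\<^sub>F s in at s0. ereal (norm (\<gamma> s)) < R"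
proof -
  have "eventually (\<lambda>s. \<gamma> s \<in> {p. ereal (norm p) < R}) (at s0)"
    using assms by (intro topological_tendstoD[OF _ open_norm_less]) (auto simp: isCont_def)
  then show ?thesis by simp
qed

lemma tangent_tube:
  assumes "(p, q) \<in> tube R"
  shows "(v, w) \<in> tangent_space (tube R) (p, q) \<longleftrightarrow> q \<bullet> w = 0"
proof
  assume "(v, w) \<in> tangent_space (tube R) (p, q)"
  then obtain \<gamma> where \<gamma>: "\<gamma> 0 = (p, q)" "\<forall>\<^sub>F s in at (0::real). \<gamma> s \<in> tube R"
    "(\<gamma> has_vector_derivative (v, w)) (at 0)"
    unfolding tangent_space_def by auto
  have "((\<lambda>s. snd (\<gamma> s)) has_vector_derivative snd (v, w)) (at 0)"
    by (rule bounded_linear.has_vector_derivative[OF bounded_linear_snd \<gamma>(3)])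
  moreover have "\<forall>\<^sub>F s in at 0. norm (snd (\<gamma> s)) = 1"
    using \<gamma>(2) by (rule eventually_mono) (auto simp: tube_def)
  ultimately show "q \<bullet> w = 0"
    using sphere_velocity[of "\<lambda>s. snd (\<gamma> s)" w] \<gamma>(1) assms by (simp add: tube_def)
next
  assume "q \<bullet> w = 0"
  moreover have "norm q = 1" "ereal (norm p) < R"
    using assms by (auto simp: tube_def)
  ultimately obtain c where c: "c 0 = q" "\<forall>s::real. norm (c s) = 1" "(c has_vector_derivative w) (at 0)"
    using sphere_curve by blast
  have "\<forall>\<^sub>F s in at 0. ereal (norm (p + s *\<^sub>R v)) < R"
    using \<open>ereal (norm p) < R\<close> by (intro eventually_norm_less) (auto intro!: continuous_intros)
  then have "\<forall>\<^sub>F s in at 0. (p + s *\<^sub>R v, c s) \<in> tube R"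
    by (rule eventually_mono) (simp add: tube_def c)
  moreover have "((\<lambda>s. (p + s *\<^sub>R v, c s)) has_vector_derivative (v, w)) (at 0)"
    by (intro has_vector_derivative_Pair c) (auto intro!: derivative_eq_intros)
  ultimately show "(v, w) \<in> tangent_space (tube R) (p, q)"
    unfolding tangent_space_def using c(1)
    by (intro CollectI exI[of _ "\<lambda>s. (p + s *\<^sub>R v, c s)"]) auto
qed

lemma SU2_curve:
  assumes "u \<in> su2"
  obtains c where "c 0 = qone" "\<forall>s::real. c s \<in> SU2" "(c has_vector_derivative u) (at 0)"
proof -
  have "norm qone = 1" "qone \<bullet> u = 0"
    using assms by (simp_all add: inner_qone su2_def)
  then show thesis
    by (rule sphere_curve) (rule that, auto simp: SU2_def)
qed

lemma tangent_cylE: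
  assumes "v \<in> tangent_space (cyl R) (t, a, b)" "a \<in> SU2" "b \<in> SU2"
  obtains \<tau> u w where "u \<in> su2" "w \<in> su2" "v = (\<tau>, a \<odot> u, b \<odot> w)"
proof -
  obtain \<gamma> where \<gamma>: "\<gamma> 0 = (t, a, b)" "\<forall>\<^sub>F s in at (0::real). \<gamma> s \<in> cyl R"
    "(\<gamma> has_vector_derivative v) (at 0)"
    using assms(1) unfolding tangent_space_def by auto
  note d = bounded_linear.has_vector_derivative[OF bounded_linear_snd \<gamma>(3)]
  have "fst (snd (\<gamma> 0)) \<bullet> fst (snd v) = 0"
  proof (rule sphere_velocity[OF _ _ bounded_linear.has_vector_derivative[OF bounded_linear_fst d]])
    show "\<forall>\<^sub>F s in at 0. norm (fst (snd (\<gamma> s))) = 1"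
      using \<gamma>(2) by (rule eventually_mono) (auto simp: cyl_def SU2_def)
  qed (use \<gamma>(1) assms in \<open>simp add: SU2_def\<close>)
  then obtain u where "u \<in> su2" "fst (snd v) = a \<odot> u"
    using tangent_SU2[OF assms(2), of "fst (snd v)"] \<gamma>(1) by auto
  moreover have "snd (snd (\<gamma> 0)) \<bullet> snd (snd v) = 0"
  proof (rule sphere_velocity[OF _ _ bounded_linear.has_vector_derivative[OF bounded_linear_snd d]])
    show "\<forall>\<^sub>F s in at 0. norm (snd (snd (\<gamma> s))) = 1"
      using \<gamma>(2) by (rule eventually_mono) (auto simp: cyl_def SU2_def)
  qed (use \<gamma>(1) assms in \<open>simp add: SU2_def\<close>)
  then obtain w where "w \<in> su2" "snd (snd v) = b \<odot> w"
    using tangent_SU2[OF assms(3), of "snd (snd v)"] \<gamma>(1) by auto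
  ultimately show thesis
    by (intro that[of u w "fst v"]) (simp_all add: prod_eq_iff)
qed

lemma qmul_vector_derivative:
  "(f has_vector_derivative f') (at s) \<Longrightarrow> (g has_vector_derivative g') (at s) \<Longrightarrow>
    ((\<lambda>s. f s \<odot> g s) has_vector_derivative f s \<odot> g' + f' \<odot> g s) (at s)"
  by (rule qmul.has_vector_derivative)

lemma qcnj_vector_derivative:
  "(f has_vector_derivative f') (at s) \<Longrightarrow> ((\<lambda>s. qcnj (f s)) has_vector_derivative qcnj f') (at s)"
  by (rule bounded_linear.has_vector_derivative[OF bounded_linear_qcnj])

lemma eventually_cyl:
  assumes "0 < t" "ereal t < R"
  shows "\<forall>\<^sub>F s in at (0::real). 0 < t + s * \<tau> \<and> ereal (t + s * \<tau>) < R"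
proof -
  have "((\<lambda>s. t + s * \<tau>) \<longlongrightarrow> t + 0 * \<tau>) (at 0)"
    by (intro tendsto_intros)
  then have lim: "((\<lambda>s. t + s * \<tau>) \<longlongrightarrow> t) (at 0)" by simp
  have "\<forall>\<^sub>F s in at 0. ereal (norm (t + s * \<tau>)) < R"
    using assms by (intro eventually_norm_less) (auto intro!: continuous_intros)
  moreover have "\<forall>\<^sub>F s in at 0. 0 < t + s * \<tau>"
    using order_tendstoD(1)[OF lim assms(1)] .
  ultimately show ?thesis
    by eventually_elim auto
qed

lemma cyl_tangent:
  assumes "(t, a, b) \<in> cyl R" "u \<in> su2" "w \<in> su2"
  shows "(\<tau>, a \<odot> u, b \<odot> w) \<in> tangent_space (cyl R) (t, a, b)"
proof -
  obtain c where c: "c 0 = qone" "\<forall>s::real. c s \<in> SU2" "(c has_vector_derivative u) (at 0)"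
    by (rule SU2_curve[OF assms(2)])
  obtain d where d: "d 0 = qone" "\<forall>s::real. d s \<in> SU2" "(d has_vector_derivative w) (at 0)"
    by (rule SU2_curve[OF assms(3)])
  have "0 < t" "ereal t < R" "a \<in> SU2" "b \<in> SU2"
    using assms(1) by (auto simp: cyl_def)
  have "\<forall>\<^sub>F s in at 0. (t + s * \<tau>, a \<odot> c s, b \<odot> d s) \<in> cyl R"
    using eventually_cyl[OF \<open>0 < t\<close> \<open>ereal t < R\<close>]
    by (rule eventually_mono) (simp add: cyl_def c d \<open>a \<in> SU2\<close> \<open>b \<in> SU2\<close>)
  moreover have "((\<lambda>s. (t + s * \<tau>, a \<odot> c s, b \<odot> d s)) has_vector_derivative (\<tau>, a \<odot> u, b \<odot> w)) (at 0)"
    using c d by (intro has_vector_derivative_Pair bounded_linear.has_vector_derivative[OF qmul.bounded_linear_right])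
      (auto intro!: derivative_eq_intros)
  ultimately show ?thesis
    unfolding tangent_space_def using c(1) d(1)
    by (intro CollectI exI[of _ "\<lambda>s. (t + s * \<tau>, a \<odot> c s, b \<odot> d s)"]) auto
qed

lemma emb_has_derivative:
  "(emb has_derivative (\<lambda>(\<tau>, v, w). (\<tau> *\<^sub>R a + t *\<^sub>R v, v \<odot> qcnj b + a \<odot> qcnj w))) (at (t, a, b))"
proof -
  have emb: "emb = (\<lambda>n. (fst n *\<^sub>R fst (snd n), fst (snd n) \<odot> qcnj (snd (snd n))))"
    by (auto simp: emb_def)
  show ?thesis
    unfolding emb
    by (auto intro!: derivative_eq_intros qmul.FDERIV bounded_linear.has_derivative[OF bounded_linear_qcnj]
        simp: fun_eq_iff)
qed

lemma emb_diff: "emb_diff (t, a, b) (\<tau>, v, w) = (\<tau> *\<^sub>R a + t *\<^sub>R v, v \<odot> qcnj b + a \<odot> qcnj w)"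
  unfolding emb_diff_def using frechet_derivative_at[OF emb_has_derivative, of a t b]
  by (metis (no_types, lifting) case_prod_conv)

text \<open>The right-hand side is the image under (a, b, 1) of the vector (\<tau> + t u, u - w) at
  (t, 1). For this reason vectors of that shape represent all tangent directions in what
  follows.\<close>

lemma emb_diff_left_invariant:
  assumes "w \<in> su2"
  shows "emb_diff (t, a, b) (\<tau>, a \<odot> u, b \<odot> w) = (a \<odot> (\<tau> *\<^sub>R qone + t *\<^sub>R u), a \<odot> (u - w) \<odot> qcnj b)"
  using assms unfolding emb_diff su2_iff_qcnj
  by (simp add: qcnj_qmul qmul.add_right qmul.scaleR_right qmul.diff_right qmul.diff_left qmul_assoc
      qmul.minus_left qmul.minus_right)

lemma emb_in_tube: "n \<in> cyl R \<Longrightarrow> emb n \<in> tube R"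
  by (auto simp: cyl_def tube_def emb_def SU2_def norm_qmul simp del: scaleR_Pair)

section \<open>Invariant connections\<close>

definition left_invariant_on :: "ereal \<Rightarrow> (quat \<times> quat \<Rightarrow> quat \<times> quat \<Rightarrow> quat) \<Rightarrow> bool"
  where "left_invariant_on R A \<longleftrightarrow> (\<forall>a\<in>SU2. \<forall>b\<in>SU2. \<forall>m\<in>tube R. \<forall>v\<in>tangent_space (tube R) m.
    A (act (a, b, qone) m) (act (a, b, qone) v) = A m v)"

lemma bounded_linear_act: "bounded_linear (act h)"
proof -
  obtain h1 h2 h3 where h: "h = (h1, h2, h3)" by (metis prod_cases3)
  have "act h = (\<lambda>m. (h1 \<odot> fst m \<odot> qcnj h3, h1 \<odot> snd m \<odot> qcnj h2))"
    by (auto simp: act_def h)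
  then show ?thesis
    by (simp add: bounded_linear_Pair bounded_linear_compose[OF bounded_linear_qmul_both]
        bounded_linear_fst bounded_linear_snd)
qed

lemma act_tube:
  assumes "h \<in> SU2_3" "m \<in> tube R"
  shows "act h m \<in> tube R"
  using assms by (auto simp: SU2_3_def act_def tube_def SU2_def norm_qmul simp del: scaleR_Pair)

lemma lift_smooth:
  assumes "lift_on R \<Phi>" "h \<in> SU2_3"
  shows "smooth_map_on (P1 R) (\<Phi> h)"
proof -
  have "Ck_on k UNIV (\<lambda>z. (h, 0) + (0, z))" for k and h :: "quat \<times> quat \<times> quat"
    by (intro Ck_on_add Ck_on_const Ck_on_bounded_linear bounded_linear_Pair bounded_linear_zero
        bounded_linear_ident open_UNIV)
  then have "smooth_map_on (P1 R) (\<lambda>z. (\<lambda>(h, z). \<Phi> h z) ((h, 0) + (0, z)))"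
  proof (rule smooth_map_on_compose[rotated])
    show "smooth_map_on (SU2_3 \<times> P1 R) (\<lambda>(h, z). \<Phi> h z)"
      using assms(1) by (simp add: lift_on_def)
    show "(\<lambda>z. (h, 0) + (0, z)) ` P1 R \<subseteq> SU2_3 \<times> P1 R"
      using assms(2) by auto
  qed
  then show ?thesis by (simp only: add_Pair add_0 add_0_right case_prod_conv)
qed

text \<open>Following a curve in the base with fixed fibre coordinate \<open>u\<close> makes the
  differential of \<open>f\<close> within \<open>P1 R\<close> computable.\<close>

lemma pulls_back_along_curve:
  assumes "pulls_back R f A A'" "f differentiable (at (m, u) within P1 R)" "m \<in> tube R" "u \<in> SU2"
    and \<gamma>: "\<gamma> 0 = m" "\<forall>\<^sub>F s in at (0::real). \<gamma> s \<in> tube R" "(\<gamma> has_vector_derivative v) (at 0)"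
    and f: "((\<lambda>s. f (\<gamma> s, u)) has_vector_derivative w) (at 0)"
  shows "conn_form A (f (m, u)) w = conn_form A' (m, u) (v, 0)"
proof -
  have z: "(m, u) \<in> P1 R"
    using assms by (simp add: P1_def)
  have c: "(\<lambda>s. (\<gamma> s, u)) 0 = (m, u)" "\<forall>\<^sub>F s in at (0::real). (\<gamma> s, u) \<in> P1 R"
    "((\<lambda>s. (\<gamma> s, u)) has_vector_derivative (v, 0)) (at 0)"
    using \<gamma> \<open>u \<in> SU2\<close> by (auto simp: P1_def intro!: has_vector_derivative_Pair)
  then have "(v, 0) \<in> tangent_space (P1 R) (m, u)"
    unfolding tangent_space_def by (intro CollectI exI[of _ "\<lambda>s. (\<gamma> s, u)"] conjI)
  then have "conn_form A (f (m, u)) (differential_on (P1 R) f (m, u) (v, 0)) = conn_form A' (m, u) (v, 0)"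
    using assms(1) z unfolding pulls_back_def by blast
  moreover have "differential_on (P1 R) f (m, u) (v, 0) = w"
    using vector_derivative_unique_at[OF differential_on_along_curve[OF assms(2) z c] f] .
  ultimately show ?thesis by simp
qed

text \<open>Elements (a, b, 1) act on the fibre coordinate trivially, so preserving the connection
  means preserving its 1-form, without a gauge term.\<close>

lemma SU2_3_invariant_left_invariant:
  assumes "SU2_3_invariant R A"
  shows "left_invariant_on R A"
proof -
  obtain \<Phi> where \<Phi>: "lift_on R \<Phi>" "\<And>h. h \<in> SU2_3 \<Longrightarrow> pulls_back R (\<Phi> h) A A"
    using assms unfolding SU2_3_invariant_def by blast
  show ?thesis
    unfolding left_invariant_on_def
  proof (intro ballI)
    fix a b m v assume ab: "a \<in> SU2" "b \<in> SU2" and m: "m \<in> tube R" and v: "v \<in> tangent_space (tube R) m"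
    let ?h = "(a, b, qone)"
    have h: "?h \<in> SU2_3" using ab by (simp add: SU2_3_def)
    have eq: "\<Phi> ?h (m, u) = (act ?h m, u)" if "m \<in> tube R" "u \<in> SU2" for m u
      using \<Phi>(1) ab that by (simp add: lift_on_def P1_def P1_act2_def)
    obtain \<gamma> where \<gamma>: "\<gamma> 0 = m" "\<forall>\<^sub>F s in at (0::real). \<gamma> s \<in> tube R" "(\<gamma> has_vector_derivative v) (at 0)"
      using v unfolding tangent_space_def by auto
    have "((\<lambda>s. (act ?h (\<gamma> s), qone)) has_vector_derivative (act ?h v, 0)) (at 0)"
      by (intro has_vector_derivative_Pair bounded_linear.has_vector_derivative[OF bounded_linear_act] \<gamma>) simp
    moreover have "\<forall>\<^sub>F s in at 0. (act ?h (\<gamma> s), qone) = \<Phi> ?h (\<gamma> s, qone)"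
      using \<gamma>(2) by (rule eventually_mono) (simp add: eq)
    ultimately have "((\<lambda>s. \<Phi> ?h (\<gamma> s, qone)) has_vector_derivative (act ?h v, 0)) (at 0)"
      unfolding has_vector_derivative_def
      by (rule has_derivative_transform_eventually) (use m \<gamma>(1) in \<open>simp_all add: eq\<close>)
    from pulls_back_along_curve[OF \<Phi>(2)[OF h] smooth_map_on_differentiable[OF lift_smooth[OF \<Phi>(1) h]] m _ \<gamma> this]
    show "A (act ?h m) (act ?h v) = A m v"
      using m by (simp add: P1_def eq conn_form_def)
  qed
qed

lemma left_invariant_emb:
  assumes "left_invariant_on R A" "(t, a, b) \<in> cyl R" "u \<in> su2" "w \<in> su2"
  shows "A (emb (t, a, b)) (emb_diff (t, a, b) (\<tau>, a \<odot> u, b \<odot> w))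
    = A (t *\<^sub>R qone, qone) (\<tau> *\<^sub>R qone + t *\<^sub>R u, u - w)"
proof -
  have t: "0 < t" "ereal t < R" "a \<in> SU2" "b \<in> SU2"
    using assms(2) by (auto simp: cyl_def)
  then have m: "(t *\<^sub>R qone, qone) \<in> tube R"
    by (simp add: tube_def)
  then have "(\<tau> *\<^sub>R qone + t *\<^sub>R u, u - w) \<in> tangent_space (tube R) (t *\<^sub>R qone, qone)"
    using assms by (simp add: tangent_tube inner_qone su2_def)
  then have "A (act (a, b, qone) (t *\<^sub>R qone, qone)) (act (a, b, qone) (\<tau> *\<^sub>R qone + t *\<^sub>R u, u - w))
      = A (t *\<^sub>R qone, qone) (\<tau> *\<^sub>R qone + t *\<^sub>R u, u - w)"
    using assms(1) m t unfolding left_invariant_on_def by blast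
  then show ?thesis
    by (simp add: act_def emb_def emb_diff_left_invariant[OF assms(4)] qmul.scaleR_right)
qed

section \<open>Curvature of invariant connections\<close>

lemma su2_bracket_su2: "u \<in> su2 \<Longrightarrow> v \<in> su2 \<Longrightarrow> su2_bracket u v \<in> su2"
  by (simp add: su2_bracket_def su2_iff_qcnj qcnj_linear qcnj_qmul qmul.minus_left qmul.minus_right)

text \<open>On fields with constant left-invariant coefficients, A is a function of t alone, so only
  the t-derivatives and the bracket of the two fields remain. This bracket is (0, [u1, u2],
  [w1, w2]).\<close>

lemma ext_deriv_left_invariant:
  assumes conn: "connection_on R A" and inv: "left_invariant_on R A" and n: "(t, a, b) \<in> cyl R"
    and u: "u1 \<in> su2" "w1 \<in> su2" "u2 \<in> su2" "w2 \<in> su2"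
    and d1: "((\<lambda>s. A (s *\<^sub>R qone, qone) (\<tau>1 *\<^sub>R qone + s *\<^sub>R u1, u1 - w1)) has_vector_derivative d1) (at t)"
    and d2: "((\<lambda>s. A (s *\<^sub>R qone, qone) (\<tau>2 *\<^sub>R qone + s *\<^sub>R u2, u2 - w2)) has_vector_derivative d2) (at t)"
  shows "ext_deriv (tube R) A (emb (t, a, b)) (emb_diff (t, a, b) (\<tau>1, a \<odot> u1, b \<odot> w1))
      (emb_diff (t, a, b) (\<tau>2, a \<odot> u2, b \<odot> w2))
    = \<tau>1 *\<^sub>R d2 - \<tau>2 *\<^sub>R d1 - A (t *\<^sub>R qone, qone)
        (t *\<^sub>R su2_bracket u1 u2, su2_bracket u1 u2 - su2_bracket w1 w2)"
proof -
  have t: "0 < t" "ereal t < R" "a \<in> SU2" "b \<in> SU2"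
    using n by (auto simp: cyl_def)
  \<comment> \<open>A curve through the first vector, with the second one carried along it as a
    left-invariant field: by invariance the value of A on this field sees only t = t + s \<tau>1,
    which explains the derivative \<open>\<tau>1 *\<^sub>R d2\<close>.\<close>
  have *: "\<exists>\<gamma> V. \<gamma> 0 = emb (t, a, b) \<and> (\<forall>\<^sub>F s in at (0::real). \<gamma> s \<in> tube R)
      \<and> (\<gamma> has_vector_derivative emb_diff (t, a, b) (\<tau>1, a \<odot> u1, b \<odot> w1)) (at 0)
      \<and> V 0 = emb_diff (t, a, b) (\<tau>2, a \<odot> u2, b \<odot> w2)
      \<and> (V has_vector_derivative (\<tau>2 *\<^sub>R (a \<odot> u1) + \<tau>1 *\<^sub>R (a \<odot> u2) + t *\<^sub>R (a \<odot> (u1 \<odot> u2)),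
            a \<odot> (u1 \<odot> (u2 - w2) - (u2 - w2) \<odot> w1) \<odot> qcnj b)) (at 0)
      \<and> ((\<lambda>s. A (\<gamma> s) (V s)) has_vector_derivative \<tau>1 *\<^sub>R d2) (at 0)"
    if u: "u1 \<in> su2" "w1 \<in> su2" "u2 \<in> su2" "w2 \<in> su2"
      and d2: "((\<lambda>s. A (s *\<^sub>R qone, qone) (\<tau>2 *\<^sub>R qone + s *\<^sub>R u2, u2 - w2)) has_vector_derivative d2) (at t)"
    for u1 w1 u2 w2 d2 and \<tau>1 \<tau>2 :: real
  proof -
    obtain c where c: "c 0 = qone" "\<forall>s::real. c s \<in> SU2" "(c has_vector_derivative u1) (at 0)"
      by (rule SU2_curve[OF u(1)])
    obtain d where d: "d 0 = qone" "\<forall>s::real. d s \<in> SU2" "(d has_vector_derivative w1) (at 0)"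
      by (rule SU2_curve[OF u(2)])
    let ?p = "\<lambda>s. (t + s * \<tau>1, a \<odot> c s, b \<odot> d s)"
    let ?\<gamma> = "\<lambda>s. emb (?p s)" and ?V = "\<lambda>s. emb_diff (?p s) (\<tau>2, a \<odot> c s \<odot> u2, b \<odot> d s \<odot> w2)"
    have cyl: "\<forall>\<^sub>F s in at 0. ?p s \<in> cyl R"
      using eventually_cyl[OF t(1,2)] by (rule eventually_mono) (simp add: cyl_def c d t)
    then have "\<forall>\<^sub>F s in at 0. ?\<gamma> s \<in> tube R"
      by (rule eventually_mono) (rule emb_in_tube)
    moreover have "(?p has_vector_derivative (\<tau>1, a \<odot> u1, b \<odot> w1)) (at 0)"
      using c d by (intro has_vector_derivative_Pair bounded_linear.has_vector_derivative[OF qmul.bounded_linear_right])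
        (auto intro!: derivative_eq_intros)
    then have "(?\<gamma> has_vector_derivative emb_diff (t, a, b) (\<tau>1, a \<odot> u1, b \<odot> w1)) (at 0)"
      using has_derivative_along_curve[OF emb_has_derivative[of a t b] UNIV_I, of ?p "(\<tau>1, a \<odot> u1, b \<odot> w1)"]
        c(1) d(1) by (simp only: emb_diff case_prod_conv) simp
    moreover have "?V = (\<lambda>s. (\<tau>2 *\<^sub>R (a \<odot> c s) + (t + s * \<tau>1) *\<^sub>R (a \<odot> (c s \<odot> u2)),
        a \<odot> (c s \<odot> ((u2 - w2) \<odot> qcnj (d s)) \<odot> qcnj b)))"
      unfolding emb_diff_left_invariant[OF u(4)]
      by (simp add: fun_eq_iff qmul.add_right qmul.scaleR_right qmul_assoc qcnj_qmul)
    moreover have "((\<lambda>s. (\<tau>2 *\<^sub>R (a \<odot> c s) + (t + s * \<tau>1) *\<^sub>R (a \<odot> (c s \<odot> u2)),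
        a \<odot> (c s \<odot> ((u2 - w2) \<odot> qcnj (d s)) \<odot> qcnj b))) has_vector_derivative
        (\<tau>2 *\<^sub>R (a \<odot> u1) + \<tau>1 *\<^sub>R (a \<odot> u2) + t *\<^sub>R (a \<odot> (u1 \<odot> u2)),
            a \<odot> (u1 \<odot> (u2 - w2) - (u2 - w2) \<odot> w1) \<odot> qcnj b)) (at 0)"
    proof (rule has_vector_derivative_Pair)
      note right = bounded_linear.has_vector_derivative[OF qmul.bounded_linear_right]
        and left = bounded_linear.has_vector_derivative[OF qmul.bounded_linear_left]
      have "((\<lambda>s. \<tau>2 *\<^sub>R (a \<odot> c s) + (t + s * \<tau>1) *\<^sub>R (a \<odot> (c s \<odot> u2))) has_vector_derivative
          \<tau>2 *\<^sub>R (a \<odot> u1) + ((t + 0 * \<tau>1) *\<^sub>R (a \<odot> (u1 \<odot> u2)) + \<tau>1 *\<^sub>R (a \<odot> (c 0 \<odot> u2)))) (at 0)"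
        by (intro has_vector_derivative_add has_vector_derivative_scaleR right left c(3)
            bounded_linear.has_vector_derivative[OF bounded_linear_scaleR_right])
          (auto intro!: derivative_eq_intros)
      then show "((\<lambda>s. \<tau>2 *\<^sub>R (a \<odot> c s) + (t + s * \<tau>1) *\<^sub>R (a \<odot> (c s \<odot> u2))) has_vector_derivative
          \<tau>2 *\<^sub>R (a \<odot> u1) + \<tau>1 *\<^sub>R (a \<odot> u2) + t *\<^sub>R (a \<odot> (u1 \<odot> u2))) (at 0)"
        using c(1) by (simp add: algebra_simps)
      have "((\<lambda>s. a \<odot> (c s \<odot> (x \<odot> qcnj (d s)) \<odot> qcnj b)) has_vector_derivative
          a \<odot> ((c 0 \<odot> (x \<odot> qcnj w1) + u1 \<odot> (x \<odot> qcnj (d 0))) \<odot> qcnj b)) (at 0)" for x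
        by (intro qmul_vector_derivative right left c(3) d(3) qcnj_vector_derivative)
      from this[of "u2 - w2"] show "((\<lambda>s. a \<odot> (c s \<odot> ((u2 - w2) \<odot> qcnj (d s)) \<odot> qcnj b)) has_vector_derivative
          a \<odot> (u1 \<odot> (u2 - w2) - (u2 - w2) \<odot> w1) \<odot> qcnj b) (at 0)"
        using c(1) d(1) u(2) by (simp add: su2_iff_qcnj qmul.minus_right qmul_assoc)
    qed
    moreover have "((\<lambda>s. A (?\<gamma> s) (?V s)) has_vector_derivative \<tau>1 *\<^sub>R d2) (at 0)"
    proof -
      have "((\<lambda>s. t + s * \<tau>1) has_vector_derivative \<tau>1) (at 0)"
        by (auto intro!: derivative_eq_intros)
      then have "((\<lambda>s. A ((t + s * \<tau>1) *\<^sub>R qone, qone) (\<tau>2 *\<^sub>R qone + (t + s * \<tau>1) *\<^sub>R u2, u2 - w2))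
          has_vector_derivative \<tau>1 *\<^sub>R d2) (at 0)"
        using vector_diff_chain_at[where f = "\<lambda>s. t + s * \<tau>1" and x = 0 and g' = d2
            and g = "\<lambda>s. A (s *\<^sub>R qone, qone) (\<tau>2 *\<^sub>R qone + s *\<^sub>R u2, u2 - w2)"] d2
        by (simp add: o_def)
      moreover have inv_eq: "A (?\<gamma> s) (?V s)
          = A ((t + s * \<tau>1) *\<^sub>R qone, qone) (\<tau>2 *\<^sub>R qone + (t + s * \<tau>1) *\<^sub>R u2, u2 - w2)" if "?p s \<in> cyl R" for s
        using left_invariant_emb[OF inv that u(3,4)] .
      moreover have "\<forall>\<^sub>F s in at 0. A ((t + s * \<tau>1) *\<^sub>R qone, qone) (\<tau>2 *\<^sub>R qone + (t + s * \<tau>1) *\<^sub>R u2, u2 - w2)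
          = A (?\<gamma> s) (?V s)"
        using cyl by (rule eventually_mono) (rule inv_eq[symmetric])
      ultimately show ?thesis
        unfolding has_vector_derivative_def
        by (elim has_derivative_transform_eventually) (use inv_eq[of 0] n c d in auto)
    qed
    ultimately show ?thesis
      using c(1) d(1) by (intro exI[of _ ?\<gamma>] exI[of _ ?V]) auto
  qed
  obtain \<gamma> V where \<gamma>: "\<gamma> 0 = emb (t, a, b)" "\<forall>\<^sub>F s in at (0::real). \<gamma> s \<in> tube R"
      "(\<gamma> has_vector_derivative emb_diff (t, a, b) (\<tau>1, a \<odot> u1, b \<odot> w1)) (at 0)"
    and V: "V 0 = emb_diff (t, a, b) (\<tau>2, a \<odot> u2, b \<odot> w2)"
      "(V has_vector_derivative (\<tau>2 *\<^sub>R (a \<odot> u1) + \<tau>1 *\<^sub>R (a \<odot> u2) + t *\<^sub>R (a \<odot> (u1 \<odot> u2)),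
            a \<odot> (u1 \<odot> (u2 - w2) - (u2 - w2) \<odot> w1) \<odot> qcnj b)) (at 0)"
    and AV: "((\<lambda>s. A (\<gamma> s) (V s)) has_vector_derivative \<tau>1 *\<^sub>R d2) (at 0)"
    using *[OF u d2, of \<tau>1] by (elim exE conjE)
  obtain \<delta> W where \<delta>: "\<delta> 0 = emb (t, a, b)" "\<forall>\<^sub>F s in at (0::real). \<delta> s \<in> tube R"
      "(\<delta> has_vector_derivative emb_diff (t, a, b) (\<tau>2, a \<odot> u2, b \<odot> w2)) (at 0)"
    and W: "W 0 = emb_diff (t, a, b) (\<tau>1, a \<odot> u1, b \<odot> w1)"
      "(W has_vector_derivative (\<tau>1 *\<^sub>R (a \<odot> u2) + \<tau>2 *\<^sub>R (a \<odot> u1) + t *\<^sub>R (a \<odot> (u2 \<odot> u1)),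
            a \<odot> (u2 \<odot> (u1 - w1) - (u1 - w1) \<odot> w2) \<odot> qcnj b)) (at 0)"
    and AW: "((\<lambda>s. A (\<delta> s) (W s)) has_vector_derivative \<tau>2 *\<^sub>R d1) (at 0)"
    using *[OF u(3,4,1,2) d1, of \<tau>2] by (elim exE conjE)
  have br: "su2_bracket u1 u2 \<in> su2" "su2_bracket w1 w2 \<in> su2"
    using u by (simp_all add: su2_bracket_su2)
  have "ext_deriv (tube R) A (emb (t, a, b)) (emb_diff (t, a, b) (\<tau>1, a \<odot> u1, b \<odot> w1))
      (emb_diff (t, a, b) (\<tau>2, a \<odot> u2, b \<odot> w2))
    = \<tau>1 *\<^sub>R d2 - \<tau>2 *\<^sub>R d1 - A (emb (t, a, b))
      ((\<tau>2 *\<^sub>R (a \<odot> u1) + \<tau>1 *\<^sub>R (a \<odot> u2) + t *\<^sub>R (a \<odot> (u1 \<odot> u2)),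
            a \<odot> (u1 \<odot> (u2 - w2) - (u2 - w2) \<odot> w1) \<odot> qcnj b)
       - (\<tau>1 *\<^sub>R (a \<odot> u2) + \<tau>2 *\<^sub>R (a \<odot> u1) + t *\<^sub>R (a \<odot> (u2 \<odot> u1)),
            a \<odot> (u2 \<odot> (u1 - w1) - (u1 - w1) \<odot> w2) \<odot> qcnj b))"
    by (rule ext_deriv_along_curves[OF conn[unfolded connection_on_def] emb_in_tube[OF n] \<gamma> V \<delta> W AV AW])
  \<comment> \<open>The terms symmetric in the two vectors cancel, and the commutators that remain
    form the image of the Lie bracket under the differential of \<open>emb\<close>.\<close>
  also have "((\<tau>2 *\<^sub>R (a \<odot> u1) + \<tau>1 *\<^sub>R (a \<odot> u2) + t *\<^sub>R (a \<odot> (u1 \<odot> u2)),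
            a \<odot> (u1 \<odot> (u2 - w2) - (u2 - w2) \<odot> w1) \<odot> qcnj b)
       - (\<tau>1 *\<^sub>R (a \<odot> u2) + \<tau>2 *\<^sub>R (a \<odot> u1) + t *\<^sub>R (a \<odot> (u2 \<odot> u1)),
            a \<odot> (u2 \<odot> (u1 - w1) - (u1 - w1) \<odot> w2) \<odot> qcnj b))
     = emb_diff (t, a, b) (0, a \<odot> su2_bracket u1 u2, b \<odot> su2_bracket w1 w2)"
    unfolding emb_diff_left_invariant[OF br(2)]
    by (simp add: su2_bracket_def qmul.diff_left qmul.diff_right qmul.scaleR_right algebra_simps)
  finally show ?thesis
    using left_invariant_emb[OF inv n br, of 0] by simp
qed

text \<open>Because g' = - \<alpha> g, the t-derivative of g X g^-1 is g X' g^-1 -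
  [\<alpha>, g X g^-1], and the second term cancels the brackets of A with \<tau> \<alpha>. What
  remains is the curvature in temporal gauge, conjugated by g. In it the quadratic terms come from
  [A, A] and the linear ones from the structure equations.\<close>

lemma curvature_ansatz:
  fixes g :: "real \<Rightarrow> quat"
  assumes conn: "connection_on R A" and inv: "left_invariant_on R A" and n: "(t, a, b) \<in> cyl R"
    and A: "\<And>s \<tau> u w. 0 < s \<Longrightarrow> ereal s < R \<Longrightarrow> u \<in> su2 \<Longrightarrow> w \<in> su2 \<Longrightarrow>
      A (s *\<^sub>R qone, qone) (\<tau> *\<^sub>R qone + s *\<^sub>R u, u - w)
        = \<tau> *\<^sub>R \<alpha> s + g s \<odot> (\<phi> s *\<^sub>R ((1 / 2) *\<^sub>R (u + w)) + \<theta> s *\<^sub>R ((1 / 2) *\<^sub>R (u - w))) \<odot> qcnj (g s)"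
    and g: "g t \<in> SU2" "(g has_vector_derivative - (\<alpha> t \<odot> g t)) (at t)"
    and \<alpha>: "\<alpha> t \<in> su2" "(\<alpha> has_vector_derivative \<alpha>') (at t)"
    and \<phi>: "(\<phi> has_real_derivative p) (at t)" and \<theta>: "(\<theta> has_real_derivative q) (at t)"
    and u: "u1 \<in> su2" "w1 \<in> su2" "u2 \<in> su2" "w2 \<in> su2"
  defines "E1 \<equiv> (1 / 2) *\<^sub>R (u1 + w1)" and "F1 \<equiv> (1 / 2) *\<^sub>R (u1 - w1)"
    and "E2 \<equiv> (1 / 2) *\<^sub>R (u2 + w2)" and "F2 \<equiv> (1 / 2) *\<^sub>R (u2 - w2)"
  shows "curvature R A (emb (t, a, b)) (emb_diff (t, a, b) (\<tau>1, a \<odot> u1, b \<odot> w1))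
      (emb_diff (t, a, b) (\<tau>2, a \<odot> u2, b \<odot> w2))
    = g t \<odot> (\<tau>1 *\<^sub>R (p *\<^sub>R E2 + q *\<^sub>R F2) - \<tau>2 *\<^sub>R (p *\<^sub>R E1 + q *\<^sub>R F1)
        + (\<phi> t ^ 2 - \<phi> t) *\<^sub>R su2_bracket E1 E2 + (\<theta> t ^ 2 - \<phi> t) *\<^sub>R su2_bracket F1 F2
        + (\<phi> t * \<theta> t - \<theta> t) *\<^sub>R (su2_bracket E1 F2 + su2_bracket F1 E2)) \<odot> qcnj (g t)"
proof -
  have t: "0 < t" "ereal t < R"
    using n by (auto simp: cyl_def)
  let ?X = "\<lambda>u w. p *\<^sub>R ((1 / 2) *\<^sub>R (u + w)) + q *\<^sub>R ((1 / 2) *\<^sub>R (u - w))"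
  let ?Y = "\<lambda>s u w. \<phi> s *\<^sub>R ((1 / 2) *\<^sub>R (u + w)) + \<theta> s *\<^sub>R ((1 / 2) *\<^sub>R (u - w))"
  have d: "((\<lambda>s. A (s *\<^sub>R qone, qone) (\<tau> *\<^sub>R qone + s *\<^sub>R u, u - w)) has_vector_derivative
      \<tau> *\<^sub>R \<alpha>' + g t \<odot> ?X u w \<odot> qcnj (g t) - su2_bracket (\<alpha> t) (g t \<odot> ?Y t u w \<odot> qcnj (g t))) (at t)"
    if "u \<in> su2" "w \<in> su2" for \<tau> u w
  proof -
    have "((\<lambda>s. \<tau> *\<^sub>R \<alpha> s + g s \<odot> ?Y s u w \<odot> qcnj (g s)) has_vector_derivative
      \<tau> *\<^sub>R \<alpha>' + (g t \<odot> ?Y t u w \<odot> qcnj (- (\<alpha> t \<odot> g t)) + (g t \<odot> ?X u w + - (\<alpha> t \<odot> g t) \<odot> ?Y t u w) \<odot> qcnj (g t))) (at t)"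
      using \<phi> \<theta> unfolding has_real_derivative_iff_has_vector_derivative
      by (intro has_vector_derivative_add qmul_vector_derivative qcnj_vector_derivative g(2)
          bounded_linear.has_vector_derivative[OF bounded_linear_scaleR_right] \<alpha>(2)
          bounded_linear.has_vector_derivative[OF bounded_linear_scaleR_left])
    moreover have "\<tau> *\<^sub>R \<alpha>' + (g t \<odot> ?Y t u w \<odot> qcnj (- (\<alpha> t \<odot> g t)) + (g t \<odot> ?X u w + - (\<alpha> t \<odot> g t) \<odot> ?Y t u w) \<odot> qcnj (g t))
        = \<tau> *\<^sub>R \<alpha>' + g t \<odot> ?X u w \<odot> qcnj (g t) - su2_bracket (\<alpha> t) (g t \<odot> ?Y t u w \<odot> qcnj (g t))"
      (is "_ + (g t \<odot> ?y \<odot> _ + (g t \<odot> ?x + _) \<odot> _) = _")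
    proof -
      have "g t \<odot> y \<odot> qcnj (- (\<alpha> t \<odot> g t)) + (g t \<odot> x + - (\<alpha> t \<odot> g t) \<odot> y) \<odot> qcnj (g t)
          = g t \<odot> x \<odot> qcnj (g t) - su2_bracket (\<alpha> t) (g t \<odot> y \<odot> qcnj (g t))" for x y
        using \<alpha>(1) unfolding su2_iff_qcnj
        by (simp add: su2_bracket_def qcnj_linear qcnj_qmul qmul.minus_right qmul.minus_left qmul.add_left
            qmul.diff_left qmul_assoc)
      from this[of ?y ?x] show ?thesis by (simp only: add_diff_eq)
    qed
    ultimately have "((\<lambda>s. \<tau> *\<^sub>R \<alpha> s + g s \<odot> ?Y s u w \<odot> qcnj (g s)) has_vector_derivative
        \<tau> *\<^sub>R \<alpha>' + g t \<odot> ?X u w \<odot> qcnj (g t) - su2_bracket (\<alpha> t) (g t \<odot> ?Y t u w \<odot> qcnj (g t))) (at t)"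
      by (simp only:)
    moreover have "\<forall>\<^sub>F s in at t. \<tau> *\<^sub>R \<alpha> s + g s \<odot> ?Y s u w \<odot> qcnj (g s)
        = A (s *\<^sub>R qone, qone) (\<tau> *\<^sub>R qone + s *\<^sub>R u, u - w)"
    proof -
      have "\<forall>\<^sub>F s in at t. ereal (norm s) < R" "\<forall>\<^sub>F s in at t. 0 < s"
        using t eventually_norm_less[where \<gamma> = "\<lambda>s. s" and ?s0.0 = t and R = R] order_tendstoD(1)[OF tendsto_ident_at t(1)] by auto
      then show ?thesis
        by eventually_elim (simp add: A that)
    qed
    ultimately show ?thesis
      unfolding has_vector_derivative_def
      by (elim has_derivative_transform_eventually) (simp_all add: A[OF t that])
  qed
  have At: "A (t *\<^sub>R qone, qone) (\<tau> *\<^sub>R qone + t *\<^sub>R u, u - w) = \<tau> *\<^sub>R \<alpha> t + g t \<odot> ?Y t u w \<odot> qcnj (g t)"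
    if "u \<in> su2" "w \<in> su2" for \<tau> u w
    using A[OF t that] .
  have br: "su2_bracket u1 u2 \<in> su2" "su2_bracket w1 w2 \<in> su2"
    using u by (simp_all add: su2_bracket_su2)
  have gg: "qcnj (g t) \<odot> (g t \<odot> x) = x" for x
    using g(1) by simp
  have bg: "su2_bracket (g t \<odot> x \<odot> qcnj (g t)) (g t \<odot> y \<odot> qcnj (g t)) = g t \<odot> su2_bracket x y \<odot> qcnj (g t)" for x y
    by (simp add: su2_bracket_def qmul_assoc gg qmul.diff_left qmul.diff_right)
  have bsum: "su2_bracket (x + y) z = su2_bracket x z + su2_bracket y z"
    "su2_bracket z (x + y) = su2_bracket z x + su2_bracket z y"
    "su2_bracket (r *\<^sub>R x) z = r *\<^sub>R su2_bracket x z" "su2_bracket z (r *\<^sub>R x) = r *\<^sub>R su2_bracket z x"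
    "su2_bracket x x = 0" for x y z r
    by (simp_all add: su2_bracket_def qmul.add_left qmul.add_right qmul.scaleR_left qmul.scaleR_right scaleR_diff_right)
  have banti: "su2_bracket x y = - su2_bracket y x" for x y
    by (simp add: su2_bracket_def)
  \<comment> \<open>The symmetric pair at work: brackets of two diagonal or of two antidiagonal
    parts are diagonal, mixed brackets are antidiagonal.\<close>
  have Y: "?Y t (su2_bracket u1 u2) (su2_bracket w1 w2)
     = \<phi> t *\<^sub>R (su2_bracket E1 E2 + su2_bracket F1 F2) + \<theta> t *\<^sub>R (su2_bracket E1 F2 + su2_bracket F1 E2)"
  proof -
    have u_w: "u1 = E1 + F1" "w1 = E1 - F1" "u2 = E2 + F2" "w2 = E2 - F2"
      unfolding E1_def F1_def E2_def F2_def by (simp_all flip: scaleR_add_right scaleR_diff_right add: scaleR_2[symmetric])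
    have "su2_bracket u1 u2 + su2_bracket w1 w2 = 2 *\<^sub>R (su2_bracket E1 E2 + su2_bracket F1 F2)"
      "su2_bracket u1 u2 - su2_bracket w1 w2 = 2 *\<^sub>R (su2_bracket E1 F2 + su2_bracket F1 E2)"
      unfolding u_w scaleR_2 by (simp_all add: su2_bracket_def qmul.add_left qmul.add_right
          qmul.diff_left qmul.diff_right algebra_simps)
    then show ?thesis by simp
  qed
  have "curvature R A (emb (t, a, b)) (emb_diff (t, a, b) (\<tau>1, a \<odot> u1, b \<odot> w1))
      (emb_diff (t, a, b) (\<tau>2, a \<odot> u2, b \<odot> w2))
    = \<tau>1 *\<^sub>R (\<tau>2 *\<^sub>R \<alpha>' + g t \<odot> ?X u2 w2 \<odot> qcnj (g t) - su2_bracket (\<alpha> t) (g t \<odot> ?Y t u2 w2 \<odot> qcnj (g t)))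
      - \<tau>2 *\<^sub>R (\<tau>1 *\<^sub>R \<alpha>' + g t \<odot> ?X u1 w1 \<odot> qcnj (g t) - su2_bracket (\<alpha> t) (g t \<odot> ?Y t u1 w1 \<odot> qcnj (g t)))
      - g t \<odot> ?Y t (su2_bracket u1 u2) (su2_bracket w1 w2) \<odot> qcnj (g t)
      + su2_bracket (\<tau>1 *\<^sub>R \<alpha> t + g t \<odot> ?Y t u1 w1 \<odot> qcnj (g t)) (\<tau>2 *\<^sub>R \<alpha> t + g t \<odot> ?Y t u2 w2 \<odot> qcnj (g t))"
    unfolding curvature_def ext_deriv_left_invariant[OF conn inv n u d[OF u(1,2)] d[OF u(3,4)]]
      left_invariant_emb[OF inv n u(1,2)] left_invariant_emb[OF inv n u(3,4)] At[OF u(1,2)] At[OF u(3,4)]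
    using At[OF br, of 0] by simp
  also have "\<dots> = \<tau>1 *\<^sub>R (g t \<odot> ?X u2 w2 \<odot> qcnj (g t)) - \<tau>2 *\<^sub>R (g t \<odot> ?X u1 w1 \<odot> qcnj (g t))
      - g t \<odot> ?Y t (su2_bracket u1 u2) (su2_bracket w1 w2) \<odot> qcnj (g t)
      + g t \<odot> su2_bracket (?Y t u1 w1) (?Y t u2 w2) \<odot> qcnj (g t)"
  proof -
    \<comment> \<open>The second derivatives of the gauge, here \<open>\<alpha>'\<close>, cancel by
      antisymmetry, and the brackets with \<open>\<alpha> t\<close> cancel against those in the
      expanded commutator.\<close>
    have "\<tau>1 *\<^sub>R (\<tau>2 *\<^sub>R \<alpha>' + P2 - su2_bracket (\<alpha> t) Q2) - \<tau>2 *\<^sub>R (\<tau>1 *\<^sub>R \<alpha>' + P1 - su2_bracket (\<alpha> t) Q1) - Z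
        + su2_bracket (\<tau>1 *\<^sub>R \<alpha> t + Q1) (\<tau>2 *\<^sub>R \<alpha> t + Q2)
      = \<tau>1 *\<^sub>R P2 - \<tau>2 *\<^sub>R P1 - Z + su2_bracket Q1 Q2" for P1 P2 Q1 Q2 Z
      unfolding bsum banti[of Q1 "\<alpha> t"]
      by (simp add: scaleR_diff_right scaleR_add_right mult.commute)
    then show ?thesis
      unfolding bg[symmetric] .
  qed
  also have "\<dots> = g t \<odot> (\<tau>1 *\<^sub>R ?X u2 w2 - \<tau>2 *\<^sub>R ?X u1 w1
      - ?Y t (su2_bracket u1 u2) (su2_bracket w1 w2) + su2_bracket (?Y t u1 w1) (?Y t u2 w2)) \<odot> qcnj (g t)"
    by (simp only: qmul.add_left qmul.add_right qmul.diff_left qmul.diff_right qmul.scaleR_left qmul.scaleR_right)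
  also have "\<tau>1 *\<^sub>R ?X u2 w2 - \<tau>2 *\<^sub>R ?X u1 w1
      - ?Y t (su2_bracket u1 u2) (su2_bracket w1 w2) + su2_bracket (?Y t u1 w1) (?Y t u2 w2)
    = \<tau>1 *\<^sub>R (p *\<^sub>R E2 + q *\<^sub>R F2) - \<tau>2 *\<^sub>R (p *\<^sub>R E1 + q *\<^sub>R F1)
        + (\<phi> t ^ 2 - \<phi> t) *\<^sub>R su2_bracket E1 E2 + (\<theta> t ^ 2 - \<phi> t) *\<^sub>R su2_bracket F1 F2
        + (\<phi> t * \<theta> t - \<theta> t) *\<^sub>R (su2_bracket E1 F2 + su2_bracket F1 E2)"
    unfolding Y E1_def[symmetric] E2_def[symmetric] F1_def[symmetric] F2_def[symmetric] bsum
    by (simp add: algebra_simps power2_eq_square)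
  finally show ?thesis .
qed

section \<open>The instanton equation for invariant connections\<close>

lemma wedge_cong:
  assumes "\<And>\<sigma>. \<sigma> permutes {..<k + l} \<Longrightarrow> \<alpha> (\<lambda>i. v (\<sigma> i)) = \<alpha>' (\<lambda>i. v (\<sigma> i))"
  shows "wedge k l \<alpha> \<beta> v = wedge k l \<alpha>' \<beta> v"
  unfolding wedge_def using assms by (intro arg_cong[of _ _ "(*\<^sub>R) _"] sum.cong) auto

lemma alt_2: "alt 2 a v = a v - a (\<lambda>i. v (Transposition.transpose 0 1 i))"
proof -
  have "{\<sigma>. \<sigma> permutes {..<2::nat}} = {id, Transposition.transpose 0 1}"
    by (auto simp: numeral_2_eq_2 lessThan_Suc permutes_doubleton_iff insert_commute)
  moreover have "id \<noteq> Transposition.transpose 0 (1::nat)"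
    by (metis id_apply transpose_apply_first zero_neq_one)
  ultimately show ?thesis
    by (simp add: alt_def sign_swap_id sign_id)
qed

lemma sum_T_su2: "(\<Sum>i\<in>UNIV. c i *\<^sub>R T_su2 i) = (0, \<chi> i. c i)"
  by (simp add: sum_3 T_su2_def prod_eq_iff vec_eq_iff forall_3 axis_def)

lemma eta_left_invariant:
  assumes "a \<in> SU2" "b \<in> SU2"
  shows "eta_p i (t, a, b) (\<tau>, a \<odot> u, b \<odot> w) = (snd u $ i + snd w $ i) / 2"
    and "eta_m i (t, a, b) (\<tau>, a \<odot> u, b \<odot> w) = (snd u $ i - snd w $ i) / 2"
  using assms by (simp_all add: eta_p_def eta_m_def)

lemma su2_bracket_su2_eq: "u \<in> su2 \<Longrightarrow> w \<in> su2 \<Longrightarrow> su2_bracket u w = (0, 2 *\<^sub>R cross3 (snd u) (snd w))"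
  by (simp add: su2_bracket_def su2_def qmul_def prod_eq_iff inner_commute cross_skew[of "snd w"] scaleR_2)

text \<open>The doubled coefficients come from [T_i, T_j] = 2 \<epsilon>_ijk T_k: the bracket is
  twice the cross product, whose components are the cyclic wedge products.\<close>

lemma curvature_tensor:
  assumes "a \<in> SU2" "b \<in> SU2" and u: "u1 \<in> su2" "w1 \<in> su2" "u2 \<in> su2" "w2 \<in> su2"
    and v: "v 0 = (\<tau>1, a \<odot> u1, b \<odot> w1)" "v (Suc 0) = (\<tau>2, a \<odot> u2, b \<odot> w2)"
  defines "E1 \<equiv> (1 / 2) *\<^sub>R (u1 + w1)" and "F1 \<equiv> (1 / 2) *\<^sub>R (u1 - w1)"
    and "E2 \<equiv> (1 / 2) *\<^sub>R (u2 + w2)" and "F2 \<equiv> (1 / 2) *\<^sub>R (u2 - w2)"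
  shows "\<tau>1 *\<^sub>R (p *\<^sub>R E2 + q *\<^sub>R F2) - \<tau>2 *\<^sub>R (p *\<^sub>R E1 + q *\<^sub>R F1)
        + x *\<^sub>R su2_bracket E1 E2 + y *\<^sub>R su2_bracket F1 F2
        + z *\<^sub>R (su2_bracket E1 F2 + su2_bracket F1 E2)
    = (\<Sum>i\<in>UNIV. alt 2 (tensor (coframe (t, a, b)) (curv_L p q (2 * x) (2 * y) (2 * z) i)) v *\<^sub>R T_su2 i)"
proof -
  have EF: "E1 \<in> su2" "F1 \<in> su2" "E2 \<in> su2" "F2 \<in> su2"
    using u by (simp_all add: E1_def F1_def E2_def F2_def su2_def)
  have co: "coframe (t, a, b) (Suc 0) (v 0) = snd E1 $ 1" "coframe (t, a, b) (Suc 0) (v (Suc 0)) = snd E2 $ 1"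
    "coframe (t, a, b) 2 (v 0) = snd E1 $ 2" "coframe (t, a, b) 2 (v (Suc 0)) = snd E2 $ 2"
    "coframe (t, a, b) 3 (v 0) = snd E1 $ 3" "coframe (t, a, b) 3 (v (Suc 0)) = snd E2 $ 3"
    "coframe (t, a, b) 4 (v 0) = snd F1 $ 1" "coframe (t, a, b) 4 (v (Suc 0)) = snd F2 $ 1"
    "coframe (t, a, b) 5 (v 0) = snd F1 $ 2" "coframe (t, a, b) 5 (v (Suc 0)) = snd F2 $ 2"
    "coframe (t, a, b) 6 (v 0) = snd F1 $ 3" "coframe (t, a, b) 6 (v (Suc 0)) = snd F2 $ 3"
    "coframe (t, a, b) 0 (v 0) = \<tau>1" "coframe (t, a, b) 0 (v (Suc 0)) = \<tau>2"
    by (simp_all add: coframe_def v eta_left_invariant assms(1,2) E1_def E2_def F1_def F2_def)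
  show ?thesis
    using EF unfolding sum_T_su2
    by (simp add: su2_bracket_su2_eq prod_eq_iff vec_eq_iff forall_3 alt_2 curv_L_def tensor_Cons co
        cross3_def su2_def Transposition.transpose_def algebra_simps)
qed

text \<open>At a fixed point, conjugation by g(t) is a constant linear map and can be moved from the
  curvature to the basis T_i. The curvature formula is available on tangent vectors only, hence the
  detour through \<open>wedge_cong\<close>.\<close>

lemma wedge_ansatz:
  fixes g :: "real \<Rightarrow> quat"
  assumes conn: "connection_on R A" and inv: "left_invariant_on R A" and n: "(t, a, b) \<in> cyl R"
    and A: "\<And>s \<tau> u w. 0 < s \<Longrightarrow> ereal s < R \<Longrightarrow> u \<in> su2 \<Longrightarrow> w \<in> su2 \<Longrightarrow>
      A (s *\<^sub>R qone, qone) (\<tau> *\<^sub>R qone + s *\<^sub>R u, u - w)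
        = \<tau> *\<^sub>R \<alpha> s + g s \<odot> (\<phi> s *\<^sub>R ((1 / 2) *\<^sub>R (u + w)) + \<theta> s *\<^sub>R ((1 / 2) *\<^sub>R (u - w))) \<odot> qcnj (g s)"
    and g: "g t \<in> SU2" "(g has_vector_derivative - (\<alpha> t \<odot> g t)) (at t)"
    and \<alpha>: "\<alpha> t \<in> su2" "(\<alpha> has_vector_derivative \<alpha>') (at t)"
    and \<phi>: "(\<phi> has_real_derivative p) (at t)" and \<theta>: "(\<theta> has_real_derivative q) (at t)"
    and v: "\<And>i. i < 6 \<Longrightarrow> v i \<in> tangent_space (cyl R) (t, a, b)"
  shows "wedge 2 4 (\<lambda>u. curvature R A (emb (t, a, b)) (emb_diff (t, a, b) (u 0)) (emb_diff (t, a, b) (u 1)))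
      (psi (t, a, b)) v
    = (\<Sum>i\<in>UNIV. wedge 2 4 (alt 2 (tensor (coframe (t, a, b)) (curv_L p q (2 * (\<phi> t ^ 2 - \<phi> t))
        (2 * (\<theta> t ^ 2 - \<phi> t)) (2 * (\<phi> t * \<theta> t - \<theta> t)) i))) (psi (t, a, b)) v
          *\<^sub>R (g t \<odot> T_su2 i \<odot> qcnj (g t)))"
proof -
  have ab: "a \<in> SU2" "b \<in> SU2" using n by (auto simp: cyl_def)
  let ?F = "\<lambda>i. alt 2 (tensor (coframe (t, a, b)) (curv_L p q (2 * (\<phi> t ^ 2 - \<phi> t))
        (2 * (\<theta> t ^ 2 - \<phi> t)) (2 * (\<phi> t * \<theta> t - \<theta> t)) i))"
  have "wedge 2 4 (\<lambda>u. curvature R A (emb (t, a, b)) (emb_diff (t, a, b) (u 0)) (emb_diff (t, a, b) (u 1)))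
      (psi (t, a, b)) v
    = wedge 2 4 (\<lambda>u. \<Sum>i\<in>UNIV. ?F i u *\<^sub>R (g t \<odot> T_su2 i \<odot> qcnj (g t))) (psi (t, a, b)) v"
  proof (rule wedge_cong)
    fix \<sigma> :: "nat \<Rightarrow> nat" assume "\<sigma> permutes {..<2 + 4}"
    then have "\<sigma> 0 < 6" "\<sigma> 1 < 6"
      using permutes_in_image[of \<sigma> "{..<6}"] by auto
    then have v01: "v (\<sigma> 0) \<in> tangent_space (cyl R) (t, a, b)" "v (\<sigma> 1) \<in> tangent_space (cyl R) (t, a, b)"
      using v by auto
    obtain \<tau>1 u1 w1 where 1: "u1 \<in> su2" "w1 \<in> su2" "v (\<sigma> 0) = (\<tau>1, a \<odot> u1, b \<odot> w1)"
      by (rule tangent_cylE[OF v01(1) ab])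
    obtain \<tau>2 u2 w2 where 2: "u2 \<in> su2" "w2 \<in> su2" "v (\<sigma> 1) = (\<tau>2, a \<odot> u2, b \<odot> w2)"
      by (rule tangent_cylE[OF v01(2) ab])
    have lin: "g t \<odot> (\<Sum>i\<in>UNIV. c i *\<^sub>R T_su2 i) \<odot> qcnj (g t)
        = (\<Sum>i\<in>UNIV. c i *\<^sub>R (g t \<odot> T_su2 i \<odot> qcnj (g t)))" for c
      by (simp add: sum_3 qmul.add_left qmul.add_right qmul.scaleR_left qmul.scaleR_right)
    have v': "(\<lambda>i. v (\<sigma> i)) 0 = (\<tau>1, a \<odot> u1, b \<odot> w1)" "(\<lambda>i. v (\<sigma> i)) (Suc 0) = (\<tau>2, a \<odot> u2, b \<odot> w2)"
      using 1(3) 2(3) by simp_all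
    show "curvature R A (emb (t, a, b)) (emb_diff (t, a, b) (v (\<sigma> 0))) (emb_diff (t, a, b) (v (\<sigma> 1)))
        = (\<Sum>i\<in>UNIV. ?F i (\<lambda>i. v (\<sigma> i)) *\<^sub>R (g t \<odot> T_su2 i \<odot> qcnj (g t)))"
      unfolding 1(3) 2(3) lin[symmetric] curvature_tensor[OF ab 1(1,2) 2(1,2) v', symmetric]
      by (rule curvature_ansatz[OF conn inv n A g \<alpha> \<phi> \<theta> 1(1,2) 2(1,2)])
  qed
  then show ?thesis
    by (simp only: wedge_sum_left[OF finite])
qed

definition instanton_rhs :: "real \<Rightarrow> real \<Rightarrow> real \<Rightarrow> real"
  where "instanton_rhs t f h = (f - f ^ 2) / bs_A t + bs_A t * (h ^ 2 - f) / bs_B t ^ 2"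

lemma instanton_rhs:
  assumes "0 < t"
  shows "- 16 * bs_A t ^ 2 * bs_B t ^ 2 * p - 8 * bs_B t ^ 2 * bs_A t * (2 * (f ^ 2 - f))
      + 8 * bs_A t ^ 3 * (2 * (h ^ 2 - f)) = 0 \<longleftrightarrow> p = instanton_rhs t f h"
    and "- 16 * bs_A t ^ 2 * bs_B t ^ 2 * q + 16 * bs_B t ^ 2 * bs_A t * (2 * (f * h - h)) = 0
      \<longleftrightarrow> q = 2 * (f - 1) * h / bs_A t"
proof -
  have A: "bs_A t \<noteq> 0" "bs_B t \<noteq> 0"
    using bs_A_pos[OF assms] bs_B_pos[OF assms] by auto
  have "- 16 * bs_A t ^ 2 * bs_B t ^ 2 * p - 8 * bs_B t ^ 2 * bs_A t * (2 * (f ^ 2 - f))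
      + 8 * bs_A t ^ 3 * (2 * (h ^ 2 - f)) = 16 * bs_A t ^ 2 * bs_B t ^ 2 * (instanton_rhs t f h - p)"
    using A by (simp add: instanton_rhs_def field_simps power2_eq_square power3_eq_cube)
  then show "- 16 * bs_A t ^ 2 * bs_B t ^ 2 * p - 8 * bs_B t ^ 2 * bs_A t * (2 * (f ^ 2 - f))
      + 8 * bs_A t ^ 3 * (2 * (h ^ 2 - f)) = 0 \<longleftrightarrow> p = instanton_rhs t f h"
    using A by auto
  have "- 16 * bs_A t ^ 2 * bs_B t ^ 2 * q + 16 * bs_B t ^ 2 * bs_A t * (2 * (f * h - h))
      = 16 * bs_A t ^ 2 * bs_B t ^ 2 * (2 * (f - 1) * h / bs_A t - q)"
    using A by (simp add: field_simps power2_eq_square)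
  then show "- 16 * bs_A t ^ 2 * bs_B t ^ 2 * q + 16 * bs_B t ^ 2 * bs_A t * (2 * (f * h - h)) = 0
      \<longleftrightarrow> q = 2 * (f - 1) * h / bs_A t"
    using A by auto
qed

lemma UNIV_3_cases: "(i::3) = 1 \<or> i = 2 \<or> i = 3"
  using exhaust_3 by blast

text \<open>Evaluating the 6-form at (t, 1, 1) on six vectors of the frame dual to the coframe
  isolates K and M.\<close>

lemma ansatz_instanton_ode:
  fixes g :: "real \<Rightarrow> quat"
  assumes conn: "connection_on R A" and inv: "left_invariant_on R A" and t: "0 < t" "ereal t < R"
    and A: "\<And>s \<tau> u w. 0 < s \<Longrightarrow> ereal s < R \<Longrightarrow> u \<in> su2 \<Longrightarrow> w \<in> su2 \<Longrightarrow>
      A (s *\<^sub>R qone, qone) (\<tau> *\<^sub>R qone + s *\<^sub>R u, u - w)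
        = \<tau> *\<^sub>R \<alpha> s + g s \<odot> (\<phi> s *\<^sub>R ((1 / 2) *\<^sub>R (u + w)) + \<theta> s *\<^sub>R ((1 / 2) *\<^sub>R (u - w))) \<odot> qcnj (g s)"
    and g: "g t \<in> SU2" "(g has_vector_derivative - (\<alpha> t \<odot> g t)) (at t)"
    and \<alpha>: "\<alpha> t \<in> su2" "(\<alpha> has_vector_derivative \<alpha>') (at t)"
    and \<phi>: "(\<phi> has_real_derivative p) (at t)" and \<theta>: "(\<theta> has_real_derivative q) (at t)"
    and G2: "G2_instanton R A"
  shows "p = instanton_rhs t (\<phi> t) (\<theta> t)" "q = 2 * (\<phi> t - 1) * \<theta> t / bs_A t"
proof -
  let ?n = "(t, qone, qone)"
  have n: "?n \<in> cyl R" using t by (simp add: cyl_def)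
  \<comment> \<open>The dual frame in the same numbering: the t-direction, the (T_i, T_i) and the
    (T_i, - T_i).\<close>
  define B :: "nat \<Rightarrow> cylpt" where "B k = [(1, 0, 0), (0, qone \<odot> T_su2 1, qone \<odot> T_su2 1), (0, qone \<odot> T_su2 2, qone \<odot> T_su2 2),
    (0, qone \<odot> T_su2 3, qone \<odot> T_su2 3), (0, qone \<odot> T_su2 1, - (qone \<odot> T_su2 1)),
    (0, qone \<odot> T_su2 2, - (qone \<odot> T_su2 2)), (0, qone \<odot> T_su2 3, - (qone \<odot> T_su2 3))] ! k" for k :: nat
  have B: "B k \<in> tangent_space (cyl R) ?n" if "k \<in> {0, 1, 2, 3, 4, 5, 6}" for k
  proof -
    have T: "T_su2 i \<in> su2" "- T_su2 i \<in> su2" "0 \<in> su2" for i by (simp_all add: T_su2_def su2_def)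
    note tan = cyl_tangent[OF n, simplified]
    have "fst (snd (B k)) \<in> su2" "snd (snd (B k)) \<in> su2"
      using that T by (auto simp: B_def)
    from tan[OF this, of "fst (B k)"] show ?thesis by simp
  qed
  have dual: "coframe ?n i (B j) = (if i = j then 1 else 0)"
    if "i \<in> {0, 1, 2, 3, 4, 5, 6}" "j \<in> {0, 1, 2, 3, 4, 5, 6}" for i j
  proof -
    have z: "eta_p k ?n (1, 0, 0) = 0" "eta_m k ?n (1, 0, 0) = 0" for k
      by (simp_all add: eta_p_def eta_m_def qmul_def)
    show ?thesis
      using that by (auto simp: coframe_def B_def z eta_dual[of qone qone, simplified])
  qed
  let ?W = "\<lambda>v i. wedge 2 4 (alt 2 (tensor (coframe ?n) (curv_L p q (2 * (\<phi> t ^ 2 - \<phi> t))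
        (2 * (\<theta> t ^ 2 - \<phi> t)) (2 * (\<phi> t * \<theta> t - \<theta> t)) i))) (psi ?n) v"
  have zero: "(\<Sum>i\<in>UNIV. ?W (\<lambda>k. B (l ! k)) i *\<^sub>R (g t \<odot> T_su2 i \<odot> qcnj (g t))) = 0"
    if "length l = 6" "set l \<subseteq> {0, 1, 2, 3, 4, 5, 6}" for l
  proof -
    have v: "B (l ! k) \<in> tangent_space (cyl R) ?n" if "k < 6" for k
    proof (rule B)
      have "l ! k \<in> set l" using \<open>length l = 6\<close> that by simp
      then show "l ! k \<in> {0, 1, 2, 3, 4, 5, 6}" using \<open>set l \<subseteq> _\<close> by (rule subsetD[rotated])
    qed
    have "wedge 2 4 (\<lambda>u. curvature R A (emb ?n) (emb_diff ?n (u 0)) (emb_diff ?n (u 1))) (psi ?n) (\<lambda>k. B (l ! k)) = 0"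
      using v by (intro G2[unfolded G2_instanton_def, THEN bspec, OF n, THEN spec, THEN mp]) simp
    then show ?thesis
      using wedge_ansatz[OF conn inv n A g \<alpha> \<phi> \<theta>, of "\<lambda>k. B (l ! k)"] v by simp
  qed
  have gT: "g t \<odot> T_su2 1 \<odot> qcnj (g t) \<noteq> 0"
  proof
    assume "g t \<odot> T_su2 1 \<odot> qcnj (g t) = 0"
    moreover have "norm (g t \<odot> T_su2 1 \<odot> qcnj (g t)) = norm (T_su2 1)"
      using g(1) by (simp add: norm_qmul SU2_def)
    ultimately have "norm (T_su2 1) = 0"
      by simp
    then show False by (simp add: T_su2_def)
  qed
  have D0: "D6 (coframe ?n) i0 i1 i2 i3 i4 i5 (\<lambda>k. B (l ! k)) = 0"
    if "i \<in> {i0, i1, i2, i3, i4, i5}" "i \<notin> set l" "length l = 6" "set l \<subseteq> {0, 1, 2, 3, 4, 5, 6}" "i \<in> {0, 1, 2, 3, 4, 5, 6}"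
    for i i0 i1 i2 i3 i4 i5 l
  proof (rule D6_zero[OF _ that(1)])
    fix k :: nat assume "k < 6"
    then have "l ! k \<in> set l" using that(3) by simp
    then show "coframe ?n i (B (l ! k)) = 0"
      using that dual[of i "l ! k"] by auto
  qed
  \<comment> \<open>Leaving out the vector dual to \<eta>_1^- kills every 6-form that contains this
    covector, which leaves K in the T_1-component. The second list leaves out the vector dual to
    \<eta>_1^+ and isolates M.\<close>
  let ?l1 = "[0, 1, 2, 3, 5, 6::nat]"
  have "D6 (coframe ?n) 0 1 2 3 5 6 (\<lambda>k. B (?l1 ! k)) = 1"
    by (rule D6_dual) (simp, rule dual, auto)
  then have "?W (\<lambda>k. B (?l1 ! k)) 1 = - 16 * bs_A t ^ 2 * bs_B t ^ 2 * p
      - 8 * bs_B t ^ 2 * bs_A t * (2 * (\<phi> t ^ 2 - \<phi> t)) + 8 * bs_A t ^ 3 * (2 * (\<theta> t ^ 2 - \<phi> t))"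
    "?W (\<lambda>k. B (?l1 ! k)) 2 = 0" "?W (\<lambda>k. B (?l1 ! k)) 3 = 0"
    unfolding wedge_curv_psi by (simp_all add: D0[where i = 4])
  then show "p = instanton_rhs t (\<phi> t) (\<theta> t)"
    using zero[of ?l1] gT unfolding instanton_rhs(1)[OF t(1), symmetric] by (simp add: sum_3)
  let ?l2 = "[0, 2, 3, 4, 5, 6::nat]"
  have "D6 (coframe ?n) 0 2 3 4 5 6 (\<lambda>k. B (?l2 ! k)) = 1"
    by (rule D6_dual) (simp, rule dual, auto)
  then have "?W (\<lambda>k. B (?l2 ! k)) 1 = - 16 * bs_A t ^ 2 * bs_B t ^ 2 * q
      + 16 * bs_B t ^ 2 * bs_A t * (2 * (\<phi> t * \<theta> t - \<theta> t))"
    "?W (\<lambda>k. B (?l2 ! k)) 2 = 0" "?W (\<lambda>k. B (?l2 ! k)) 3 = 0"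
    unfolding wedge_curv_psi by (simp_all add: D0[where i = 1])
  then show "q = 2 * (\<phi> t - 1) * \<theta> t / bs_A t"
    using zero[of ?l2] gT unfolding instanton_rhs(2)[OF t(1), symmetric] by (simp add: sum_3)
qed

text \<open>The converse for \<theta> = 0, \<alpha> = 0 and g = 1: then M is identically 0, and the
  differential equation for \<phi> says that K = 0.\<close>

lemma ansatz_G2_instanton:
  assumes conn: "connection_on R A" and inv: "left_invariant_on R A"
    and A: "\<And>s \<tau> u w. 0 < s \<Longrightarrow> ereal s < R \<Longrightarrow> u \<in> su2 \<Longrightarrow> w \<in> su2 \<Longrightarrow>
      A (s *\<^sub>R qone, qone) (\<tau> *\<^sub>R qone + s *\<^sub>R u, u - w) = \<phi> s *\<^sub>R ((1 / 2) *\<^sub>R (u + w))"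
    and \<phi>: "\<And>s. 0 < s \<Longrightarrow> ereal s < R \<Longrightarrow> (\<phi> has_real_derivative instanton_rhs s (\<phi> s) 0) (at s)"
  shows "G2_instanton R A"
  unfolding G2_instanton_def
proof (intro ballI allI impI)
  fix n and v :: "nat \<Rightarrow> cylpt" assume n: "n \<in> cyl R" and v: "\<forall>i<6. v i \<in> tangent_space (cyl R) n"
  obtain t a b where n_eq: "n = (t, a, b)" by (metis prod_cases3)
  have t: "0 < t" "ereal t < R" using n by (auto simp: n_eq cyl_def)
  let ?p = "instanton_rhs t (\<phi> t) 0"
  have rhs: "- 16 * bs_A t ^ 2 * bs_B t ^ 2 * ?p - 8 * bs_B t ^ 2 * bs_A t * (2 * (\<phi> t ^ 2 - \<phi> t))
      + 8 * bs_A t ^ 3 * (2 * (0 ^ 2 - \<phi> t)) = 0"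
    using instanton_rhs(1)[OF t(1), of ?p "\<phi> t" 0] by simp
  have "wedge 2 4 (alt 2 (tensor (coframe n) (curv_L ?p 0 (2 * (\<phi> t ^ 2 - \<phi> t))
        (2 * (0 ^ 2 - \<phi> t)) (2 * (\<phi> t * 0 - 0)) i))) (psi n) v = 0" for i
    using UNIV_3_cases[of i] rhs by (elim disjE) (simp_all only: wedge_curv_psi n_eq fst_conv, simp_all)
  moreover have "wedge 2 4 (\<lambda>u. curvature R A (emb n) (emb_diff n (u 0)) (emb_diff n (u 1))) (psi n) v
    = (\<Sum>i\<in>UNIV. wedge 2 4 (alt 2 (tensor (coframe n) (curv_L ?p 0 (2 * (\<phi> t ^ 2 - \<phi> t))
        (2 * (0 ^ 2 - \<phi> t)) (2 * (\<phi> t * 0 - 0)) i))) (psi n) v *\<^sub>R (qone \<odot> T_su2 i \<odot> qcnj qone))"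
    unfolding n_eq
    by (rule wedge_ansatz[OF conn inv n[unfolded n_eq], where \<alpha> = "\<lambda>_. 0" and \<alpha>' = 0 and \<theta> = "\<lambda>_. 0" and g = "\<lambda>_. qone" and \<phi> = \<phi>])
      (use A \<phi>[OF t] v in \<open>auto simp: n_eq su2_def\<close>)
  ultimately show "wedge 2 4 (\<lambda>u. curvature R A (emb n) (emb_diff n (u 0)) (emb_diff n (u 1))) (psi n) v = 0"
    by (simp only:) simp
qed

lemma restricts_to_ansatz:
  assumes inv: "left_invariant_on R A"
    and A: "\<And>s \<tau> u w. s \<in> I \<Longrightarrow> 0 < s \<Longrightarrow> ereal s < R \<Longrightarrow> u \<in> su2 \<Longrightarrow> w \<in> su2 \<Longrightarrow>
      A (s *\<^sub>R qone, qone) (\<tau> *\<^sub>R qone + s *\<^sub>R u, u - w)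
        = (bs_A s * x s) *\<^sub>R ((1 / 2) *\<^sub>R (u + w)) + (bs_B s * y s) *\<^sub>R ((1 / 2) *\<^sub>R (u - w))"
  shows "restricts_to R I A (ansatz x y)"
  unfolding restricts_to_def
proof (intro ballI impI)
  fix n v assume n: "n \<in> cyl R" and I: "fst n \<in> I" and v: "v \<in> tangent_space (cyl R) n"
  obtain t a b where n_eq: "n = (t, a, b)" by (metis prod_cases3)
  have t: "0 < t" "ereal t < R" "a \<in> SU2" "b \<in> SU2" using n by (auto simp: n_eq cyl_def)
  obtain \<tau> u w where u: "u \<in> su2" "w \<in> su2" "v = (\<tau>, a \<odot> u, b \<odot> w)"
    by (rule tangent_cylE[OF v[unfolded n_eq] t(3,4)])
  have "(1 / 2) *\<^sub>R (u + w) = (\<Sum>i\<in>UNIV. eta_p i n v *\<^sub>R T_su2 i)"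
    "(1 / 2) *\<^sub>R (u - w) = (\<Sum>i\<in>UNIV. eta_m i n v *\<^sub>R T_su2 i)"
    unfolding u(3) n_eq eta_left_invariant[OF t(3,4)] sum_T_su2
    using u(1,2) by (simp_all add: prod_eq_iff vec_eq_iff su2_def)
  moreover have "A (emb n) (emb_diff n v) = A (t *\<^sub>R qone, qone) (\<tau> *\<^sub>R qone + t *\<^sub>R u, u - w)"
    unfolding n_eq u(3) using left_invariant_emb[OF inv n[unfolded n_eq] u(1,2)] .
  ultimately show "A (emb n) (emb_diff n v) = ansatz x y n v"
    using A[of t u w \<tau>] I t u by (simp add: n_eq ansatz_def)
qed


section \<open>Clarke's instantons\<close>

definition qim :: "quat \<Rightarrow> quat"
  where "qim x = (1 / 2) *\<^sub>R (x - qcnj x)"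

lemma qim_su2: "qim x \<in> su2" and qim_id: "u \<in> su2 \<Longrightarrow> qim u = u"
  by (simp_all add: qim_def su2_iff_qcnj qcnj_linear scaleR_2[symmetric] scaleR_diff_right)

lemma qim_conj: "qim (a \<odot> x \<odot> qcnj a) = a \<odot> qim x \<odot> qcnj a"
  by (simp add: qim_def qcnj_qmul qmul_assoc qmul.diff_left qmul.diff_right qmul.scaleR_left qmul.scaleR_right)

lemma bounded_linear_qim: "bounded_linear qim"
  unfolding qim_def
  by (intro bounded_linear_compose[OF bounded_linear_scaleR_right] bounded_linear_sub bounded_linear_ident
      bounded_linear_qcnj)

text \<open>At t = |p| > 0 this is \<phi>(t) / t^2 for Clarke's \<phi> = A x. Since A = t r k / 3,
  the division can be carried out, and the result is smooth at p = 0.\<close>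

definition clarke_coef :: "real \<Rightarrow> quat \<Rightarrow> real"
  where "clarke_coef x1 p = 2 * x1 * (bs_r (norm p) * bs_k (norm p) / 3)\<^sup>2
    * inverse (1 + x1 * (bs_r (norm p) ^ 2 / 3 - 1 / 3))"

text \<open>
  In the coordinates \<open>(p, q) = (t a, a b\<^sup>-\<^sup>1)\<close> one has \<open>p\<^sup>* dp = t dt + t\<^sup>2 a\<^sup>-\<^sup>1 da\<close> and
  \<open>p\<^sup>* dq q\<^sup>* p = t\<^sup>2 (a\<^sup>-\<^sup>1 da - b\<^sup>-\<^sup>1 db)\<close>, so the form below is a multiple of
  \<open>a\<^sup>-\<^sup>1 da + b\<^sup>-\<^sup>1 db\<close>.
\<close>

definition clarke_conn :: "real \<Rightarrow> quat \<times> quat \<Rightarrow> quat \<times> quat \<Rightarrow> quat"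
  where "clarke_conn x1 m v = clarke_coef x1 (fst m) *\<^sub>R
    qim (qcnj (fst m) \<odot> fst v - (1 / 2) *\<^sub>R (qcnj (fst m) \<odot> snd v \<odot> (qcnj (snd m) \<odot> fst m)))"

lemma clarke_denom_eq: "clarke_denom x1 t = 1 + x1 * (bs_r t ^ 2 / 3 - 1 / 3)"
  by (simp add: clarke_denom_def bs_B_sq)

lemma Ck_on_Pair:
  assumes "open S" "Ck_on k S f" "Ck_on k S g"
  shows "Ck_on k S (\<lambda>x. (f x, g x))"
proof -
  have "Ck_on k S (\<lambda>x. (f x, 0) + (0, g x))"
    by (intro Ck_on_add Ck_on_linear_compose[OF assms(1) _ assms(2), of "\<lambda>x. (x, 0)"]
        Ck_on_linear_compose[OF assms(1) _ assms(3), of "\<lambda>x. (0, x)"] assms(1)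
        bounded_linear_Pair bounded_linear_ident bounded_linear_zero)
  then show ?thesis by simp
qed

lemma clarke_connection:
  assumes "\<And>t. 0 \<le> t \<Longrightarrow> ereal t < R \<Longrightarrow> clarke_denom x1 t \<noteq> 0"
  shows "connection_on R (clarke_conn x1)"
  unfolding connection_on_def one_form_on_def
proof (intro conjI ballI allI)
  fix m
  have "bounded_linear (clarke_conn x1 m)"
    unfolding clarke_conn_def
    by (intro bounded_linear_compose[OF bounded_linear_scaleR_right] bounded_linear_compose[OF bounded_linear_qim]
        bounded_linear_sub bounded_linear_compose[OF qmul.bounded_linear_right]
        bounded_linear_compose[OF qmul.bounded_linear_left] bounded_linear_fst bounded_linear_snd)
  then show "linear (clarke_conn x1 m)"
    by (rule bounded_linear.linear)
  show "range (clarke_conn x1 m) \<subseteq> su2"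
    unfolding clarke_conn_def by (intro image_subsetI subspace_scale[OF subspace_su2] qim_su2)
next
  fix v :: "quat \<times> quat"
  let ?U = "{m::quat \<times> quat. ereal (norm (fst m)) < R}"
  have U: "open ?U"
    using open_vimage_fst[OF open_norm_less[of R]] by (simp add: vimage_def)
  have fs: "Ck_on k ?U fst" "Ck_on k ?U snd" for k
    using U by (simp_all add: Ck_on_bounded_linear bounded_linear_fst bounded_linear_snd)
  have r: "Ck_on k ?U (\<lambda>m. bs_r (norm (fst m)))" "Ck_on k ?U (\<lambda>m. bs_k (norm (fst m)))" for k
    by (rule Ck_on_compose[OF U open_UNIV _ fs(1) bs_r_norm_Ck], simp,
        rule Ck_on_compose[OF U open_UNIV _ fs(1) bs_k_norm_Ck], simp)
  have d: "1 + x1 * (bs_r (norm (fst m)) ^ 2 / 3 - 1 / 3) \<noteq> 0" if "m \<in> ?U" for m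
    using assms[of "norm (fst m)"] that by (simp add: clarke_denom_eq)
  have "Ck_on k ?U (\<lambda>m. clarke_conn x1 m v)" for k
    unfolding clarke_conn_def clarke_coef_def divide_inverse
    by (intro Ck_on_scaleR Ck_on_mult Ck_on_power Ck_on_inverse Ck_on_add Ck_on_diff Ck_on_const U r fs
        Ck_on_linear_compose[OF U bounded_linear_qim] Ck_on_bilinear[OF U bounded_bilinear_qmul]
        Ck_on_linear_compose[OF U bounded_linear_qcnj] d[unfolded divide_inverse])
  then show "smooth_map_on (tube R) (\<lambda>m. clarke_conn x1 m v)"
    by (rule smooth_map_onI[OF U, rotated]) (auto simp: tube_def)
qed

lemma norm_SU2: "a \<in> SU2 \<Longrightarrow> norm a = 1"
  by (simp add: SU2_def)

text \<open>In p^-* combinations of this kind the factors h1 and h2 cancel, leaving conjugation by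
  h3, which commutes with taking imaginary parts.\<close>

lemma clarke_conn_equivariant:
  assumes "h1 \<in> SU2" "h2 \<in> SU2" "h3 \<in> SU2"
  shows "clarke_conn x1 (act (h1, h2, h3) m) (act (h1, h2, h3) v) = h3 \<odot> clarke_conn x1 m v \<odot> qcnj h3"
proof -
  obtain p q where m: "m = (p, q)" by (rule prod.exhaust)
  obtain p' q' where v: "v = (p', q')" by (rule prod.exhaust)
  have "qcnj (h1 \<odot> p \<odot> qcnj h3) \<odot> (h1 \<odot> p' \<odot> qcnj h3)
      - (1 / 2) *\<^sub>R (qcnj (h1 \<odot> p \<odot> qcnj h3) \<odot> (h1 \<odot> q' \<odot> qcnj h2) \<odot> (qcnj (h1 \<odot> q \<odot> qcnj h2) \<odot> (h1 \<odot> p \<odot> qcnj h3)))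
     = h3 \<odot> (qcnj p \<odot> p' - (1 / 2) *\<^sub>R (qcnj p \<odot> q' \<odot> (qcnj q \<odot> p))) \<odot> qcnj h3"
    using assms by (simp add: qcnj_qmul qmul_assoc qmul.diff_left qmul.diff_right qmul.scaleR_left qmul.scaleR_right)
  moreover have "norm (h1 \<odot> p \<odot> qcnj h3) = norm p"
    using assms by (simp add: norm_qmul norm_SU2)
  ultimately show ?thesis
    by (simp add: clarke_conn_def clarke_coef_def m v act_def qim_conj qmul.scaleR_left qmul.scaleR_right)
qed

text \<open>Left multiplication by h3 on the fibre compensates the conjugation of the 1-form by h3;
  for h3 = 1 it is the prescribed action on P_1.\<close>

definition clarke_lift :: "quat \<times> quat \<times> quat \<Rightarrow> (quat \<times> quat) \<times> quat \<Rightarrow> (quat \<times> quat) \<times> quat"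
  where "clarke_lift h z = (act h (fst z), snd (snd h) \<odot> snd z)"

lemma clarke_lift: "lift_on R clarke_lift"
  unfolding lift_on_def
proof (intro conjI ballI)
  have fs: "Ck_on k UNIV fst" "Ck_on k UNIV snd" for k
    by (simp_all add: Ck_on_bounded_linear bounded_linear_fst bounded_linear_snd)
  have "(\<lambda>(h, z). clarke_lift h z) = (\<lambda>x. ((fst (fst x) \<odot> fst (fst (snd x)) \<odot> qcnj (snd (snd (fst x))),
      fst (fst x) \<odot> snd (fst (snd x)) \<odot> qcnj (fst (snd (fst x)))), snd (snd (fst x)) \<odot> snd (snd x)))"
    by (auto simp: clarke_lift_def act_def fun_eq_iff)
  moreover have "Ck_on k UNIV (\<lambda>x. ((fst (fst x) \<odot> fst (fst (snd x)) \<odot> qcnj (snd (snd (fst x))),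
      fst (fst x) \<odot> snd (fst (snd x)) \<odot> qcnj (fst (snd (fst x)))), snd (snd (fst x)) \<odot> snd (snd x)))" for k
    by (intro Ck_on_Pair open_UNIV Ck_on_bilinear[OF open_UNIV bounded_bilinear_qmul]
        Ck_on_linear_compose[OF open_UNIV bounded_linear_qcnj] Ck_on_linear_compose[OF open_UNIV bounded_linear_fst]
        Ck_on_linear_compose[OF open_UNIV bounded_linear_snd] fs)
  ultimately show "smooth_map_on (SU2_3 \<times> P1 R) (\<lambda>(h, z). clarke_lift h z)"
    by (intro smooth_map_onI[OF open_UNIV]) auto
next
  fix h z assume h: "h \<in> SU2_3" and z: "z \<in> P1 R"
  then show "clarke_lift h z \<in> P1 R" "fst (clarke_lift h z) = act h (fst z)"
    using act_tube[OF h, of "fst z"] by (auto simp: clarke_lift_def P1_def SU2_3_def)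
next
  fix h k z
  show "clarke_lift (mul3 h k) z = clarke_lift h (clarke_lift k z)"
    by (cases h rule: prod_cases3; cases k rule: prod_cases3)
      (simp add: clarke_lift_def mul3_def act_def qcnj_qmul qmul_assoc split_beta)
qed (auto simp: clarke_lift_def act_def P1_act2_def qmul_assoc)

lemma clarke_invariant: "SU2_3_invariant R (clarke_conn x1)"
  unfolding SU2_3_invariant_def
proof (intro exI[of _ clarke_lift] conjI ballI clarke_lift)
  fix h assume h: "h \<in> SU2_3"
  obtain h1 h2 h3 where h_eq: "h = (h1, h2, h3)" by (metis prod_cases3)
  have SU: "h1 \<in> SU2" "h2 \<in> SU2" "h3 \<in> SU2" using h by (auto simp: h_eq SU2_3_def)
  have lin: "bounded_linear (clarke_lift h)"
    unfolding clarke_lift_def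
    by (intro bounded_linear_Pair bounded_linear_compose[OF bounded_linear_act]
        bounded_linear_compose[OF qmul.bounded_linear_right] bounded_linear_fst bounded_linear_snd)
  show "pulls_back R (clarke_lift h) (clarke_conn x1) (clarke_conn x1)"
    unfolding pulls_back_def
  proof (intro ballI)
    fix z w assume z: "z \<in> P1 R" and w: "w \<in> tangent_space (P1 R) z"
    have "differential_on (P1 R) (clarke_lift h) z w = clarke_lift h w"
      by (rule differential_on_eq[OF bounded_linear_imp_has_derivative[OF lin] z w])
    then show "conn_form (clarke_conn x1) (clarke_lift h z) (differential_on (P1 R) (clarke_lift h) z w)
        = conn_form (clarke_conn x1) z w"
      using SU by (simp add: clarke_lift_def conn_form_def split_beta h_eq clarke_conn_equivariant qcnj_qmul qmul_assoc)
  qed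
qed

lemma clarke_conn_radial:
  assumes "0 < s" "u \<in> su2" "w \<in> su2"
  shows "clarke_conn x1 (s *\<^sub>R qone, qone) (\<tau> *\<^sub>R qone + s *\<^sub>R u, u - w)
    = (bs_A s * clarke_x x1 s) *\<^sub>R ((1 / 2) *\<^sub>R (u + w))"
proof -
  have "qcnj (s *\<^sub>R qone) \<odot> (\<tau> *\<^sub>R qone + s *\<^sub>R u)
      - (1 / 2) *\<^sub>R (qcnj (s *\<^sub>R qone) \<odot> (u - w) \<odot> (qcnj qone \<odot> s *\<^sub>R qone))
      = (s * \<tau>) *\<^sub>R qone + s\<^sup>2 *\<^sub>R ((1 / 2) *\<^sub>R (u + w))"
  proof -
    have "x - (1 / 2) *\<^sub>R (x - y) = (1 / 2) *\<^sub>R (x + y)" for x y :: quat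
      using scaleR_half_double[of x] by (simp add: scaleR_diff_right scaleR_add_right algebra_simps)
    from this[of "s\<^sup>2 *\<^sub>R u" "s\<^sup>2 *\<^sub>R w"] show ?thesis
      by (simp add: qcnj_linear qmul.scaleR_left qmul.scaleR_right scaleR_add_right scaleR_diff_right
          power2_eq_square add_diff_eq[symmetric])
  qed
  moreover have "qim (r *\<^sub>R qone + x) = qim x" for r x
    by (simp add: qim_def qcnj_linear)
  moreover have "s\<^sup>2 *\<^sub>R ((1 / 2) *\<^sub>R (u + w)) \<in> su2"
    using assms by (simp add: su2_def)
  ultimately have "clarke_conn x1 (s *\<^sub>R qone, qone) (\<tau> *\<^sub>R qone + s *\<^sub>R u, u - w)
      = clarke_coef x1 (s *\<^sub>R qone) *\<^sub>R (s\<^sup>2 *\<^sub>R ((1 / 2) *\<^sub>R (u + w)))"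
    by (simp only: clarke_conn_def fst_conv snd_conv qim_id)
  also have "\<dots> = (clarke_coef x1 (s *\<^sub>R qone) * s\<^sup>2) *\<^sub>R ((1 / 2) *\<^sub>R (u + w))"
    by simp
  also have "clarke_coef x1 (s *\<^sub>R qone) * s\<^sup>2 = bs_A s * clarke_x x1 s"
    using assms by (simp add: clarke_coef_def clarke_x_def clarke_denom_eq bs_A_eq bs_v_eq power2_eq_square inverse_eq_divide)
  finally show ?thesis .
qed

text \<open>Here \<phi> = 2 x_1 A^2 / D, and (B^2)' = 2 A gives D' = 2 x_1 A for the denominator
  D.\<close>

lemma clarke_x_ode:
  assumes "0 < s" "clarke_denom x1 s \<noteq> 0"
  shows "((\<lambda>s. bs_A s * clarke_x x1 s) has_real_derivative instanton_rhs s (bs_A s * clarke_x x1 s) 0) (at s)"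
proof -
  let ?D = "clarke_denom x1 s" and ?A = "bs_A s" and ?B = "bs_B s"
  have ne: "?A \<noteq> 0" "?B \<noteq> 0" using bs_A_pos[OF assms(1)] bs_B_pos[OF assms(1)] by auto
  have D: "(clarke_denom x1 has_real_derivative x1 * (2 * ?A)) (at s)"
    unfolding clarke_denom_def[abs_def]
    by (rule DERIV_cong[OF DERIV_add[OF DERIV_const
            DERIV_cmult[OF DERIV_diff[OF bs_B_sq_deriv[OF assms(1)] DERIV_const]]]]) simp
  have "((\<lambda>s. 2 * x1 * bs_A s ^ 2 / clarke_denom x1 s) has_real_derivative
      (2 * x1 * (2 * ?A * ((1 - ?A ^ 2 / ?B ^ 2) / 2)) * ?D - 2 * x1 * ?A ^ 2 * (x1 * (2 * ?A))) / (?D * ?D)) (at s)"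
    using bs_A_deriv[OF assms(1)] assms(2)
    by (auto intro!: derivative_eq_intros D)
  moreover have "(2 * x1 * (2 * ?A * ((1 - ?A ^ 2 / ?B ^ 2) / 2)) * ?D - 2 * x1 * ?A ^ 2 * (x1 * (2 * ?A))) / (?D * ?D)
      = instanton_rhs s (2 * x1 * ?A ^ 2 / ?D) 0"
    using ne assms(2) by (simp add: instanton_rhs_def field_simps power2_eq_square)
  moreover have "(\<lambda>s. bs_A s * clarke_x x1 s) = (\<lambda>s. 2 * x1 * bs_A s ^ 2 / clarke_denom x1 s)"
    by (simp add: fun_eq_iff clarke_x_def power2_eq_square)
  ultimately show ?thesis
    by (simp add: fun_eq_iff)
qed

lemma clarke_defined_onI:
  assumes "\<And>t. 0 \<le> t \<Longrightarrow> ereal t < R \<Longrightarrow> clarke_denom x1 t \<noteq> 0"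
  shows "clarke_defined_on R x1"
  unfolding clarke_defined_on_def
proof (intro exI[of _ "clarke_conn x1"] conjI)
  show conn: "connection_on R (clarke_conn x1)"
    by (rule clarke_connection) (rule assms)
  show "SU2_3_invariant R (clarke_conn x1)"
    by (rule clarke_invariant)
  then have inv: "left_invariant_on R (clarke_conn x1)"
    by (rule SU2_3_invariant_left_invariant)
  show "G2_instanton R (clarke_conn x1)"
    by (rule ansatz_G2_instanton[OF conn inv clarke_conn_radial clarke_x_ode]) (use assms in auto)
  show "restricts_to R (clarke_interval x1) (clarke_conn x1) (clarke x1)"
    unfolding clarke_def
    by (rule restricts_to_ansatz[OF inv]) (simp add: clarke_conn_radial)
qed

section \<open>Zeros of the denominator and the domain of definition\<close>

lemma clarke_denom_pos:
  assumes "0 \<le> x1" "0 \<le> t"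
  shows "0 < clarke_denom x1 t"
proof -
  have "1 \<le> bs_r t ^ 2"
    using bs_r(1)[OF assms(2)] by (simp add: one_le_power)
  then show ?thesis
    using assms by (simp add: clarke_denom_eq add_pos_nonneg)
qed

text \<open>The zero of the denominator: \<open>r\<^sup>2 = 1 - 3 / x\<^sub>1\<close>.\<close>

definition clarke_t0 :: "real \<Rightarrow> real"
  where "clarke_t0 x1 = bs_t (sqrt (1 - 3 / x1))"

lemma clarke_t0:
  assumes "x1 < 0"
  shows "0 < clarke_t0 x1" "clarke_denom x1 (clarke_t0 x1) = 0"
    "\<And>t. 0 \<le> t \<Longrightarrow> t < clarke_t0 x1 \<Longrightarrow> 0 < clarke_denom x1 t"
proof -
  have gt: "1 < 1 - 3 / x1" using assms by (simp add: divide_less_0_iff)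
  then have sq: "1 < sqrt (1 - 3 / x1)" by simp
  show "0 < clarke_t0 x1"
    using bs_t_strict_mono[of 1, OF _ sq] by (simp add: clarke_t0_def)
  have "bs_r (clarke_t0 x1) = sqrt (1 - 3 / x1)"
    using sq by (simp add: clarke_t0_def bs_r_bs_t)
  then have r0: "bs_r (clarke_t0 x1) ^ 2 = 1 - 3 / x1"
    using gt by simp
  then show "clarke_denom x1 (clarke_t0 x1) = 0"
    using assms by (simp add: clarke_denom_eq field_simps)
  fix t assume t: "0 \<le> t" "t < clarke_t0 x1"
  have "bs_r t < sqrt (1 - 3 / x1)"
  proof (rule ccontr)
    assume "\<not> ?thesis"
    then have "clarke_t0 x1 \<le> t"
      using bs_t_strict_mono[of "sqrt (1 - 3 / x1)" "bs_r t"] sq bs_r(2)[OF t(1)]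
      by (cases "bs_r t = sqrt (1 - 3 / x1)") (auto simp: clarke_t0_def)
    then show False using t by simp
  qed
  then have "bs_r t ^ 2 < sqrt (1 - 3 / x1) ^ 2"
    using bs_r(1)[OF t(1)] by (intro power_strict_mono) auto
  then have "bs_r t ^ 2 < 1 - 3 / x1"
    using gt by simp
  then have "x1 * (1 - 3 / x1) < x1 * bs_r t ^ 2"
    using assms by (rule mult_strict_left_mono_neg)
  moreover have "x1 * (1 - 3 / x1) = x1 - 3"
    using assms by (simp add: right_diff_distrib)
  ultimately show "0 < clarke_denom x1 t"
    by (simp add: clarke_denom_eq right_diff_distrib)
qed

lemma clarke_interval_neg:
  assumes "x1 < 0"
  shows "clarke_interval x1 = {0<..<clarke_t0 x1}"
proof -
  have "clarke_denom x1 s \<noteq> 0" if "0 < s" "s < clarke_t0 x1" for s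
    using clarke_t0(3)[OF assms, of s] that by simp
  moreover have "t < clarke_t0 x1" if "0 < t" "\<forall>s. 0 < s \<and> s \<le> t \<longrightarrow> clarke_denom x1 s \<noteq> 0" for t
    using that clarke_t0(1,2)[OF assms] by (meson not_le)
  ultimately show ?thesis
    by (auto simp: clarke_interval_def)
qed

lemma connection_linear: "connection_on R A \<Longrightarrow> m \<in> tube R \<Longrightarrow> linear (A m)"
  unfolding connection_on_def one_form_on_def by blast

lemma radial_ray_continuous:
  assumes "connection_on R A"
  shows "continuous_on {s. 0 \<le> s \<and> ereal s < R} (\<lambda>s. A (s *\<^sub>R qone, qone) v)"
proof -
  have "continuous_on (tube R) (\<lambda>m. A m v)"
    using assms unfolding connection_on_def one_form_on_def by (blast intro: smooth_map_on_continuous)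
  then show ?thesis
    by (rule continuous_on_compose2) (auto intro!: continuous_intros simp: tube_def)
qed

text \<open>On the vector (T_1, T_1), whose image is t (T_1, 0), Clarke's formula reads t h D = 2
  x_1 A^2, with h a component of the connection. For a global connection both sides are continuous
  at the first zero of D, where the left side vanishes and the right side does not.\<close>

lemma clarke_not_global:
  assumes "x1 < 0"
  shows "\<not> clarke_defined_on \<infinity> x1"
proof
  assume "clarke_defined_on \<infinity> x1"
  then obtain A where conn: "connection_on \<infinity> A"
    and res: "restricts_to \<infinity> (clarke_interval x1) A (clarke x1)"
    and "SU2_3_invariant \<infinity> A"
    unfolding clarke_defined_on_def by blast
  let ?t0 = "clarke_t0 x1" and ?T = "T_su2 1"
  let ?h = "\<lambda>t. snd (A (t *\<^sub>R qone, qone) (?T, 0)) $ 1"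
  have eq: "(t * ?h t) * clarke_denom x1 t = 2 * x1 * bs_A t ^ 2" if "0 < t" "t < ?t0" for t
  proof -
    let ?n = "(t, qone, qone)"
    have n: "?n \<in> cyl \<infinity>" using that by (simp add: cyl_def)
    have T: "?T \<in> su2" by (simp add: T_su2_def su2_def)
    have v: "(0, ?T, ?T) \<in> tangent_space (cyl \<infinity>) ?n"
      using cyl_tangent[OF n T T, of 0] by simp
    have "fst ?n \<in> clarke_interval x1"
      using that by (simp add: clarke_interval_neg[OF assms])
    then have "A (emb ?n) (emb_diff ?n (0, ?T, ?T)) = clarke x1 ?n (0, ?T, ?T)"
      using res n v unfolding restricts_to_def by blast
    moreover have "emb_diff ?n (0, ?T, ?T) = t *\<^sub>R (?T, 0)"
      using emb_diff_left_invariant[OF T, of t qone qone 0 ?T] by (simp add: zero_prod_def)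
    moreover have "linear (A (t *\<^sub>R qone, qone))"
      by (rule connection_linear[OF conn]) (simp add: tube_def)
    ultimately have "t *\<^sub>R A (t *\<^sub>R qone, qone) (?T, 0) = clarke x1 ?n (0, ?T, ?T)"
      by (simp add: emb_def linear_scale del: scaleR_Pair)
    then have "t * ?h t = snd (clarke x1 ?n (0, ?T, ?T)) $ 1"
      by (metis snd_scaleR vector_scaleR_component real_scaleR_def)
    also have "\<dots> = bs_A t * clarke_x x1 t"
      using eta_dual[of qone qone] by (simp add: clarke_def ansatz_def sum_T_su2)
    finally show ?thesis
      using clarke_t0(3)[OF assms, of t] that by (simp add: clarke_x_def power2_eq_square)
  qed
  have t0: "0 < ?t0" by (rule clarke_t0(1)[OF assms])
  have "continuous_on {0..} (\<lambda>t. A (t *\<^sub>R qone, qone) (?T, 0))"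
    using radial_ray_continuous[OF conn] by (simp add: atLeast_def)
  then have h: "continuous_on {0..} (\<lambda>t. (t * ?h t) * clarke_denom x1 t)"
    unfolding clarke_denom_eq by (intro continuous_intros bs_r_continuous) auto
  have A2: "continuous_on {0..} (\<lambda>t. 2 * x1 * bs_A t ^ 2)"
    unfolding bs_A_eq by (intro continuous_intros bs_r_continuous bs_v_continuous) auto
  have lim: "(f \<longlongrightarrow> f ?t0) (at_left ?t0)" if "continuous_on {0..} f" for f :: "real \<Rightarrow> real"
    using that t0 continuous_on_interior[of "{0..}" f ?t0]
    by (simp add: isCont_def filterlim_at_split)
  have "\<forall>\<^sub>F t in at_left ?t0. (t * ?h t) * clarke_denom x1 t = 2 * x1 * bs_A t ^ 2"
    using eventually_at_left_real[OF t0] by (rule eventually_mono) (use eq in auto)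
  then have "((\<lambda>t. 2 * x1 * bs_A t ^ 2) \<longlongrightarrow> ?t0 * ?h ?t0 * clarke_denom x1 ?t0) (at_left ?t0)"
    by (rule Lim_transform_eventually[OF lim[OF h]])
  from tendsto_unique[OF trivial_limit_at_left_real this lim[OF A2]]
  have "?t0 * ?h ?t0 * clarke_denom x1 ?t0 = 2 * x1 * bs_A ?t0 ^ 2" .
  then show False
    using clarke_t0(2)[OF assms] bs_A_pos[OF t0] assms by simp
qed

section \<open>Connections vanishing off the singular orbit\<close>

lemma fst_qmul_qcnj: "fst (x \<odot> qcnj y) = x \<bullet> y"
  by (simp add: qmul_def qcnj_def inner_prod_def)

text \<open>Polar coordinates: t = |p|, a = p / t and b = q^-1 a. The real part of a^-1 v is the
  velocity of t and its imaginary part is t u; the last component is then forced by w.\<close>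

lemma tube_emb:
  assumes "(p, q) \<in> tube R" "p \<noteq> 0" "q \<bullet> w = 0"
  obtains n v' where "n \<in> cyl R" "emb n = (p, q)" "v' \<in> tangent_space (cyl R) n" "emb_diff n v' = (v, w)"
proof -
  define t where "t = norm p"
  define a where "a = (1 / t) *\<^sub>R p"
  define b where "b = qcnj q \<odot> a"
  have t: "0 < t" "ereal t < R" and q: "q \<in> SU2"
    using assms by (auto simp: t_def tube_def SU2_def)
  have a: "a \<in> SU2" using t by (simp add: a_def SU2_def t_def)
  have b: "b \<in> SU2" using a q by (simp add: b_def)
  have n: "(t, a, b) \<in> cyl R" using t a b by (simp add: cyl_def)
  have pq: "emb (t, a, b) = (p, q)"
    using t a by (simp add: emb_def b_def qcnj_qmul a_def[symmetric]) (simp add: a_def)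
  define X where "X = qcnj a \<odot> v"
  define u :: quat where "u = (0, (1 / t) *\<^sub>R snd X)"
  have u: "u \<in> su2" by (simp add: u_def su2_def)
  have X: "fst X *\<^sub>R qone + t *\<^sub>R u = X"
    using t by (simp add: u_def qone_def prod_eq_iff)
  have "w \<odot> qcnj q \<in> su2"
    using assms(3) by (simp add: su2_def fst_qmul_qcnj inner_commute)
  then have "qcnj a \<odot> (w \<odot> qcnj q) \<odot> qcnj (qcnj a) \<in> su2"
    by (rule su2_conj)
  then have Y: "u - qcnj a \<odot> w \<odot> b \<in> su2"
    using u by (simp add: b_def qmul_assoc su2_def)
  have "emb_diff (t, a, b) (fst X, a \<odot> u, b \<odot> (u - qcnj a \<odot> w \<odot> b)) = (v, w)"
    unfolding emb_diff_left_invariant[OF Y] using a b by (simp add: X qmul_assoc) (simp add: X_def a)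
  then show thesis
    by (rule that[OF n pq cyl_tangent[OF n u Y]])
qed

text \<open>Points of the singular orbit are limits of points (s, q) with s nonzero. The tangency
  condition involves q only, so the same vector stays admissible along this approach, and continuity
  applies.\<close>

lemma vanishing_connection:
  assumes conn: "connection_on R A"
    and off: "\<And>n v. n \<in> cyl R \<Longrightarrow> v \<in> tangent_space (cyl R) n \<Longrightarrow> A (emb n) (emb_diff n v) = 0"
    and m: "m \<in> tube R" and v: "v \<in> tangent_space (tube R) m"
  shows "A m v = 0"
proof -
  obtain p q where mpq: "m = (p, q)" by (rule prod.exhaust)
  obtain x w where vxw: "v = (x, w)" by (rule prod.exhaust)
  have qw: "q \<bullet> w = 0" using v m by (simp add: mpq vxw tangent_tube)
  have ne: "A (p, q) (x, w) = 0" if "(p, q) \<in> tube R" "p \<noteq> 0" for p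
    by (rule tube_emb[OF that qw, of x]) (use off in metis)
  show ?thesis
  proof (cases "p = 0")
    case False
    with ne m show ?thesis by (simp add: mpq vxw)
  next
    case True
    have R: "0 < R" "norm q = 1" using m by (auto simp: mpq True tube_def zero_ereal_def)
    let ?\<gamma> = "\<lambda>s::real. (s *\<^sub>R qone, q)"
    have c: "continuous_on (tube R) (\<lambda>m. A m v)"
      using conn unfolding connection_on_def one_form_on_def by (blast intro: smooth_map_on_continuous)
    have "continuous_on {s. ereal \<bar>s\<bar> < R} (\<lambda>s. A (?\<gamma> s) v)"
      by (rule continuous_on_compose2[OF c]) (intro continuous_intros, simp add: image_subset_iff tube_def R)
    moreover have "open {s::real. ereal \<bar>s\<bar> < R}"
      using open_norm_less[of R, where 'a = real] by simp
    ultimately have "isCont (\<lambda>s. A (?\<gamma> s) v) 0"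
      using R by (simp add: continuous_on_eq_continuous_at zero_ereal_def)
    then have "((\<lambda>s. A (?\<gamma> s) v) \<longlongrightarrow> A m v) (at 0)"
      by (simp add: isCont_def mpq True)
    moreover have "\<forall>\<^sub>F s in at (0::real). A (?\<gamma> s) v = 0"
    proof -
      have "\<forall>\<^sub>F s in at (0::real). ereal (norm s) < R"
        using R by (intro eventually_norm_less) (auto simp: zero_ereal_def)
      moreover have "\<forall>\<^sub>F s in at (0::real). s \<noteq> 0"
        by (simp add: eventually_at_filter)
      ultimately show ?thesis
        by eventually_elim (simp add: vxw ne tube_def R, rule ne, simp_all add: tube_def R qone_def zero_prod_def)
    qed
    then have "((\<lambda>s. A (?\<gamma> s) v) \<longlongrightarrow> 0) (at 0)"
      by (rule tendsto_eventually)
    ultimately show ?thesis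
      using tendsto_unique[of "at (0::real)"] by auto
  qed
qed

text \<open>The form is known to vanish on tangent vectors only, so the constant extensions in
  \<open>ext_deriv\<close> are of no use here; the vectors have to be extended tangentially.\<close>

lemma vanishing_curvature:
  assumes conn: "connection_on R A"
    and zero: "\<And>m v. m \<in> tube R \<Longrightarrow> v \<in> tangent_space (tube R) m \<Longrightarrow> A m v = 0"
    and m: "m \<in> tube R" and v: "v \<in> tangent_space (tube R) m" and w: "w \<in> tangent_space (tube R) m"
  shows "curvature R A m v w = 0"
proof -
  obtain p q where mpq: "m = (p, q)" by (rule prod.exhaust)
  have *: "\<exists>\<gamma> V. \<gamma> 0 = m \<and> (\<forall>\<^sub>F s in at (0::real). \<gamma> s \<in> tube R) \<and> (\<gamma> has_vector_derivative v) (at 0)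
      \<and> V 0 = w \<and> (V has_vector_derivative (0, - ((snd v \<bullet> snd w) *\<^sub>R q))) (at 0)
      \<and> ((\<lambda>s. A (\<gamma> s) (V s)) has_vector_derivative 0) (at 0)"
    if v: "v \<in> tangent_space (tube R) m" and w: "w \<in> tangent_space (tube R) m" for v w
  proof -
    obtain \<gamma> where \<gamma>: "\<gamma> 0 = m" "\<forall>\<^sub>F s in at (0::real). \<gamma> s \<in> tube R" "(\<gamma> has_vector_derivative v) (at 0)"
      using v unfolding tangent_space_def by auto
    let ?q = "\<lambda>s. snd (\<gamma> s)"
    \<comment> \<open>The second component is projected onto the tangent space of the sphere at the
      moving point.\<close>
    let ?V = "\<lambda>s. (fst w, snd w - (snd w \<bullet> ?q s) *\<^sub>R ?q s)"
    have qw: "snd w \<bullet> q = 0"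
      using w m by (cases w) (simp add: mpq tangent_tube inner_commute)
    have dq: "(?q has_vector_derivative snd v) (at 0)"
      by (rule bounded_linear.has_vector_derivative[OF bounded_linear_snd \<gamma>(3)])
    have "((\<lambda>s. snd w \<bullet> ?q s) has_real_derivative snd w \<bullet> snd v) (at 0)"
      unfolding has_real_derivative_iff_has_vector_derivative
      by (rule bounded_linear.has_vector_derivative[OF bounded_linear_inner_right dq])
    from has_vector_derivative_scaleR[OF this dq]
    have "((\<lambda>s. (snd w \<bullet> ?q s) *\<^sub>R ?q s) has_vector_derivative (snd v \<bullet> snd w) *\<^sub>R q) (at 0)"
      using \<gamma>(1) qw by (simp add: mpq inner_commute)
    from has_vector_derivative_Pair[OF has_vector_derivative_const
        has_vector_derivative_diff[OF has_vector_derivative_const this], of "fst w" "snd w"]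
    have V: "(?V has_vector_derivative (0, - ((snd v \<bullet> snd w) *\<^sub>R q))) (at 0)"
      by simp
    have V0: "?V 0 = w" using \<gamma>(1) qw by (simp add: mpq)
    have z: "A (\<gamma> s) (?V s) = 0" if "\<gamma> s \<in> tube R" for s
    proof (rule zero[OF that])
      have "?q s \<bullet> ?q s = 1" using that by (auto simp: tube_def dot_square_norm)
      then show "?V s \<in> tangent_space (tube R) (\<gamma> s)"
        using that tangent_tube[of "fst (\<gamma> s)" "snd (\<gamma> s)" R] by (simp add: inner_diff_right inner_commute)
    qed
    then have "\<forall>\<^sub>F s in at 0. 0 = A (\<gamma> s) (?V s)"
      using \<gamma>(2) by (auto elim: eventually_mono)
    then have "((\<lambda>s. A (\<gamma> s) (?V s)) has_derivative (\<lambda>x. x *\<^sub>R 0)) (at 0)"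
      by (rule has_derivative_transform_eventually[of "\<lambda>s. 0" "\<lambda>x. x *\<^sub>R 0" 0 UNIV, rotated])
        (use z[of 0] m \<gamma>(1) in simp_all)
    then have "((\<lambda>s. A (\<gamma> s) (?V s)) has_vector_derivative 0) (at 0)"
      by (simp only: has_vector_derivative_def)
    then show ?thesis
      by (intro exI[of _ \<gamma>] exI[of _ ?V] conjI \<gamma> V V0)
  qed
  obtain \<gamma> V where \<gamma>: "\<gamma> 0 = m" "\<forall>\<^sub>F s in at (0::real). \<gamma> s \<in> tube R" "(\<gamma> has_vector_derivative v) (at 0)"
    "V 0 = w" "(V has_vector_derivative (0, - ((snd v \<bullet> snd w) *\<^sub>R q))) (at 0)"
    "((\<lambda>s. A (\<gamma> s) (V s)) has_vector_derivative 0) (at 0)"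
    using *[OF v w] by (elim exE conjE)
  obtain \<delta> W where \<delta>: "\<delta> 0 = m" "\<forall>\<^sub>F s in at (0::real). \<delta> s \<in> tube R" "(\<delta> has_vector_derivative w) (at 0)"
    "W 0 = v" "(W has_vector_derivative (0, - ((snd w \<bullet> snd v) *\<^sub>R q))) (at 0)"
    "((\<lambda>s. A (\<delta> s) (W s)) has_vector_derivative 0) (at 0)"
    using *[OF w v] by (elim exE conjE)
  \<comment> \<open>The bracket term vanishes because the normal corrections of the two extensions
    agree, by the symmetry of the inner product.\<close>
  have "ext_deriv (tube R) A m v w = 0 - 0 - A m ((0, - ((snd v \<bullet> snd w) *\<^sub>R q)) - (0, - ((snd w \<bullet> snd v) *\<^sub>R q)))"
    by (rule ext_deriv_along_curves[OF conn[unfolded connection_on_def] m \<gamma>(1-5) \<delta>(1-5) \<gamma>(6) \<delta>(6)])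
  then show ?thesis
    using linear_0[OF connection_linear[OF conn m]] zero[OF m v]
    by (simp add: curvature_def inner_commute su2_bracket_def qmul.zero_left qmul.zero_right zero_prod_def[symmetric])
qed


section \<open>Linear ordinary differential equations\<close>

text \<open>The terms of the Dyson series (time-ordered exponential) of b; their sum solves g' = b g
  with g(0) = 1.\<close>

primrec picard :: "(real \<Rightarrow> quat) \<Rightarrow> nat \<Rightarrow> real \<Rightarrow> quat"
  where
    "picard b 0 t = qone"
  | "picard b (Suc n) t = integral {0..t} (\<lambda>s. b s \<odot> picard b n s)"

text \<open>The n-th term is bounded by (M t)^n / n!, where M bounds b, so that the series of
  derivatives converges uniformly and may be summed term by term.\<close>

lemma linear_ode_segment:
  assumes b: "continuous_on {0..T} b" and "0 \<le> T" and t: "t \<in> {0..T}"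
  shows "((\<lambda>t. \<Sum>n. picard b n t) has_vector_derivative b t \<odot> (\<Sum>n. picard b n t)) (at t within {0..T})"
proof -
  have cont: "continuous_on {0..T} (picard b n)" for n
  proof (induction n)
    case 0
    have "picard b 0 = (\<lambda>t. qone)" by auto
    then show ?case by simp
  next
    case (Suc n)
    have "picard b (Suc n) = (\<lambda>t. integral {0..t} (\<lambda>s. b s \<odot> picard b n s))" by auto
    then show ?case
      using b Suc by (auto intro!: indefinite_integral_continuous_1 integrable_continuous_interval
          qmul.continuous_on)
  qed
  then have contb: "continuous_on {0..T} (\<lambda>s. b s \<odot> picard b n s)" for n
    using b by (intro qmul.continuous_on)
  \<comment> \<open>The derivative of the n-th term is b times the preceding one; the constant term
    0 contributes nothing.\<close>
  define d where "d n t = (case n of 0 \<Rightarrow> 0 | Suc k \<Rightarrow> b t \<odot> picard b k t)" for n t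
  have deriv: "(picard b n has_vector_derivative d n t) (at t within {0..T})" if "t \<in> {0..T}" for n t
  proof (cases n)
    case 0
    have "picard b 0 = (\<lambda>t. qone)" by auto
    then show ?thesis by (simp add: 0 d_def)
  next
    case (Suc k)
    have "picard b (Suc k) = (\<lambda>t. integral {0..t} (\<lambda>s. b s \<odot> picard b k s))" by auto
    then show ?thesis
      using integral_has_vector_derivative[OF contb that] by (simp add: Suc d_def)
  qed
  have "bounded (b ` {0..T})"
    using b by (intro compact_imp_bounded compact_continuous_image) auto
  then obtain M where M: "M > 0" "\<And>s. s \<in> {0..T} \<Longrightarrow> norm (b s) \<le> M"
    unfolding bounded_pos by auto
  have bound: "norm (picard b n t) \<le> (M * t) ^ n / fact n" if "t \<in> {0..T}" for n t
    using that
  proof (induction n arbitrary: t)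
    case 0
    then show ?case by simp
  next
    case (Suc n)
    let ?g = "\<lambda>s. M * ((M * s) ^ n / fact n)"
    have int: "(?g has_integral (M * t) ^ Suc n / fact (Suc n) - (M * 0) ^ Suc n / fact (Suc n)) {0..t}"
    proof (rule fundamental_theorem_of_calculus)
      fix s assume "s \<in> {0..t}"
      have "((\<lambda>s. (M * s) ^ Suc n / fact (Suc n)) has_real_derivative
          (real (Suc n) * (M * s) ^ n * M) / fact (Suc n)) (at s within {0..t})"
        by (auto intro!: derivative_eq_intros simp del: fact_Suc power_Suc) 
      moreover have "(real (Suc n) * (M * s) ^ n * M) / fact (Suc n) = ?g s"
        by (simp add: fact_Suc mult.commute[of _ M] mult.left_commute[of _ M] del: of_nat_Suc)
      ultimately show "((\<lambda>s. (M * s) ^ Suc n / fact (Suc n)) has_vector_derivative ?g s) (at s within {0..t})"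
        by (simp only: has_real_derivative_iff_has_vector_derivative)
    qed (use Suc.prems in auto)
    have "norm (picard b (Suc n) t) \<le> integral {0..t} ?g"
      unfolding picard.simps
    proof (rule integral_norm_bound_integral)
      show "(\<lambda>s. b s \<odot> picard b n s) integrable_on {0..t}"
        using Suc.prems by (intro integrable_continuous_interval continuous_on_subset[OF contb]) auto
      show "?g integrable_on {0..t}" using int by blast
      fix s assume s: "s \<in> {0..t}"
      then have sT: "s \<in> {0..T}" using Suc.prems by auto
      show "norm (b s \<odot> picard b n s) \<le> ?g s"
        unfolding norm_qmul using M(1) M(2)[OF sT] Suc.IH[OF sT] by (intro mult_mono) auto
    qed
    also have "\<dots> = (M * t) ^ Suc n / fact (Suc n)"
      using integral_unique[OF int] by simp
    finally show ?case .
  qed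
  let ?m = "\<lambda>n. (M * T) ^ n / fact n"
  have bound': "norm (picard b n t) \<le> ?m n" if "t \<in> {0..T}" for n t
    using bound[OF that, of n] power_mono[of "M * t" "M * T" n] M(1) that
    by (smt (verit) atLeastAtMost_iff divide_right_mono fact_ge_zero mult_left_mono mult_nonneg_nonneg)
  have summ: "summable ?m"
    using summable_exp[of "M * T"] by (simp add: divide_inverse mult.commute)
  have sums: "summable (\<lambda>n. picard b n t)" if "t \<in> {0..T}" for t
    by (rule summable_comparison_test'[OF summ, of 0]) (rule bound'[OF that])
  have dbound: "norm (d n t) \<le> (case n of 0 \<Rightarrow> 0 | Suc k \<Rightarrow> M * ?m k)" if "t \<in> {0..T}" for n t
  proof (cases n)
    case (Suc k)
    have "norm (b t) * norm (picard b k t) \<le> M * ?m k"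
      using M(1) by (intro mult_mono M(2) bound' that) auto
    then show ?thesis by (simp add: Suc d_def norm_qmul)
  qed (simp add: d_def)
  have dsumm: "summable (\<lambda>n. case n of 0 \<Rightarrow> 0 | Suc k \<Rightarrow> M * ?m k)"
    using summable_mult[OF summ, of M] by (subst summable_Suc_iff[symmetric]) simp
  have dsum: "(\<Sum>n. d n t) = b t \<odot> (\<Sum>n. picard b n t)" if "t \<in> {0..T}" for t
  proof -
    have "summable (\<lambda>n. d n t)"
      by (rule summable_comparison_test'[OF dsumm, of 0]) (rule dbound[OF that])
    from suminf_split_head[OF this] have "(\<Sum>n. d n t) = (\<Sum>n. b t \<odot> picard b n t)"
      by (simp add: d_def)
    also have "\<dots> = b t \<odot> (\<Sum>n. picard b n t)"
      using bounded_linear.suminf[OF qmul.bounded_linear_right sums[OF that]] by simp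
    finally show ?thesis .
  qed
  have unif: "uniform_limit {0..T} (\<lambda>n t. \<Sum>i<n. d i t) (\<lambda>t. \<Sum>i. d i t) sequentially"
    by (rule Weierstrass_m_test[OF dbound dsumm])
  have "\<exists>g. \<forall>x\<in>{0..T}. (\<lambda>n. picard b n x) sums (g x) \<and>
      (g has_derivative (\<lambda>h. h *\<^sub>R (\<Sum>i. d i x))) (at x within {0..T})"
  proof (rule has_derivative_series[where f' = "\<lambda>n x h. h *\<^sub>R d n x"])
    fix e :: real assume "e > 0"
    then have "\<forall>\<^sub>F n in sequentially. \<forall>x\<in>{0..T}. dist (\<Sum>i<n. d i x) (\<Sum>i. d i x) < e"
      using unif by (simp add: uniform_limit_iff)
    then show "\<forall>\<^sub>F n in sequentially. \<forall>x\<in>{0..T}. \<forall>h. norm ((\<Sum>i<n. h *\<^sub>R d i x) - h *\<^sub>R (\<Sum>i. d i x)) \<le> e * norm h"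
    proof (rule eventually_mono, intro ballI allI)
      fix n x h assume *: "\<forall>x\<in>{0..T}. dist (\<Sum>i<n. d i x) (\<Sum>i. d i x) < e" "x \<in> {0..T}"
      have "norm ((\<Sum>i<n. h *\<^sub>R d i x) - h *\<^sub>R (\<Sum>i. d i x)) = \<bar>h\<bar> * norm ((\<Sum>i<n. d i x) - (\<Sum>i. d i x))"
        by (simp flip: scaleR_sum_right scaleR_diff_right)
      also have "\<dots> \<le> \<bar>h\<bar> * e"
        using * by (intro mult_left_mono) (auto simp: dist_norm less_imp_le)
      finally show "norm ((\<Sum>i<n. h *\<^sub>R d i x) - h *\<^sub>R (\<Sum>i. d i x)) \<le> e * norm h"
        by (simp add: mult.commute)
    qed
  qed (use deriv t sums[OF t] in \<open>auto simp: has_vector_derivative_def summable_sums\<close>)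
  then obtain g where g: "\<And>x. x \<in> {0..T} \<Longrightarrow> (\<lambda>n. picard b n x) sums (g x)"
    "\<And>x. x \<in> {0..T} \<Longrightarrow> (g has_derivative (\<lambda>h. h *\<^sub>R (\<Sum>i. d i x))) (at x within {0..T})"
    by blast
  have "(g has_vector_derivative b t \<odot> (\<Sum>n. picard b n t)) (at t within {0..T})"
    using g(2)[OF t] dsum[OF t] by (simp add: has_vector_derivative_def)
  then show ?thesis
  proof (rule has_vector_derivative_transform[OF t, rotated])
    show "(\<Sum>n. picard b n x) = g x" if "x \<in> {0..T}" for x
      using g(1)[OF that] by (simp add: sums_iff)
  qed
qed

text \<open>The series does not refer to the end point of the segment, so one function solves the
  equation on all segments at once. At t = 0 the derivative is one-sided.\<close>

lemma linear_ode_exists: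
  assumes b: "continuous_on {t. 0 \<le> t \<and> ereal t < R} b"
  obtains g where "g 0 = qone"
    "\<forall>t. 0 \<le> t \<and> ereal t < R \<longrightarrow> (g has_vector_derivative b t \<odot> g t) (at t within {0..})"
proof
  let ?g = "\<lambda>t. \<Sum>n. picard b n t"
  have "(\<lambda>n. picard b n 0) sums picard b 0 0"
  proof (rule sums_single[of 0 "\<lambda>n. picard b n 0", THEN sums_cong[THEN iffD1, rotated]])
    show "(if n = 0 then picard b n 0 else 0) = picard b n 0" for n
      by (cases n) auto
  qed
  then show "?g 0 = qone" by (simp add: sums_iff)
  show "\<forall>t. 0 \<le> t \<and> ereal t < R \<longrightarrow> (?g has_vector_derivative b t \<odot> ?g t) (at t within {0..})"
  proof (intro allI impI)
    fix t assume t: "0 \<le> t \<and> ereal t < R"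
    then obtain T where T: "t < T" "ereal T < R"
      using ereal_dense2[of "ereal t" R] by auto
    have sub: "{0..T} \<subseteq> {t. 0 \<le> t \<and> ereal t < R}"
      using T(2) by (auto intro: le_less_trans[of _ "ereal T"])
    have "at t within {0..T} = at t within {0..}"
      using T t by (intro at_within_nhd[of _ "{..<T}"]) auto
    then show "(?g has_vector_derivative b t \<odot> ?g t) (at t within {0..})"
      using linear_ode_segment[OF continuous_on_subset[OF b sub], of t] t T by simp
  qed
qed

lemma convex_ray: "convex {t. 0 < t \<and> ereal t < R}" "convex {t. 0 \<le> t \<and> ereal t < R}"
  unfolding is_interval_convex_1[symmetric] is_interval_1
  by (auto intro: le_less_trans[OF ereal_less_eq(3)[THEN iffD2]])

lemma eventually_ray:
  assumes "0 < R"
  shows "\<forall>\<^sub>F t in at_right (0::real). 0 < t \<and> ereal t < R"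
proof -
  obtain r where "0 < ereal r" "ereal r < R"
    using ereal_dense2[OF assms] by blast
  then show ?thesis
    by (intro eventually_at_rightI[of 0 r]) (auto intro: less_trans[of _ "ereal r"])
qed

text \<open>Integrating factor. The form C exp H yields the dichotomy used twice below: a solution
  vanishes identically or nowhere.\<close>

lemma scalar_linear_ode:
  fixes w k :: "real \<Rightarrow> real"
  assumes "0 < R"
    and w: "\<And>t. 0 < t \<Longrightarrow> ereal t < R \<Longrightarrow> (w has_real_derivative k t * w t) (at t)"
    and k: "\<And>t. 0 < t \<Longrightarrow> ereal t < R \<Longrightarrow> isCont k t"
  obtains H C where "\<forall>t. 0 < t \<and> ereal t < R \<longrightarrow> (H has_real_derivative k t) (at t)"
    "\<forall>t. 0 < t \<and> ereal t < R \<longrightarrow> w t = C * exp (H t)"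
proof -
  obtain H where H: "\<And>t. 0 < t \<Longrightarrow> ereal t < R \<Longrightarrow> (H has_real_derivative k t) (at t)"
    using einterval_antiderivative[of 0 R k] assms(1) k
    by (auto simp: has_real_derivative_iff_has_vector_derivative zero_ereal_def)
  let ?S = "{t. 0 < t \<and> ereal t < R}"
  have "convex ?S"
    by (rule convex_ray)
  moreover have "((\<lambda>t. w t * exp (- H t)) has_vector_derivative 0) (at t within ?S)" if "t \<in> ?S" for t
  proof -
    have "((\<lambda>t. w t * exp (- H t)) has_real_derivative 0) (at t)"
      using that by (auto intro!: derivative_eq_intros w H)
    then show ?thesis
      by (simp add: has_real_derivative_iff_has_vector_derivative has_vector_derivative_at_within)
  qed
  ultimately obtain C where C: "\<And>t. t \<in> ?S \<Longrightarrow> w t * exp (- H t) = C"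
    using has_vector_derivative_zero_constant by blast
  show thesis
  proof (rule that[of H C])
    show "\<forall>t. 0 < t \<and> ereal t < R \<longrightarrow> w t = C * exp (H t)"
      using C by (simp add: exp_minus field_simps)
  qed (use H in simp)
qed

lemma instanton_ode_solution:
  assumes "0 < R"
    and \<phi>: "\<And>t. 0 < t \<Longrightarrow> ereal t < R \<Longrightarrow> (\<phi> has_real_derivative instanton_rhs t (\<phi> t) (\<theta> t)) (at t)"
    and \<theta>: "\<And>t. 0 < t \<Longrightarrow> ereal t < R \<Longrightarrow> (\<theta> has_real_derivative 2 * (\<phi> t - 1) * \<theta> t / bs_A t) (at t)"
    and \<phi>0: "(\<phi> \<longlongrightarrow> 0) (at_right 0)"
    and \<theta>0: "\<forall>\<^sub>F t in at_right 0. \<bar>\<theta> t\<bar> \<le> K"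
  obtains x1 where "\<And>t. 0 < t \<Longrightarrow> ereal t < R \<Longrightarrow> clarke_denom x1 t \<noteq> 0"
    "\<And>t. 0 < t \<Longrightarrow> ereal t < R \<Longrightarrow> \<phi> t = bs_A t * clarke_x x1 t"
    "\<And>t. 0 < t \<Longrightarrow> ereal t < R \<Longrightarrow> \<theta> t = 0"
proof -
  have contA: "isCont bs_A t" if "0 < t" for t
    using DERIV_isCont[OF bs_A_deriv[OF that]] .
  have cont\<phi>: "isCont \<phi> t" if "0 < t" "ereal t < R" for t
    using DERIV_isCont[OF \<phi>[OF that]] .
  have A0: "bs_A t \<noteq> 0" "bs_B t \<noteq> 0" if "0 < t" for t
    using bs_A_pos[OF that] bs_B_pos[OF that] by auto
  have "(\<theta> has_real_derivative 2 * (\<phi> t - 1) / bs_A t * \<theta> t) (at t)" if "0 < t" "ereal t < R" for t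
    using \<theta>[OF that] by simp
  moreover have "isCont (\<lambda>t. 2 * (\<phi> t - 1) / bs_A t) t" if "0 < t" "ereal t < R" for t
    using contA cont\<phi> A0 that by (intro continuous_intros) auto
  ultimately obtain H C
    where HC: "\<forall>t. 0 < t \<and> ereal t < R \<longrightarrow> (H has_real_derivative 2 * (\<phi> t - 1) / bs_A t) (at t)"
      "\<forall>t. 0 < t \<and> ereal t < R \<longrightarrow> \<theta> t = C * exp (H t)"
    by (rule scalar_linear_ode[OF assms(1)])
  have H: "(H has_real_derivative 2 * (\<phi> t - 1) / bs_A t) (at t)" and C: "\<theta> t = C * exp (H t)"
    if "0 < t" "ereal t < R" for t
    using HC that by auto
  have "\<forall>\<^sub>F t in at_right 0. \<phi> t < 1 / 2"
    by (rule order_tendstoD(2)[OF \<phi>0]) simp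
  moreover have "\<forall>\<^sub>F t in at_right 0. bs_r t < 2"
  proof -
    have "(bs_r \<longlongrightarrow> bs_r 0) (at 0 within {0..})"
      using bs_r_continuous unfolding continuous_on_def by (rule bspec) simp
    then have "(bs_r \<longlongrightarrow> bs_r 0) (at_right 0)"
      by (rule tendsto_within_subset) auto
    then show ?thesis
      using order_tendstoD(2)[of bs_r 1 "at_right 0" 2] by simp
  qed
  moreover have "\<forall>\<^sub>F t in at_right 0. ereal t < R"
    using eventually_ray[OF assms(1)] by (rule eventually_mono) simp
  ultimately have "\<forall>\<^sub>F t in at_right 0. \<phi> t < 1 / 2 \<and> bs_r t < 2 \<and> ereal t < R \<and> \<bar>\<theta> t\<bar> \<le> K"
    using \<theta>0 by eventually_elim auto
  then obtain \<delta> where \<delta>: "0 < \<delta>" "\<And>t. 0 < t \<Longrightarrow> t < \<delta> \<Longrightarrow> \<phi> t < 1 / 2 \<and> bs_r t < 2 \<and> ereal t < R \<and> \<bar>\<theta> t\<bar> \<le> K"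
    unfolding eventually_at_right_field by auto
  \<comment> \<open>Near 0 one has \<phi> < 1/2 and A(s) \<le> s, so H' \<le> -1/s and t exp(H(t))
    does not increase with t. A nonzero C would make |\<theta>| at least a positive constant times
    1/t, against the bound K.\<close>
  have "C = 0"
  proof (rule ccontr)
    assume "C \<noteq> 0"
    define e where "e = \<delta> / 2"
    have e: "0 < e" "e < \<delta>" using \<delta>(1) by (auto simp: e_def)
    have mono: "H e + ln e \<le> H t + ln t" if "0 < t" "t \<le> e" for t
    proof (rule DERIV_nonpos_imp_nonincreasing[OF that(2)])
      fix s assume s: "t \<le> s" "s \<le> e"
      then have s': "0 < s" "s < \<delta>" "ereal s < R" using that e \<delta>(2)[of s] by auto
      have "bs_A s \<le> s"
      proof -
        have "bs_r s * s \<le> 2 * s"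
          using \<delta>(2)[OF s'(1,2)] s'(1) by (intro mult_right_mono) auto
        then show ?thesis using bs_A_le[of s] s'(1) by linarith
      qed
      moreover have "2 * (\<phi> s - 1) \<le> - 1" using \<delta>(2)[OF s'(1,2)] by simp
      ultimately have "2 * (\<phi> s - 1) / bs_A s + 1 / s \<le> 0"
        using bs_A_pos[OF s'(1)] s'(1)
        by (smt (verit) divide_minus_left divide_right_mono frac_le minus_divide_left)
      moreover have "((\<lambda>s. H s + ln s) has_real_derivative 2 * (\<phi> s - 1) / bs_A s + 1 / s) (at s)"
        using s' by (auto intro!: derivative_eq_intros H)
      ultimately show "\<exists>y. ((\<lambda>s. H s + ln s) has_real_derivative y) (at s) \<and> y \<le> 0"
        by blast
    qed
    have bound: "\<bar>C\<bar> * exp (H e) * e \<le> K * t" if "0 < t" "t \<le> e" for t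
    proof -
      have "exp (H e + ln e) \<le> exp (H t + ln t)"
        using mono[OF that] by simp
      then have "exp (H e) * e \<le> exp (H t) * t"
        using that e by (simp add: exp_add)
      then have "\<bar>C\<bar> * (exp (H e) * e) \<le> \<bar>C\<bar> * (exp (H t) * t)"
        by (intro mult_left_mono) auto
      also have "\<dots> = \<bar>\<theta> t\<bar> * t"
        using C[of t] \<delta>(2)[of t] that e by (simp add: abs_mult)
      also have "\<dots> \<le> K * t"
        using \<delta>(2)[of t] that e by (intro mult_right_mono) auto
      finally show ?thesis by (simp add: mult.assoc)
    qed
    let ?c = "\<bar>C\<bar> * exp (H e) * e"
    have c: "0 < ?c" using \<open>C \<noteq> 0\<close> e by simp
    have K: "0 < K" using bound[OF e(1) order_refl] c e by (smt (verit) mult_nonpos_nonneg)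
    \<comment> \<open>Small enough that K t is at most half the constant that is supposed to lie
      below it.\<close>
    define t where "t = min e (?c / (2 * K))"
    have "0 < t" "t \<le> e" "K * t \<le> ?c / 2"
      using c K e mult_left_mono[of t "?c / (2 * K)" K] by (auto simp: t_def)
    then show False using bound[of t] c by linarith
  qed
  then have \<theta>_zero: "\<theta> t = 0" if "0 < t" "ereal t < R" for t
    using C[OF that] by simp
  \<comment> \<open>Dividing by A^2 removes the linear terms of the equation, since A' = (1 - A^2 /
    B^2) / 2, and leaves a pure Riccati equation.\<close>
  define w where "w t = \<phi> t / bs_A t ^ 2" for t
  have dw: "(w has_real_derivative - w t * bs_A t * w t) (at t)" if t: "0 < t" "ereal t < R" for t
  proof -
    have "(w has_real_derivative (instanton_rhs t (\<phi> t) 0 * bs_A t ^ 2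
        - \<phi> t * (2 * bs_A t * ((1 - bs_A t ^ 2 / bs_B t ^ 2) / 2))) / (bs_A t ^ 2 * bs_A t ^ 2)) (at t)"
      unfolding w_def using \<phi>[OF t] bs_A_deriv[OF t(1)] A0[OF t(1)] \<theta>_zero[OF t]
      by (auto intro!: derivative_eq_intros simp: power2_eq_square)
    moreover have "(instanton_rhs t (\<phi> t) 0 * bs_A t ^ 2
        - \<phi> t * (2 * bs_A t * ((1 - bs_A t ^ 2 / bs_B t ^ 2) / 2))) / (bs_A t ^ 2 * bs_A t ^ 2) = - w t * bs_A t * w t"
      using A0[OF t(1)] by (simp add: instanton_rhs_def w_def field_simps power2_eq_square)
    ultimately show ?thesis by simp
  qed
  \<comment> \<open>The Riccati equation read as a linear one with coefficient - w A: it follows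
    that w has no zeros unless it is identically 0, so that 1 / w may be formed.\<close>
  have "isCont (\<lambda>t. - w t * bs_A t) t" if "0 < t" "ereal t < R" for t
    using contA DERIV_isCont[OF dw[OF that]] that by (intro continuous_intros) auto
  from scalar_linear_ode[OF assms(1) dw this]
  obtain H' C' where HC': "\<forall>t. 0 < t \<and> ereal t < R \<longrightarrow> w t = C' * exp (H' t)"
    by metis
  have C': "w t = C' * exp (H' t)" if "0 < t" "ereal t < R" for t
    using HC' that by auto
  have \<phi>_w: "\<phi> t = bs_A t ^ 2 * w t" if "0 < t" for t
    using A0[OF that] by (simp add: w_def)
  show thesis
  proof (cases "C' = 0")
    case True
    then have "\<phi> t = bs_A t * clarke_x 0 t" if "0 < t" "ereal t < R" for t
      using C'[OF that] \<phi>_w[OF that(1)] by (simp add: clarke_x_def)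
    then show thesis
      using that[of 0] \<theta>_zero by (simp add: clarke_denom_def)
  next
    case False
    then have w: "w t \<noteq> 0" if "0 < t" "ereal t < R" for t
      using C'[OF that] by simp
    let ?S = "{t. 0 < t \<and> ereal t < R}"
    have "convex ?S"
      by (rule convex_ray)
    \<comment> \<open>Here (2 / w)' = 2 A = (B^2)'. With the normalisation by 1/3 the constant d is
      the limit of 2 / w at t = 0, and x_1 = 1 / d.\<close>
    moreover have "((\<lambda>t. 2 / w t - bs_B t ^ 2 + 1 / 3) has_vector_derivative 0) (at t within ?S)" if "t \<in> ?S" for t
    proof -
      have "((\<lambda>t. 2 / w t - bs_B t ^ 2 + 1 / 3) has_real_derivative 0) (at t)"
        using that w[of t] by (intro DERIV_cong[OF DERIV_add[OF DERIV_diff[OF DERIV_divide[OF DERIV_const dw]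
                  bs_B_sq_deriv] DERIV_const]]) (auto simp: field_simps)
      then show ?thesis
        by (simp add: has_real_derivative_iff_has_vector_derivative has_vector_derivative_at_within)
    qed
    ultimately obtain d where d: "\<And>t. t \<in> ?S \<Longrightarrow> 2 / w t - bs_B t ^ 2 + 1 / 3 = d"
      using has_vector_derivative_zero_constant by blast
    have w_eq: "2 / w t = d + (bs_B t ^ 2 - 1 / 3)" if "0 < t" "ereal t < R" for t
      using d[of t] that by simp
    \<comment> \<open>For d = 0 one would have \<phi> = 2 (r^3 - 1) / (3 r (r^2 - 1)), which exceeds
      1/2 for every r > 1, whereas \<phi> < 1/2 near 0.\<close>
    have "d \<noteq> 0"
    proof
      assume "d = 0"
      define t where "t = \<delta> / 2"
      have t: "0 < t" "\<phi> t < 1 / 2" "ereal t < R" using \<delta>(1) \<delta>(2)[of t] by (auto simp: t_def)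
      let ?r = "bs_r t"
      have r: "1 < ?r" by (rule bs_r_gt[OF t(1)])
      have "\<phi> t * (2 / w t) = 2 * bs_A t ^ 2"
        using w[OF t(1,3)] \<phi>_w[OF t(1)] by simp
      then have "\<phi> t * ((?r ^ 2 - 1) / 3) = 2 * ((?r ^ 3 - 1) / (9 * ?r))"
        using w_eq[OF t(1,3)] \<open>d = 0\<close> by (simp add: bs_B_sq bs_A_sq[OF t(1)] diff_divide_distrib)
      then have eq: "3 * ?r * \<phi> t * (?r ^ 2 - 1) = 2 * (?r ^ 3 - 1)"
        using r by (simp add: field_simps)
      have "?r ^ 2 - 1 > 0" using r one_less_power[OF r, of 2] by simp
      then have "3 * ?r * \<phi> t * (?r ^ 2 - 1) < 3 * ?r * (1 / 2) * (?r ^ 2 - 1)"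
        using t r by (intro mult_strict_right_mono mult_strict_left_mono) auto
      moreover have "2 * (?r ^ 3 - 1) - 3 * ?r * (1 / 2) * (?r ^ 2 - 1) = (?r - 1) * (?r ^ 2 / 2 + ?r / 2 + 2)"
        by (simp add: field_simps power2_eq_square power3_eq_cube)
      moreover have "0 < (?r - 1) * (?r ^ 2 / 2 + ?r / 2 + 2)"
      proof (rule mult_pos_pos)
        show "0 < ?r ^ 2 / 2 + ?r / 2 + 2"
          using r zero_le_power2[of ?r] by linarith
      qed (use r in simp)
      ultimately show False using eq by linarith
    qed
    have denom: "clarke_denom (1 / d) t = 2 / w t / d" if "0 < t" "ereal t < R" for t
      using w_eq[OF that] \<open>d \<noteq> 0\<close> by (simp add: clarke_denom_def add_divide_distrib)
    show thesis
    proof (rule that[of "1 / d"])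
      fix t assume t: "0 < t" "ereal t < R"
      show "clarke_denom (1 / d) t \<noteq> 0"
        using denom[OF t] w[OF t] \<open>d \<noteq> 0\<close> by simp
      show "\<phi> t = bs_A t * clarke_x (1 / d) t"
        using \<phi>_w[OF t(1)] w[OF t] \<open>d \<noteq> 0\<close> by (simp add: clarke_x_def denom[OF t] power2_eq_square)
      show "\<theta> t = 0" by (rule \<theta>_zero[OF t])
    qed
  qed
qed


section \<open>Equivariant maps of \<open>su(2)\<close>\<close>

lemma su2_square: "x \<in> su2 \<Longrightarrow> norm x = 1 \<Longrightarrow> x \<odot> (x \<odot> z) = - z"
proof -
  assume x: "x \<in> su2" "norm x = 1"
  then have "x \<in> SU2" by (simp add: SU2_def)
  then have "qcnj x \<odot> (x \<odot> z) = z" by simp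
  then have "- (x \<odot> (x \<odot> z)) = z"
    using x(1) by (simp add: su2_iff_qcnj qmul.minus_left)
  then show ?thesis
    by (metis minus_minus)
qed

text \<open>Since x^2 = y^2 = -1, the quaternion m = 1 - y x satisfies m x = x + y = y m, and it
  vanishes only for y = - x. As a polynomial in y x, it commutes with whatever y x commutes
  with.\<close>

lemma half_turn:
  assumes x: "x \<in> su2" "norm x = 1" and y: "y \<in> su2" "norm y = 1" and "y \<noteq> - x"
  obtains k where "k \<in> SU2" "k \<odot> x \<odot> qcnj k = y"
    "\<forall>z. z \<odot> (y \<odot> x) = (y \<odot> x) \<odot> z \<longrightarrow> k \<odot> z \<odot> qcnj k = z"
proof -
  define m where "m = qone - y \<odot> x"
  have xx: "x \<odot> x = - qone" and yy: "y \<odot> (y \<odot> z) = - z" for z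
    using su2_square[OF x, of qone] su2_square[OF y] by simp_all
  have mx: "m \<odot> x = y \<odot> m"
    by (simp add: m_def qmul.diff_left qmul.diff_right qmul_assoc xx yy qmul.minus_right)
  have "m \<noteq> 0"
  proof
    assume "m = 0"
    then have "y \<odot> (y \<odot> x) = y" by (simp add: m_def)
    then show False using yy assms(5) by (metis minus_minus)
  qed
  define k where "k = inverse (norm m) *\<^sub>R m"
  have k: "k \<in> SU2" using \<open>m \<noteq> 0\<close> by (simp add: k_def SU2_def)
  have "k \<odot> x = y \<odot> k"
    by (simp add: k_def qmul.scaleR_left qmul.scaleR_right mx)
  then have "k \<odot> x \<odot> qcnj k = y"
    using k by (simp add: qmul_assoc)
  moreover have "k \<odot> z \<odot> qcnj k = z" if "z \<odot> (y \<odot> x) = (y \<odot> x) \<odot> z" for z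
  proof -
    have "k \<odot> z = z \<odot> k"
      using that by (simp add: k_def m_def qmul.scaleR_left qmul.scaleR_right qmul.diff_left qmul.diff_right)
    then show ?thesis using k by (simp add: qmul_assoc)
  qed
  ultimately show thesis using that k by blast
qed

lemma T_su2_simps: "T_su2 i \<in> su2" "norm (T_su2 i) = 1" "T_su2 i \<in> SU2"
  by (simp_all add: T_su2_def su2_def SU2_def norm_Pair)

text \<open>An intermediate T_i avoids the antipodal case: of the three, at most two are excluded by
  being - x or - y.\<close>

lemma conj_transitive:
  assumes x: "x \<in> su2" "norm x = 1" and y: "y \<in> su2" "norm y = 1"
  obtains k where "k \<in> SU2" "k \<odot> x \<odot> qcnj k = y"
proof -
  have "T_su2 1 \<noteq> T_su2 2" "T_su2 1 \<noteq> T_su2 3" "T_su2 2 \<noteq> T_su2 3"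
    by (simp_all add: T_su2_def axis_eq_axis)
  then obtain i where i: "T_su2 i \<noteq> - x" "y \<noteq> - T_su2 i"
    by (metis minus_minus)
  obtain h where h: "h \<in> SU2" "h \<odot> x \<odot> qcnj h = T_su2 i"
    by (rule half_turn[OF x T_su2_simps(1,2) i(1)])
  obtain k where k: "k \<in> SU2" "k \<odot> T_su2 i \<odot> qcnj k = y"
    by (rule half_turn[OF T_su2_simps(1,2) y i(2)])
  show thesis
  proof (rule that[of "k \<odot> h"])
    show "k \<odot> h \<odot> x \<odot> qcnj (k \<odot> h) = y"
      unfolding k(2)[symmetric] h(2)[symmetric] by (simp add: qmul_assoc qcnj_qmul)
  qed (use h k in simp)
qed

lemma su2_expand: "u \<in> su2 \<Longrightarrow> u = (\<Sum>i\<in>UNIV. (u \<bullet> T_su2 i) *\<^sub>R T_su2 i)"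
  unfolding sum_T_su2 by (cases u) (simp add: su2_def T_su2_def vec_eq_iff inner_axis)

lemma T_su2_qmul:
  "T_su2 1 \<odot> T_su2 2 = T_su2 3" "T_su2 2 \<odot> T_su2 1 = - T_su2 3"
  "T_su2 2 \<odot> T_su2 3 = T_su2 1" "T_su2 3 \<odot> T_su2 2 = - T_su2 1"
  "T_su2 3 \<odot> T_su2 1 = T_su2 2" "T_su2 1 \<odot> T_su2 3 = - T_su2 2"
  "T_su2 i \<odot> T_su2 i = - qone"
  using UNIV_3_cases[of i]
  by (auto simp: T_su2_def qmul_def qone_def prod_eq_iff vec_eq_iff forall_3 cross3_def axis_def
      inner_vec_def sum_3)

lemma qcnj_T_su2: "qcnj (T_su2 i) = - T_su2 i"
  using T_su2_simps(1) by (simp add: su2_iff_qcnj)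

lemma inner_T_su2: "T_su2 i \<bullet> T_su2 j = (if i = j then 1 else 0)"
  by (simp add: T_su2_def inner_axis_axis)

lemma inner_conj:
  assumes "c \<in> SU2"
  shows "(c \<odot> x \<odot> qcnj c) \<bullet> (c \<odot> y \<odot> qcnj c) = x \<bullet> y"
proof -
  have n: "norm (c \<odot> z \<odot> qcnj c) = norm z" for z
    using assms by (simp add: norm_qmul norm_SU2)
  show ?thesis
    unfolding inner_polarization[of "c \<odot> x \<odot> qcnj c"] inner_polarization[of x y]
    by (simp only: n qmul.add_left[symmetric] qmul.add_right[symmetric])
qed

text \<open>After moving T_1 to v1, a rotation about T_1 remains to be found that takes T_2 to some
  y orthogonal to T_1. Then y T_2 lies in the span of 1 and T_1, so the rotation from
  \<open>half_turn\<close> fixes T_1. In the excluded case y = - T_2, conjugation by T_1 does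
  it.\<close>

lemma conj_frame:
  assumes v: "v1 \<in> su2" "norm v1 = 1" "v2 \<in> su2" "norm v2 = 1" "v1 \<bullet> v2 = 0"
  obtains c where "c \<in> SU2" "c \<odot> T_su2 1 \<odot> qcnj c = v1" "c \<odot> T_su2 2 \<odot> qcnj c = v2"
proof -
  obtain h where h: "h \<in> SU2" "h \<odot> T_su2 1 \<odot> qcnj h = v1"
    by (rule conj_transitive[OF T_su2_simps(1,2) v(1,2)])
  define y where "y = qcnj h \<odot> v2 \<odot> h"
  have hy: "h \<odot> y \<odot> qcnj h = v2" using h(1) by (simp add: y_def qmul_assoc)
  have y: "y \<in> su2" "norm y = 1"
    using su2_conj[OF v(3), of "qcnj h"] h(1) v(4) by (simp_all add: y_def norm_qmul norm_SU2)
  have y1: "T_su2 1 \<bullet> y = 0"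
    using inner_conj[OF h(1), of "T_su2 1" y] by (simp add: h(2) hy v(5))
  have "\<exists>k\<in>SU2. k \<odot> T_su2 1 \<odot> qcnj k = T_su2 1 \<and> k \<odot> T_su2 2 \<odot> qcnj k = y"
  proof (cases "y = - T_su2 2")
    case True
    then show ?thesis
      by (intro bexI[of _ "T_su2 1"]) (simp_all add: T_su2_simps qcnj_T_su2 qmul.minus_right qmul.minus_left qmul_assoc T_su2_qmul)
  next
    case False
    obtain k where k: "k \<in> SU2" "k \<odot> T_su2 2 \<odot> qcnj k = y"
      "\<forall>z. z \<odot> (y \<odot> T_su2 2) = (y \<odot> T_su2 2) \<odot> z \<longrightarrow> k \<odot> z \<odot> qcnj k = z"
      by (rule half_turn[OF T_su2_simps(1,2) y False])
    have "y = (y \<bullet> T_su2 2) *\<^sub>R T_su2 2 + (y \<bullet> T_su2 3) *\<^sub>R T_su2 3"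
      using su2_expand[OF y(1)] y1 by (simp add: sum_3 inner_commute)
    then have "y \<odot> T_su2 2 = - ((y \<bullet> T_su2 2) *\<^sub>R qone) - (y \<bullet> T_su2 3) *\<^sub>R T_su2 1"
      by (metis (no_types, lifting) T_su2_qmul(4,7) qmul.add_left qmul.scaleR_left scaleR_minus_right diff_conv_add_uminus)
    then have "T_su2 1 \<odot> (y \<odot> T_su2 2) = (y \<odot> T_su2 2) \<odot> T_su2 1"
      by (simp add: qmul.diff_left qmul.diff_right qmul.minus_left qmul.minus_right qmul.scaleR_left qmul.scaleR_right)
    then show ?thesis using k by blast
  qed
  then obtain k where k: "k \<in> SU2" "k \<odot> T_su2 1 \<odot> qcnj k = T_su2 1" "k \<odot> T_su2 2 \<odot> qcnj k = y"
    by blast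
  have "h \<odot> k \<odot> z \<odot> qcnj (h \<odot> k) = h \<odot> (k \<odot> z \<odot> qcnj k) \<odot> qcnj h" for z
    by (simp add: qmul_assoc qcnj_qmul)
  then show thesis
    using h k hy by (intro that[of "h \<odot> k"]) simp_all
qed

text \<open>N commutes with the half-turn about each T_i, so it preserves its axis; the rotation
  permuting T_1, T_2, T_3 cyclically then makes the three eigenvalues equal.\<close>

lemma conj_commuting_scalar:
  assumes lin: "linear N" and N: "\<And>x. x \<in> su2 \<Longrightarrow> N x \<in> su2"
    and comm: "\<And>h x. h \<in> SU2 \<Longrightarrow> x \<in> su2 \<Longrightarrow> N (h \<odot> x \<odot> qcnj h) = h \<odot> N x \<odot> qcnj h"
  shows "\<exists>r. \<forall>x\<in>su2. N x = r *\<^sub>R x"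
proof -
  note q = qcnj_T_su2 qmul.minus_right qmul.minus_left qmul_assoc T_su2_qmul
    qmul.add_left qmul.add_right qmul.scaleR_left qmul.scaleR_right
  let ?c = "\<lambda>i j. N (T_su2 i) \<bullet> T_su2 j"
  have fixed: "T_su2 i \<odot> N (T_su2 i) \<odot> qcnj (T_su2 i) = N (T_su2 i)" for i
    using comm[OF T_su2_simps(3,1), of i i] by (simp add: q)
  have expand: "N (T_su2 i) = ?c i 1 *\<^sub>R T_su2 1 + ?c i 2 *\<^sub>R T_su2 2 + ?c i 3 *\<^sub>R T_su2 3" for i
    using su2_expand[OF N[OF T_su2_simps(1)], of i] by (simp add: sum_3)
  have flip: "?c i j = 0" if "i \<noteq> j" for i j
  proof -
    have "T_su2 i \<odot> T_su2 j \<odot> qcnj (T_su2 i) = - T_su2 j"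
      using that UNIV_3_cases[of i] UNIV_3_cases[of j] by (auto simp: q)
    then have "?c i j = - ?c i j"
      using inner_conj[OF T_su2_simps(3)[of i], of "N (T_su2 i)" "T_su2 j"] by (simp add: fixed)
    then show ?thesis by simp
  qed
  \<comment> \<open>The unit quaternion (1 + i + j + k) / 2 of order six, whose conjugation cycles
    the basis.\<close>
  define h where "h = (1 / 2) *\<^sub>R (qone + T_su2 1 + T_su2 2 + T_su2 3)"
  have h: "h \<in> SU2"
    by (simp add: h_def SU2_def qone_def T_su2_def norm_Pair norm_vec_def L2_set_def sum_3 axis_def power2_eq_square)
  have rot: "h \<odot> T_su2 1 \<odot> qcnj h = T_su2 2" "h \<odot> T_su2 2 \<odot> qcnj h = T_su2 3"
    by (simp_all add: h_def qone_def T_su2_def qmul_def qcnj_def prod_eq_iff vec_eq_iff forall_3 cross3_def axis_def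
      inner_vec_def sum_3)
  have "?c 2 2 = ?c 1 1"
    using inner_conj[OF h, of "N (T_su2 1)" "T_su2 1"] comm[OF h T_su2_simps(1), of 1] by (simp add: rot)
  moreover have "?c 3 3 = ?c 2 2"
    using inner_conj[OF h, of "N (T_su2 2)" "T_su2 2"] comm[OF h T_su2_simps(1), of 2] by (simp add: rot)
  moreover define r where "r = ?c 1 1"
  ultimately have c: "?c 1 1 = r" "?c 2 2 = r" "?c 3 3 = r"
    by simp_all
  have NT: "N (T_su2 i) = r *\<^sub>R T_su2 i" for i
  proof -
    have "N (T_su2 1) = r *\<^sub>R T_su2 1" "N (T_su2 2) = r *\<^sub>R T_su2 2" "N (T_su2 3) = r *\<^sub>R T_su2 3"
      by (subst expand, simp add: flip c)+
    then show ?thesis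
      using UNIV_3_cases[of i] by auto
  qed
  have "N x = r *\<^sub>R x" if "x \<in> su2" for x
  proof -
    have "N x = (\<Sum>i\<in>UNIV. (x \<bullet> T_su2 i) *\<^sub>R N (T_su2 i))"
      by (subst su2_expand[OF that]) (simp add: linear_sum[OF lin] linear_scale[OF lin])
    also have "\<dots> = r *\<^sub>R (\<Sum>i\<in>UNIV. (x \<bullet> T_su2 i) *\<^sub>R T_su2 i)"
      by (simp add: NT scaleR_sum_right mult.commute)
    finally show ?thesis using su2_expand[OF that] by simp
  qed
  then show ?thesis by blast
qed

text \<open>
  A version of Schur's lemma for the adjoint representation twisted by an arbitrary map \<open>\<mu>\<close>: a
  nonzero equivariant map is a multiple of an isometry, so that up to sign it is the conjugation by
  some \<open>c\<close>, and then \<open>\<mu>\<close> acts as conjugation by \<open>c h c\<^sup>-\<^sup>1\<close> does.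
\<close>

lemma equivariant_maps_scalar:
  assumes lin: "\<And>i. i \<in> I \<Longrightarrow> linear (M i)" and M: "\<And>i x. i \<in> I \<Longrightarrow> x \<in> su2 \<Longrightarrow> M i x \<in> su2"
    and \<mu>: "\<And>h. h \<in> SU2 \<Longrightarrow> \<mu> h \<in> SU2"
    and equiv: "\<And>i h x. i \<in> I \<Longrightarrow> h \<in> SU2 \<Longrightarrow> x \<in> su2 \<Longrightarrow>
      M i (h \<odot> x \<odot> qcnj h) = \<mu> h \<odot> M i x \<odot> qcnj (\<mu> h)"
  obtains c where "c \<in> SU2" "\<forall>i\<in>I. \<exists>r. \<forall>x\<in>su2. M i x = r *\<^sub>R (c \<odot> x \<odot> qcnj c)"
proof (cases "\<forall>i\<in>I. \<forall>x\<in>su2. M i x = 0")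
  case True
  then have "\<forall>i\<in>I. \<exists>r. \<forall>x\<in>su2. M i x = r *\<^sub>R (qone \<odot> x \<odot> qcnj qone)"
    by (intro ballI exI[of _ 0]) simp
  then show thesis using that SU2_closed(1) by blast
next
  case False
  then obtain j x0 where j: "j \<in> I" "x0 \<in> su2" "M j x0 \<noteq> 0" by blast
  have lj: "linear (M j)" by (rule lin[OF j(1)])
  define \<kappa> where "\<kappa> = norm (M j (T_su2 1))"
  \<comment> \<open>Conjugations act transitively on the unit sphere of su(2) and preserve norms on
    both sides, so the norm of M j is constant there.\<close>
  have iso1: "norm (M j x) = \<kappa>" if x: "x \<in> su2" "norm x = 1" for x
  proof -
    obtain h where h: "h \<in> SU2" "h \<odot> T_su2 1 \<odot> qcnj h = x"
      by (rule conj_transitive[OF T_su2_simps(1,2) x])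
    then show ?thesis
      using equiv[OF j(1) h(1) T_su2_simps(1), of 1] \<mu>[OF h(1)] by (simp add: \<kappa>_def norm_qmul norm_SU2)
  qed
  have iso: "norm (M j x) = \<kappa> * norm x" if "x \<in> su2" for x
  proof (cases "x = 0")
    case True
    then show ?thesis using linear_0[OF lj] by simp
  next
    case False
    have "norm (M j (inverse (norm x) *\<^sub>R x)) = \<kappa>"
      using False that by (intro iso1) (auto simp: su2_def)
    then show ?thesis using False by (simp add: linear_scale[OF lj] field_simps)
  qed
  have \<kappa>: "\<kappa> > 0" using iso[OF j(2)] j(3) by (simp add: \<kappa>_def) (metis mult_zero_left norm_eq_zero)
  have inner: "M j x \<bullet> M j y = \<kappa>\<^sup>2 * (x \<bullet> y)" if "x \<in> su2" "y \<in> su2" for x y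
  proof -
    have "x + y \<in> su2" using that by (simp add: su2_def)
    then show ?thesis
      unfolding inner_polarization[of "M j x"] inner_polarization[of x] linear_add[OF lj, symmetric]
      by (simp add: iso that power_mult_distrib algebra_simps)
  qed
  define Q where "Q x = inverse \<kappa> *\<^sub>R M j x" for x
  have Q: "Q x \<in> su2" "norm (Q x) = norm x" "Q x \<bullet> Q y = x \<bullet> y" if "x \<in> su2" "y \<in> su2" for x y
    using \<kappa> iso[OF that(1)] inner[OF that] M[OF j(1) that(1)]
    by (simp_all add: Q_def su2_def power2_eq_square field_simps)
  note QT = Q[OF T_su2_simps(1) T_su2_simps(1)]
  obtain c where c: "c \<in> SU2" "c \<odot> T_su2 1 \<odot> qcnj c = Q (T_su2 1)" "c \<odot> T_su2 2 \<odot> qcnj c = Q (T_su2 2)"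
    by (rule conj_frame[of "Q (T_su2 1)" "Q (T_su2 2)"]) (simp_all add: QT inner_T_su2 T_su2_simps)
  \<comment> \<open>A second candidate for the case that the isometry Q reverses orientation: then -
    Q is a rotation.\<close>
  obtain c' where c': "c' \<in> SU2" "c' \<odot> T_su2 1 \<odot> qcnj c' = - Q (T_su2 1)" "c' \<odot> T_su2 2 \<odot> qcnj c' = - Q (T_su2 2)"
    by (rule conj_frame[of "- Q (T_su2 1)" "- Q (T_su2 2)"])
      (use QT in \<open>simp_all add: inner_T_su2 T_su2_simps su2_def\<close>)
  define z where "z = qcnj c \<odot> Q (T_su2 3) \<odot> c"
  have cz: "c \<odot> z \<odot> qcnj c = Q (T_su2 3)" using c(1) by (simp add: z_def qmul_assoc)
  have z: "z \<in> su2" "norm z = 1"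
    using su2_conj[OF QT(1), of "qcnj c" 3] c(1) QT(2)[of 3] by (simp_all add: z_def norm_qmul norm_SU2 T_su2_simps)
  have "z \<bullet> T_su2 1 = 0" "z \<bullet> T_su2 2 = 0"
    using inner_conj[OF c(1), of z "T_su2 1"] inner_conj[OF c(1), of z "T_su2 2"]
    by (simp_all add: cz c QT inner_T_su2)
  then have z3: "z = (z \<bullet> T_su2 3) *\<^sub>R T_su2 3"
    using su2_expand[OF z(1)] by (simp add: sum_3)
  then have "\<bar>z \<bullet> T_su2 3\<bar> = 1"
    using z(2) by (metis T_su2_simps(2) mult.right_neutral norm_scaleR)
  then have "z = T_su2 3 \<or> z = - T_su2 3"
    using z3 by (metis abs_eq_iff' abs_1 scaleR_minus_left scaleR_one)
  then have "\<exists>c\<in>SU2. \<exists>\<epsilon>. (\<epsilon> = 1 \<or> \<epsilon> = -1) \<and> (\<forall>i. Q (T_su2 i) = \<epsilon> *\<^sub>R (c \<odot> T_su2 i \<odot> qcnj c))"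
  proof
    assume "z = T_su2 3"
    then have "Q (T_su2 i) = 1 *\<^sub>R (c \<odot> T_su2 i \<odot> qcnj c)" for i
      using UNIV_3_cases[of i] c cz by auto
    then show ?thesis using c(1) by blast
  next
    assume z: "z = - T_su2 3"
    have conj_mult: "b \<in> SU2 \<Longrightarrow> (b \<odot> x \<odot> qcnj b) \<odot> (b \<odot> y \<odot> qcnj b) = b \<odot> (x \<odot> y) \<odot> qcnj b" for b x y
      by (simp add: qmul_assoc)
    \<comment> \<open>The third basis vector is determined through T_3 = T_1 T_2, in which the two
      signs cancel.\<close>
    have "c' \<odot> T_su2 3 \<odot> qcnj c' = Q (T_su2 1) \<odot> Q (T_su2 2)"
      using conj_mult[OF c'(1), of "T_su2 1" "T_su2 2"]
      by (simp add: c' T_su2_qmul qmul.minus_left qmul.minus_right)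
    also have "\<dots> = c \<odot> T_su2 3 \<odot> qcnj c"
      using conj_mult[OF c(1), of "T_su2 1" "T_su2 2"] by (simp add: c T_su2_qmul)
    also have "\<dots> = - Q (T_su2 3)"
      unfolding cz[symmetric] z by (simp add: qmul.minus_left qmul.minus_right)
    finally have "Q (T_su2 i) = - 1 *\<^sub>R (c' \<odot> T_su2 i \<odot> qcnj c')" for i
      using UNIV_3_cases[of i] c' by auto
    then show ?thesis using c'(1) by blast
  qed
  then obtain b \<epsilon> where b: "b \<in> SU2" "\<epsilon> = 1 \<or> \<epsilon> = -1" "\<And>i. Q (T_su2 i) = \<epsilon> *\<^sub>R (b \<odot> T_su2 i \<odot> qcnj b)"
    by blast
  have Mj: "M j x = (\<kappa> * \<epsilon>) *\<^sub>R (b \<odot> x \<odot> qcnj b)" if "x \<in> su2" for x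
  proof -
    have MT: "M j (T_su2 i) = (\<kappa> * \<epsilon>) *\<^sub>R (b \<odot> T_su2 i \<odot> qcnj b)" for i
      using b(3)[of i] \<kappa> unfolding Q_def by (metis (no_types, lifting) divideR_right less_numeral_extra(3) scaleR_scaleR)
    have "M j x = (\<Sum>i\<in>UNIV. (x \<bullet> T_su2 i) *\<^sub>R M j (T_su2 i))"
      by (subst su2_expand[OF that]) (simp add: linear_sum[OF lj] linear_scale[OF lj])
    also have "\<dots> = (\<kappa> * \<epsilon>) *\<^sub>R (b \<odot> (\<Sum>i\<in>UNIV. (x \<bullet> T_su2 i) *\<^sub>R T_su2 i) \<odot> qcnj b)"
      by (simp add: MT sum_3 qmul.add_left qmul.add_right qmul.scaleR_left qmul.scaleR_right scaleR_add_right mult_ac)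
    finally show ?thesis using su2_expand[OF that] by simp
  qed
  \<comment> \<open>Dividing out the nonzero scalar in the equivariance of M j shows that
    conjugation by \<mu>(h) is conjugation by b h b^-1. After conjugation with b, every member of
    the family commutes with all rotations.\<close>
  have \<mu>b: "\<mu> h \<odot> (b \<odot> x \<odot> qcnj b) \<odot> qcnj (\<mu> h) = b \<odot> (h \<odot> x \<odot> qcnj h) \<odot> qcnj b" if "h \<in> SU2" "x \<in> su2" for h x
  proof -
    have "(\<kappa> * \<epsilon>) *\<^sub>R (b \<odot> (h \<odot> x \<odot> qcnj h) \<odot> qcnj b) = (\<kappa> * \<epsilon>) *\<^sub>R (\<mu> h \<odot> (b \<odot> x \<odot> qcnj b) \<odot> qcnj (\<mu> h))"
      using equiv[OF j(1) that] Mj[OF that(2)] Mj[OF su2_conj[OF that(2)], of h]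
      by (simp add: qmul.scaleR_left qmul.scaleR_right)
    then show ?thesis using \<kappa> b(2) by auto
  qed
  have "\<exists>r. \<forall>x\<in>su2. M i x = r *\<^sub>R (b \<odot> x \<odot> qcnj b)" if i: "i \<in> I" for i
  proof -
    let ?N = "\<lambda>x. qcnj b \<odot> M i x \<odot> b"
    have "\<exists>r. \<forall>x\<in>su2. ?N x = r *\<^sub>R x"
    proof (rule conj_commuting_scalar)
      have "linear (\<lambda>x. qcnj b \<odot> x \<odot> b)"
        using bounded_linear_qmul_both bounded_linear.linear by blast
      from linear_compose[OF lin[OF i] this] show "linear ?N" by (simp add: o_def)
      show "?N x \<in> su2" if "x \<in> su2" for x
        using su2_conj[OF M[OF i that], of "qcnj b"] by simp
      fix h x assume hx: "h \<in> SU2" "x \<in> su2"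
      have "?N x \<in> su2"
        using su2_conj[OF M[OF i hx(2)], of "qcnj b"] by simp
      have "M i (h \<odot> x \<odot> qcnj h) = \<mu> h \<odot> (b \<odot> ?N x \<odot> qcnj b) \<odot> qcnj (\<mu> h)"
        using equiv[OF i hx] b(1) by (simp add: qmul_assoc)
      also have "\<dots> = b \<odot> (h \<odot> ?N x \<odot> qcnj h) \<odot> qcnj b"
        by (rule \<mu>b[OF hx(1) \<open>?N x \<in> su2\<close>])
      finally show "?N (h \<odot> x \<odot> qcnj h) = h \<odot> ?N x \<odot> qcnj h"
        using b(1) by (simp add: qmul_assoc)
    qed
    then obtain r where r: "\<And>x. x \<in> su2 \<Longrightarrow> ?N x = r *\<^sub>R x" by blast
    have "M i x = r *\<^sub>R (b \<odot> x \<odot> qcnj b)" if "x \<in> su2" for x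
    proof -
      have "M i x = b \<odot> ?N x \<odot> qcnj b" using b(1) by (simp add: qmul_assoc)
      then show ?thesis by (simp add: r[OF that] qmul.scaleR_left qmul.scaleR_right)
    qed
    then show ?thesis by blast
  qed
  then show thesis using that b(1) by blast
qed

section \<open>The temporal gauge\<close>

lemma ray_tube: "0 \<le> t \<Longrightarrow> ereal t < R \<Longrightarrow> (t *\<^sub>R qone, qone) \<in> tube R"
  by (simp add: tube_def)

text \<open>The element (a, a, 1) rotates the fibre over q = 1 and fixes this base point of the
  orbit.\<close>

lemma left_invariant_polar:
  assumes inv: "left_invariant_on R A" and a: "a \<in> SU2" and t: "0 \<le> t" "ereal t < R"
  shows "A (t *\<^sub>R a, qone) (v, 0) = A (t *\<^sub>R qone, qone) (qcnj a \<odot> v, 0)"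
proof -
  note m = ray_tube[OF t]
  have "(qcnj a \<odot> v, 0) \<in> tangent_space (tube R) (t *\<^sub>R qone, qone)"
    using m by (simp add: tangent_tube)
  then have "A (act (a, a, qone) (t *\<^sub>R qone, qone)) (act (a, a, qone) (qcnj a \<odot> v, 0))
      = A (t *\<^sub>R qone, qone) (qcnj a \<odot> v, 0)"
    using inv a m unfolding left_invariant_on_def by blast
  then show ?thesis
    using a by (simp add: act_def qmul.scaleR_right qmul.zero_left qmul.zero_right)
qed

text \<open>The element (-1, -1, 1) fixes (0, 1) and acts as -1 on the fibre, while the 1-form is
  invariant, so A(v) = A(-v).\<close>

lemma connection_singular_orbit:
  assumes conn: "connection_on R A" and inv: "left_invariant_on R A" and "0 < R"
  shows "A (0, qone) (v, 0) = 0"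
proof -
  have R: "ereal 0 < R" using assms(3) by (simp add: zero_ereal_def)
  have "- qone \<in> SU2" by (simp add: SU2_def)
  from left_invariant_polar[OF inv this _ R, of v] have "A (0, qone) (v, 0) = A (0, qone) (- v, 0)"
    by (simp add: qcnj_linear qmul.minus_left)
  also have "(- v, 0 :: quat) = - (v, 0)" by simp
  also have "A (0, qone) \<dots> = - A (0, qone) (v, 0)"
    using ray_tube[OF order_refl R] by (intro linear_neg connection_linear[OF conn]) simp
  finally have "2 *\<^sub>R A (0, qone) (v, 0) = 0"
    by (simp only: scaleR_2 eq_neg_iff_add_eq_0)
  then show ?thesis by simp
qed

definition radial_coef :: "(quat \<times> quat \<Rightarrow> quat \<times> quat \<Rightarrow> quat) \<Rightarrow> real \<Rightarrow> quat"
  where "radial_coef A t = A (t *\<^sub>R qone, qone) (qone, 0)"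

text \<open>
  Averaging over the conjugations by \<open>1, i, j, k\<close> extracts the radial part of the connection along
  the fibre \<open>\<real>\<^sup>4 \<times> {1}\<close>, and it manifestly is smooth at the origin.
\<close>

definition radial_part :: "(quat \<times> quat \<Rightarrow> quat \<times> quat \<Rightarrow> quat) \<Rightarrow> quat \<Rightarrow> quat \<Rightarrow> quat"
  where "radial_part A p v = (1 / 4) *\<^sub>R (A (p, qone) (v, 0)
    + A (T_su2 1 \<odot> p \<odot> qcnj (T_su2 1), qone) (T_su2 1 \<odot> v \<odot> qcnj (T_su2 1), 0)
    + A (T_su2 2 \<odot> p \<odot> qcnj (T_su2 2), qone) (T_su2 2 \<odot> v \<odot> qcnj (T_su2 2), 0)
    + A (T_su2 3 \<odot> p \<odot> qcnj (T_su2 3), qone) (T_su2 3 \<odot> v \<odot> qcnj (T_su2 3), 0))"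

text \<open>Averaging over 1, i, j, k projects a quaternion onto its real part.\<close>

lemma sum_conj_T_su2:
  "x + T_su2 1 \<odot> x \<odot> qcnj (T_su2 1) + T_su2 2 \<odot> x \<odot> qcnj (T_su2 2) + T_su2 3 \<odot> x \<odot> qcnj (T_su2 3)
    = (4 * fst x) *\<^sub>R qone"
  by (cases x) (simp add: T_su2_def qmul_def qcnj_def qone_def prod_eq_iff vec_eq_iff forall_3 cross3_def axis_def
      inner_vec_def sum_3)

text \<open>By invariance, each of the four terms is A at the point |p| of the ray, evaluated on a
  conjugate of a^-1 v with a = p / |p|. The average keeps only the real part of a^-1 v, that is, the
  radial component of v.\<close>

lemma radial_part_eq:
  assumes conn: "connection_on R A" and inv: "left_invariant_on R A" and p: "ereal (norm p) < R" "p \<noteq> 0"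
  shows "radial_part A p v = (p \<bullet> v / norm p) *\<^sub>R radial_coef A (norm p)"
proof -
  let ?t = "norm p"
  define a where "a = inverse ?t *\<^sub>R p"
  have a: "a \<in> SU2" using p(2) by (simp add: a_def SU2_def)
  have pa: "p = ?t *\<^sub>R a" using p(2) by (simp add: a_def)
  have t: "0 \<le> ?t" by simp
  let ?L = "\<lambda>x. A (?t *\<^sub>R qone, qone) (x, 0)"
  have lin: "linear ?L"
    using linear_compose[of "\<lambda>x. (x, 0)" "A (?t *\<^sub>R qone, qone)"] connection_linear[OF conn ray_tube[OF t p(1)]]
    by (simp add: o_def linearI)
  have h: "A (h \<odot> p \<odot> qcnj h, qone) (h \<odot> v \<odot> qcnj h, 0) = ?L (h \<odot> (qcnj a \<odot> v) \<odot> qcnj h)" if "h \<in> SU2" for h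
  proof -
    have "A (?t *\<^sub>R (h \<odot> a \<odot> qcnj h), qone) (h \<odot> v \<odot> qcnj h, 0)
        = ?L (qcnj (h \<odot> a \<odot> qcnj h) \<odot> (h \<odot> v \<odot> qcnj h))"
      using that a by (intro left_invariant_polar[OF inv _ t p(1)]) simp
    moreover have "h \<odot> (?t *\<^sub>R a) \<odot> qcnj h = ?t *\<^sub>R (h \<odot> a \<odot> qcnj h)"
      by (simp add: qmul.scaleR_left qmul.scaleR_right)
    then have "?t *\<^sub>R (h \<odot> a \<odot> qcnj h) = h \<odot> p \<odot> qcnj h"
      by (simp only: pa[symmetric])
    ultimately show ?thesis
      using that by (simp add: qcnj_qmul qmul_assoc)
  qed
  have "radial_part A p v = (1 / 4) *\<^sub>R ?L (qcnj a \<odot> v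
      + T_su2 1 \<odot> (qcnj a \<odot> v) \<odot> qcnj (T_su2 1) + T_su2 2 \<odot> (qcnj a \<odot> v) \<odot> qcnj (T_su2 2)
      + T_su2 3 \<odot> (qcnj a \<odot> v) \<odot> qcnj (T_su2 3))"
    unfolding radial_part_def h[OF T_su2_simps(3)] linear_add[OF lin]
    using h[of qone] by simp
  also have "\<dots> = fst (qcnj a \<odot> v) *\<^sub>R radial_coef A ?t"
    unfolding sum_conj_T_su2 by (simp only: linear_scale[OF lin] radial_coef_def) simp
  also have "fst (qcnj a \<odot> v) = p \<bullet> v / ?t"
    using su2_inner_SU2[OF a, of "qcnj a \<odot> v"] a by (simp add: a_def divide_inverse mult.commute)
  finally show ?thesis .
qed

lemma radial_part_0:
  assumes "connection_on R A" "left_invariant_on R A" "0 < R"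
  shows "radial_part A 0 v = 0"
  using connection_singular_orbit[OF assms] by (simp add: radial_part_def qmul.zero_left qmul.zero_right)

lemma radial_part_linear:
  assumes "connection_on R A" "ereal (norm p) < R"
  shows "linear (radial_part A p)"
proof -
  have "linear (\<lambda>v. A (h \<odot> p \<odot> qcnj h, qone) (h \<odot> v \<odot> qcnj h, 0))" if "h \<in> SU2" for h
  proof -
    have "linear (A (h \<odot> p \<odot> qcnj h, qone))"
      using assms that by (intro connection_linear[OF assms(1)]) (simp add: tube_def norm_qmul norm_SU2)
    moreover have "linear (\<lambda>v. (h \<odot> v \<odot> qcnj h, 0 :: quat))"
      by (intro bounded_linear.linear bounded_linear_Pair bounded_linear_qmul_both bounded_linear_zero)
    ultimately show ?thesis
      using linear_compose by (fastforce simp: o_def)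
  qed
  from this[of qone] this[OF T_su2_simps(3)] show ?thesis
    unfolding radial_part_def by (intro linear_compose_scale_right linear_compose_add) simp_all
qed

lemma radial_part_su2:
  assumes "connection_on R A" "ereal (norm p) < R"
  shows "radial_part A p v \<in> su2"
proof -
  have "A (h \<odot> p \<odot> qcnj h, qone) w \<in> su2" if "h \<in> SU2" for h w
  proof -
    have "(h \<odot> p \<odot> qcnj h, qone) \<in> tube R"
      using assms that by (simp add: tube_def norm_qmul norm_SU2)
    then show ?thesis
      using assms(1) unfolding connection_on_def one_form_on_def by blast
  qed
  from this[of qone] this[OF T_su2_simps(3)] show ?thesis
    unfolding radial_part_def
    by (intro subspace_scale[OF subspace_su2] subspace_add[OF subspace_su2]) simp_all
qed

lemma smooth_map_on_const: "smooth_map_on S (\<lambda>x. c)"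
  by (rule smooth_map_onI[OF open_UNIV]) simp_all

lemma radial_part_smooth:
  assumes "connection_on R A"
  shows "smooth_map_on {p. ereal (norm p) < R} (\<lambda>p. radial_part A p v)"
proof -
  have "smooth_map_on {p. ereal (norm p) < R} (\<lambda>p. A (h \<odot> p \<odot> qcnj h, qone) w)" if "h \<in> SU2" for h w
  proof (rule smooth_map_on_compose[where T = "tube R" and g = "\<lambda>m. A m w"])
    show "smooth_map_on (tube R) (\<lambda>m. A m w)"
      using assms unfolding connection_on_def one_form_on_def by blast
    show "Ck_on k UNIV (\<lambda>p. (h \<odot> p \<odot> qcnj h, qone))" for k
      by (intro Ck_on_Pair Ck_on_const Ck_on_bounded_linear bounded_linear_qmul_both open_UNIV)
    show "(\<lambda>p. (h \<odot> p \<odot> qcnj h, qone)) ` {p. ereal (norm p) < R} \<subseteq> tube R"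
      using that by (auto simp: tube_def norm_qmul norm_SU2 simp del: scaleR_Pair)
  qed
  from this[of qone] this[OF T_su2_simps(3)] show ?thesis
    unfolding radial_part_def
    by (intro smooth_map_on_bilinear[OF bounded_bilinear_scaleR] smooth_map_on_const smooth_map_on_add) simp_all
qed

lemma su2_qmul_orthogonal:
  assumes "a \<in> su2"
  shows "g \<bullet> (a \<odot> g) = 0"
proof -
  have "(a \<odot> g) \<bullet> g = fst (a \<odot> (g \<odot> qcnj g))"
    by (simp flip: fst_qmul_qcnj qmul_assoc)
  also have "\<dots> = 0"
    using assms by (simp add: qmul_qcnj qmul.scaleR_right su2_def)
  finally show ?thesis by (simp add: inner_commute)
qed

text \<open>Parallel transport along the ray, extended radially. The equation of the ray becomes DG
  = - (radial part) G on the ball, which bootstraps smoothness of G from that of the radial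
  part.\<close>

lemma temporal_gauge:
  assumes conn: "connection_on R A" and inv: "left_invariant_on R A" and "0 < R"
  obtains g where "\<forall>t. 0 \<le> t \<and> ereal t < R \<longrightarrow> g t \<in> SU2"
    "\<forall>t. 0 < t \<and> ereal t < R \<longrightarrow> (g has_vector_derivative - (radial_coef A t \<odot> g t)) (at t)"
    "\<forall>p::quat. ereal (norm p) < R \<longrightarrow>
      ((\<lambda>p. g (norm p)) has_derivative (\<lambda>v. - (radial_part A p v \<odot> g (norm p)))) (at p)"
    "\<forall>k. Ck_on k {p::quat. ereal (norm p) < R} (\<lambda>p. g (norm p))"
proof -
  let ?S = "{t. 0 \<le> t \<and> ereal t < R}" and ?a = "radial_coef A" and ?U = "{p::quat. ereal (norm p) < R}"
  have R0: "ereal 0 < R" using assms(3) by (simp add: zero_ereal_def)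
  have "continuous_on ?S (\<lambda>t. - ?a t)"
    unfolding radial_coef_def using radial_ray_continuous[OF conn] by (rule continuous_on_minus)
  then obtain g where g0: "g 0 = qone"
    and g': "\<forall>t. 0 \<le> t \<and> ereal t < R \<longrightarrow> (g has_vector_derivative - ?a t \<odot> g t) (at t within {0..})"
    by (rule linear_ode_exists)
  have dg: "(g has_vector_derivative - (?a t \<odot> g t)) (at t within {0..})" if "t \<in> ?S" for t
    using g' that by (simp add: qmul.minus_left)
  have a_su2: "?a t \<in> su2" if "t \<in> ?S" for t
    using conn ray_tube[of t R] that unfolding connection_on_def one_form_on_def radial_coef_def by blast
  have "convex ?S"
    by (rule convex_ray)
  moreover have "((\<lambda>t. g t \<bullet> g t) has_vector_derivative 0) (at t within ?S)" if "t \<in> ?S" for t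
  proof -
    have "((\<lambda>t. g t \<bullet> g t) has_vector_derivative g t \<bullet> - (?a t \<odot> g t) + - (?a t \<odot> g t) \<bullet> g t) (at t within {0..})"
      by (rule bounded_bilinear.has_vector_derivative[OF bounded_bilinear_inner dg[OF that] dg[OF that]])
    then have "((\<lambda>t. g t \<bullet> g t) has_vector_derivative 0) (at t within {0..})"
      using su2_qmul_orthogonal[OF a_su2[OF that], of "g t"] by (simp add: inner_commute)
    then show ?thesis
      by (rule has_vector_derivative_within_subset) auto
  qed
  ultimately obtain C where C: "\<And>t. t \<in> ?S \<Longrightarrow> g t \<bullet> g t = C"
    using has_vector_derivative_zero_constant by blast
  have "C = 1"
    using C[of 0] R0 g0 by (simp add: dot_square_norm)
  then have g_SU2: "g t \<in> SU2" if "t \<in> ?S" for t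
    using C[OF that] by (simp add: SU2_def norm_eq_1)
  have dg_at: "(g has_vector_derivative - (?a t \<odot> g t)) (at t)" if "0 < t" "ereal t < R" for t
  proof -
    have "at t within {0..} = at t" using that by (intro at_within_interior) simp
    then show ?thesis using dg[of t] that by simp
  qed
  \<comment> \<open>At the origin both sides vanish, because the connection vanishes on the fibre
    direction there.\<close>
  have dG: "((\<lambda>p. g (norm p)) has_derivative (\<lambda>v. - (radial_part A p v \<odot> g (norm p)))) (at p)" if p: "p \<in> ?U" for p
  proof (cases "p = 0")
    case True
    have "?a 0 = 0" using connection_singular_orbit[OF assms] by (simp add: radial_coef_def)
    then have "(g has_vector_derivative 0) (at 0 within {0..})"
      using dg[of 0] R0 by (simp add: qmul.zero_left)
    from radial_has_derivative_0[OF this] show ?thesis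
      by (simp add: True radial_part_0[OF assms] qmul.zero_left)
  next
    case False
    from radial_has_derivative[OF dg_at False] p False show ?thesis
      by (simp add: radial_part_eq[OF conn inv] qmul.scaleR_left)
  qed
  have "Ck_on k ?U (\<lambda>p. g (norm p))" for k
  proof (induction k)
    case 0
    show ?case
      by (auto intro!: continuous_at_imp_continuous_on has_derivative_continuous[OF dG])
  next
    case (Suc k)
    have "Ck_on k ?U (\<lambda>p. - (radial_part A p v \<odot> g (norm p)))" for v
      by (intro Ck_on_linear_compose[OF open_norm_less bounded_linear_minus[OF bounded_linear_ident]]
          Ck_on_bilinear[OF open_norm_less bounded_bilinear_qmul] Suc
          smooth_map_on_open[OF open_norm_less radial_part_smooth[OF conn]])
    then show ?case
      by (intro Ck_on_SucI[OF open_norm_less dG])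
  qed
  then show thesis
    using g_SU2 dg_at dG by (intro that[of g]) auto
qed

section \<open>The action of the isotropy group\<close>

text \<open>The diagonal fixes the ray pointwise, so (h, h, h) moves the fibre over (t, 1) by left
  multiplication with this element.\<close>

definition isotropy :: "(quat \<times> quat \<times> quat \<Rightarrow> (quat \<times> quat) \<times> quat \<Rightarrow> (quat \<times> quat) \<times> quat)
    \<Rightarrow> quat \<Rightarrow> real \<Rightarrow> quat"
  where "isotropy \<Phi> h t = snd (\<Phi> (h, h, h) ((t *\<^sub>R qone, qone), qone))"

lemma act_diag_ray: "h \<in> SU2 \<Longrightarrow> act (h, h, h) (t *\<^sub>R qone, qone) = (t *\<^sub>R qone, qone)"
  by (simp add: act_def qmul.scaleR_left qmul.scaleR_right)

lemma isotropy_SU2: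
  assumes "lift_on R \<Phi>" "h \<in> SU2" "0 \<le> t" "ereal t < R"
  shows "isotropy \<Phi> h t \<in> SU2"
    and "\<Phi> (h, h, h) ((t *\<^sub>R qone, qone), qone) = ((t *\<^sub>R qone, qone), isotropy \<Phi> h t)"
proof -
  let ?z = "((t *\<^sub>R qone, qone), qone)"
  have "?z \<in> P1 R" "(h, h, h) \<in> SU2_3"
    using assms ray_tube by (auto simp: P1_def SU2_3_def)
  then have "\<Phi> (h, h, h) ?z \<in> P1 R" "fst (\<Phi> (h, h, h) ?z) = act (h, h, h) (fst ?z)"
    using assms(1) unfolding lift_on_def by blast+
  then show "isotropy \<Phi> h t \<in> SU2" "\<Phi> (h, h, h) ?z = ((t *\<^sub>R qone, qone), isotropy \<Phi> h t)"
    using act_diag_ray[OF assms(2)] by (auto simp: isotropy_def P1_def prod_eq_iff)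
qed

lemma vector_derivative_shift:
  assumes "((\<lambda>s. f (t + s)) has_vector_derivative d) (at 0)"
  shows "(f has_vector_derivative d) (at (t::real))"
proof -
  have "((\<lambda>s. s - t) has_vector_derivative 1) (at t)"
    by (auto intro!: derivative_eq_intros)
  from vector_diff_chain_at[OF this, of "\<lambda>s. f (t + s)" d] assms show ?thesis
    by (simp add: o_def)
qed

lemma ray_curve:
  assumes "0 < t" "ereal t < R"
  shows "\<forall>\<^sub>F s in at (0::real). ((t + s) *\<^sub>R qone, qone) \<in> tube R"
    and "((\<lambda>s. ((t + s) *\<^sub>R qone, qone)) has_vector_derivative (qone, 0)) (at 0)"
proof -
  show "\<forall>\<^sub>F s in at (0::real). ((t + s) *\<^sub>R qone, qone) \<in> tube R"
    using eventually_cyl[OF assms, of 1] by (rule eventually_mono) (simp add: ray_tube)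
  show "((\<lambda>s. ((t + s) *\<^sub>R qone, qone)) has_vector_derivative (qone, 0)) (at 0)"
    by (intro has_vector_derivative_Pair) (auto intro!: derivative_eq_intros)
qed

lemma ray_differentiable:
  assumes conn: "connection_on R A" and t: "0 < t" "ereal t < R"
  obtains d where "((\<lambda>s. A (s *\<^sub>R qone, qone) v) has_vector_derivative d) (at t)"
proof -
  note m = ray_tube[OF less_imp_le[OF t(1)] t(2)]
  have "(\<lambda>m. A m v) differentiable (at (t *\<^sub>R qone, qone) within tube R)"
    using conn m unfolding connection_on_def one_form_on_def by (blast intro: smooth_map_on_differentiable)
  from differential_on_along_curve[OF this m _ ray_curve[OF t]] show thesis
    by (intro that[OF vector_derivative_shift]) simp
qed

text \<open>Comparing the connection forms along the ray gives l^-1 a l + l^-1 l' = a for the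
  isotropy element l: it is parallel with respect to the connection.\<close>

lemma isotropy_deriv:
  assumes \<Phi>: "lift_on R \<Phi>" and pb: "\<And>h. h \<in> SU2_3 \<Longrightarrow> pulls_back R (\<Phi> h) A A"
    and h: "h \<in> SU2" and t: "0 < t" "ereal t < R"
  shows "(isotropy \<Phi> h has_vector_derivative
    isotropy \<Phi> h t \<odot> radial_coef A t - radial_coef A t \<odot> isotropy \<Phi> h t) (at t)"
proof -
  let ?h = "(h, h, h)" and ?m = "(t *\<^sub>R qone, qone)" and ?\<gamma> = "\<lambda>s. ((t + s) *\<^sub>R qone, qone)"
  let ?l = "isotropy \<Phi> h t" and ?a = "radial_coef A t"
  note m = ray_tube[OF less_imp_le[OF t(1)] t(2)] and c = ray_curve[OF t]
  have h3: "?h \<in> SU2_3" using h by (simp add: SU2_3_def)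
  have z: "(?m, qone) \<in> P1 R" using m by (simp add: P1_def)
  have diff: "\<Phi> ?h differentiable (at (?m, qone) within P1 R)"
    by (rule smooth_map_on_differentiable[OF lift_smooth[OF \<Phi> h3] z])
  have "((\<lambda>s. \<Phi> ?h (?\<gamma> s, qone)) has_vector_derivative differential_on (P1 R) (\<Phi> ?h) (?m, qone) ((qone, 0), 0)) (at 0)"
    using c by (intro differential_on_along_curve[OF diff z])
      (auto simp: P1_def intro!: has_vector_derivative_Pair)
  then obtain D where D: "((\<lambda>s. \<Phi> ?h (?\<gamma> s, qone)) has_vector_derivative D) (at 0)"
    by blast
  have \<Phi>_ray: "\<Phi> ?h (?\<gamma> s, qone) = (?\<gamma> s, isotropy \<Phi> h (t + s))" if "0 < t + s" "ereal (t + s) < R" for s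
    using isotropy_SU2(2)[OF \<Phi> h less_imp_le[OF that(1)] that(2)] .
  have ev: "\<forall>\<^sub>F s in at (0::real). 0 < t + s \<and> ereal (t + s) < R"
    using eventually_cyl[OF t, of 1] by simp
  have "((\<lambda>s. (?\<gamma> s, isotropy \<Phi> h (t + s))) has_vector_derivative D) (at 0)"
    using D unfolding has_vector_derivative_def
  proof (rule has_derivative_transform_eventually)
    show "\<forall>\<^sub>F s in at 0. \<Phi> ?h (?\<gamma> s, qone) = (?\<gamma> s, isotropy \<Phi> h (t + s))"
      using ev by (rule eventually_mono) (simp add: \<Phi>_ray)
    show "\<Phi> ?h (?\<gamma> 0, qone) = (?\<gamma> 0, isotropy \<Phi> h (t + 0))"
      using \<Phi>_ray[of 0] t by simp
  qed simp
  note D' = bounded_linear.has_vector_derivative[OF bounded_linear_fst this]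
    bounded_linear.has_vector_derivative[OF bounded_linear_snd this]
  have "fst D = (qone, 0)"
    using vector_derivative_unique_at[OF D'(1)[unfolded fst_conv] c(2)] .
  moreover have "conn_form A (\<Phi> ?h (?m, qone)) D = conn_form A (?m, qone) ((qone, 0), 0)"
    by (rule pulls_back_along_curve[OF pb[OF h3] diff m _ _ c]) (use D in simp_all)
  ultimately have "qcnj ?l \<odot> ?a \<odot> ?l + qcnj ?l \<odot> snd D = ?a"
    using isotropy_SU2(2)[OF \<Phi> h less_imp_le[OF t(1)] t(2)]
    by (cases D) (simp add: conn_form_def radial_coef_def qmul.zero_right)
  then have "?l \<odot> (qcnj ?l \<odot> ?a \<odot> ?l + qcnj ?l \<odot> snd D) = ?l \<odot> ?a"
    by simp
  then have "?a \<odot> ?l + snd D = ?l \<odot> ?a"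
    using isotropy_SU2(1)[OF \<Phi> h less_imp_le[OF t(1)] t(2)] by (simp add: qmul.add_right qmul_assoc)
  then have "snd D = ?l \<odot> ?a - ?a \<odot> ?l"
    by (simp add: eq_diff_eq add.commute)
  then show ?thesis
    using vector_derivative_shift[OF D'(2)[unfolded snd_conv]] by simp
qed

text \<open>Along a curve in the orbit the fibre coordinate of the lift stays constant, so
  invariance of the connection has no Maurer-Cartan term and reduces to conjugation by the isotropy
  element.\<close>

lemma isotropy_equivariant:
  assumes \<Phi>: "lift_on R \<Phi>" and pb: "\<And>h. h \<in> SU2_3 \<Longrightarrow> pulls_back R (\<Phi> h) A A"
    and h: "h \<in> SU2" and t: "0 < t" "ereal t < R" and u: "u \<in> su2" "w \<in> su2"
  shows "A (t *\<^sub>R qone, qone) (t *\<^sub>R (h \<odot> u \<odot> qcnj h), h \<odot> (u - w) \<odot> qcnj h)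
    = isotropy \<Phi> h t \<odot> A (t *\<^sub>R qone, qone) (t *\<^sub>R u, u - w) \<odot> qcnj (isotropy \<Phi> h t)"
proof -
  let ?h = "(h, h, h)" and ?m = "(t *\<^sub>R qone, qone)" and ?l = "isotropy \<Phi> h t"
  note m = ray_tube[OF less_imp_le[OF t(1)] t(2)]
  have n: "(t, qone, qone) \<in> cyl R" using t by (simp add: cyl_def)
  have h3: "?h \<in> SU2_3" using h by (simp add: SU2_3_def)
  have z: "(?m, qone) \<in> P1 R" using m by (simp add: P1_def)
  have l: "?l \<in> SU2" "\<Phi> ?h (?m, qone) = (?m, ?l)"
    using isotropy_SU2[OF \<Phi> h less_imp_le[OF t(1)] t(2)] by simp_all
  have \<Phi>_2: "\<Phi> (a, b, qone) y = P1_act2 a b y" if "a \<in> SU2" "b \<in> SU2" "y \<in> P1 R" for a b y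
    using \<Phi> that unfolding lift_on_def by blast
  have \<Phi>_mul: "\<Phi> (mul3 k k') y = \<Phi> k (\<Phi> k' y)" if "k \<in> SU2_3" "k' \<in> SU2_3" "y \<in> P1 R" for k k' y
    using \<Phi> that unfolding lift_on_def by blast
  \<comment> \<open>The relation (h, h, h) (a, b, 1) = (h a h^-1, h b h^-1, 1) (h, h, h) carries the
    fibre coordinate from the ray to the whole orbit, as the left factor acts trivially on
    fibres.\<close>
  have orbit: "\<Phi> ?h (emb (t, a, b), qone) = (act ?h (emb (t, a, b)), ?l)" if ab: "a \<in> SU2" "b \<in> SU2" for a b
  proof -
    have emb: "emb (t, a, b) = act (a, b, qone) ?m"
      by (simp add: emb_def act_def qmul.scaleR_right)
    have k: "(a, b, qone) \<in> SU2_3" "(h \<odot> a \<odot> qcnj h, h \<odot> b \<odot> qcnj h, qone) \<in> SU2_3"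
      using ab h by (simp_all add: SU2_3_def)
    have "\<Phi> ?h (emb (t, a, b), qone) = \<Phi> ?h (\<Phi> (a, b, qone) (?m, qone))"
      using \<Phi>_2[OF ab z] by (simp add: P1_act2_def emb)
    also have "\<dots> = \<Phi> (mul3 ?h (a, b, qone)) (?m, qone)"
      using \<Phi>_mul[OF h3 k(1) z] by simp
    also have "mul3 ?h (a, b, qone) = mul3 (h \<odot> a \<odot> qcnj h, h \<odot> b \<odot> qcnj h, qone) ?h"
      using h by (simp add: mul3_def qmul_assoc)
    also have "\<Phi> \<dots> (?m, qone) = \<Phi> (h \<odot> a \<odot> qcnj h, h \<odot> b \<odot> qcnj h, qone) (?m, ?l)"
      using \<Phi>_mul[OF k(2) h3 z] l by simp
    also have "\<dots> = (act (h \<odot> a \<odot> qcnj h, h \<odot> b \<odot> qcnj h, qone) ?m, ?l)"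
      using \<Phi>_2[of "h \<odot> a \<odot> qcnj h" "h \<odot> b \<odot> qcnj h" "(?m, ?l)"] ab h l m by (simp add: P1_act2_def P1_def)
    also have "act (h \<odot> a \<odot> qcnj h, h \<odot> b \<odot> qcnj h, qone) ?m = act ?h (emb (t, a, b))"
      using h by (simp add: emb_def act_def qmul_assoc qcnj_qmul qmul.scaleR_right qmul.scaleR_left)
    finally show ?thesis .
  qed
  have diff: "\<Phi> ?h differentiable (at (?m, qone) within P1 R)"
    by (rule smooth_map_on_differentiable[OF lift_smooth[OF \<Phi> h3] z])
  obtain c where c: "c 0 = qone" "\<forall>s::real. c s \<in> SU2" "(c has_vector_derivative u) (at 0)"
    by (rule SU2_curve[OF u(1)])
  obtain d where d: "d 0 = qone" "\<forall>s::real. d s \<in> SU2" "(d has_vector_derivative w) (at 0)"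
    by (rule SU2_curve[OF u(2)])
  let ?\<gamma> = "\<lambda>s. emb (t, c s, d s)"
  have "((\<lambda>s. (t, c s, d s)) has_vector_derivative (0, u, w)) (at 0)"
    by (intro has_vector_derivative_Pair c d has_vector_derivative_const)
  from has_derivative_along_curve[OF emb_has_derivative[of qone t qone] UNIV_I _ _ this]
  have "(?\<gamma> has_vector_derivative emb_diff (t, qone, qone) (0, u, w)) (at 0)"
    using c(1) d(1) by (simp only: emb_diff case_prod_conv) simp
  then have \<gamma>: "(?\<gamma> has_vector_derivative (t *\<^sub>R u, u - w)) (at 0)"
    using emb_diff_left_invariant[OF u(2), of t qone qone 0 u] by simp
  have \<gamma>0: "?\<gamma> 0 = ?m" using c(1) d(1) by (simp add: emb_def)
  have \<gamma>_tube: "\<forall>\<^sub>F s in at 0. ?\<gamma> s \<in> tube R"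
    using t c(2) d(2) by (intro always_eventually allI emb_in_tube) (simp add: cyl_def)
  have "((\<lambda>s. (act ?h (?\<gamma> s), ?l)) has_vector_derivative (act ?h (t *\<^sub>R u, u - w), 0)) (at 0)"
    by (intro has_vector_derivative_Pair bounded_linear.has_vector_derivative[OF bounded_linear_act] \<gamma>) simp
  then have \<Phi>\<gamma>: "((\<lambda>s. \<Phi> ?h (?\<gamma> s, qone)) has_vector_derivative (act ?h (t *\<^sub>R u, u - w), 0)) (at 0)"
    using c(2) d(2) by (simp add: orbit)
  have "conn_form A (\<Phi> ?h (?m, qone)) (act ?h (t *\<^sub>R u, u - w), 0) = conn_form A (?m, qone) ((t *\<^sub>R u, u - w), 0)"
    by (rule pulls_back_along_curve[OF pb[OF h3] diff m _ \<gamma>0 \<gamma>_tube \<gamma> \<Phi>\<gamma>]) simp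
  then have "qcnj ?l \<odot> A ?m (act ?h (t *\<^sub>R u, u - w)) \<odot> ?l = A ?m (t *\<^sub>R u, u - w)"
    by (simp add: conn_form_def l qmul.zero_right)
  then have "?l \<odot> (qcnj ?l \<odot> A ?m (act ?h (t *\<^sub>R u, u - w)) \<odot> ?l) \<odot> qcnj ?l = ?l \<odot> A ?m (t *\<^sub>R u, u - w) \<odot> qcnj ?l"
    by simp
  then show ?thesis
    using l(1) by (simp add: qmul_assoc) (simp add: act_def qmul.scaleR_left qmul.scaleR_right qmul_assoc)
qed

section \<open>Classification\<close>

text \<open>The equation l' = l a - a l is the parallel transport equation for endomorphisms;
  conjugating by the transport g makes its solutions constant.\<close>

lemma gauged_isotropy_const:
  assumes l: "(l has_vector_derivative l t \<odot> a - a \<odot> l t) (at t)"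
    and g: "(g has_vector_derivative - (a \<odot> g t)) (at t)" and "a \<in> su2"
  shows "((\<lambda>t. qcnj (g t) \<odot> l t \<odot> g t) has_vector_derivative 0) (at t)"
proof -
  have "((\<lambda>t. qcnj (g t) \<odot> l t \<odot> g t) has_vector_derivative
      qcnj (g t) \<odot> l t \<odot> - (a \<odot> g t) + (qcnj (g t) \<odot> (l t \<odot> a - a \<odot> l t) + qcnj (- (a \<odot> g t)) \<odot> l t) \<odot> g t) (at t)"
    by (intro qmul_vector_derivative qcnj_vector_derivative l g)
  moreover have "qcnj (g t) \<odot> l t \<odot> - (a \<odot> g t) + (qcnj (g t) \<odot> (l t \<odot> a - a \<odot> l t) + qcnj (- (a \<odot> g t)) \<odot> l t) \<odot> g t = 0"
    using assms(3) unfolding su2_iff_qcnj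
    by (simp add: qcnj_linear qcnj_qmul qmul.minus_left qmul.minus_right qmul.add_left qmul.diff_left
        qmul.diff_right qmul_assoc)
  ultimately show ?thesis by simp
qed

lemma at_right_0_ray:
  fixes f :: "real \<Rightarrow> 'a::topological_space"
  assumes "continuous_on {s. 0 \<le> s \<and> ereal s < R} f" "0 < R"
  shows "(f \<longlongrightarrow> f 0) (at_right 0)"
proof -
  obtain r where r: "0 < ereal r" "ereal r < R"
    using ereal_dense2[OF assms(2)] by blast
  then have "{0..r} \<subseteq> {s. 0 \<le> s \<and> ereal s < R}"
    by (auto intro: le_less_trans[OF ereal_less_eq(3)[THEN iffD2]])
  then have "continuous_on {0..r} f"
    by (rule continuous_on_subset[OF assms(1)])
  then have "(f \<longlongrightarrow> f 0) (at 0 within {0..r})"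
    using r unfolding continuous_on_def by (rule_tac bspec) (auto simp: zero_ereal_def)
  then show ?thesis
    using r by (simp add: at_within_Icc_at_right zero_ereal_def)
qed

text \<open>The rotation c and the parameter x_1 must be the same for all t. The isotropy elements,
  once gauged, do not depend on t, so a single application of the twisted Schur lemma treats all
  times together.\<close>

lemma instanton_normal_form:
  assumes R: "0 < R" and conn: "connection_on R A" and inv3: "SU2_3_invariant R A" and G2: "G2_instanton R A"
    and g_SU2: "\<forall>t. 0 \<le> t \<and> ereal t < R \<longrightarrow> g t \<in> SU2"
    and dg: "\<forall>t. 0 < t \<and> ereal t < R \<longrightarrow> (g has_vector_derivative - (radial_coef A t \<odot> g t)) (at t)"
  obtains c x1 where "c \<in> SU2" "\<forall>t. 0 < t \<and> ereal t < R \<longrightarrow> clarke_denom x1 t \<noteq> 0"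
    "\<forall>t \<tau> u w. 0 < t \<and> ereal t < R \<and> u \<in> su2 \<and> w \<in> su2 \<longrightarrow>
      A (t *\<^sub>R qone, qone) (\<tau> *\<^sub>R qone + t *\<^sub>R u, u - w) = \<tau> *\<^sub>R radial_coef A t
        + (g t \<odot> c) \<odot> ((bs_A t * clarke_x x1 t) *\<^sub>R ((1 / 2) *\<^sub>R (u + w))) \<odot> qcnj (g t \<odot> c)"
proof -
  let ?S = "{t. 0 < t \<and> ereal t < R}" and ?a = "radial_coef A" and ?m = "\<lambda>t. (t *\<^sub>R qone, qone)"
  note inv = SU2_3_invariant_left_invariant[OF inv3]
  obtain \<Phi> where \<Phi>: "lift_on R \<Phi>" and pb: "\<And>h. h \<in> SU2_3 \<Longrightarrow> pulls_back R (\<Phi> h) A A"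
    using inv3 unfolding SU2_3_invariant_def by blast
  have gS: "g t \<in> SU2" and g': "(g has_vector_derivative - (?a t \<odot> g t)) (at t)" if "t \<in> ?S" for t
    using g_SU2 dg that by auto
  have lin: "linear (A (?m t))" if "t \<in> ?S" for t
    using that by (intro connection_linear[OF conn] ray_tube) auto
  have A_su2: "A (?m t) v \<in> su2" if "t \<in> ?S" for t v
    using conn ray_tube[of t R] that unfolding connection_on_def one_form_on_def by fastforce
  have a_su2: "?a t \<in> su2" if "t \<in> ?S" for t
    using A_su2[OF that] by (simp add: radial_coef_def)

  have conv: "convex ?S"
    by (rule convex_ray)
  have "\<exists>k. \<forall>t\<in>?S. qcnj (g t) \<odot> isotropy \<Phi> h t \<odot> g t = k" if h: "h \<in> SU2" for h
  proof (rule has_vector_derivative_zero_constant[OF conv, of "\<lambda>t. qcnj (g t) \<odot> isotropy \<Phi> h t \<odot> g t"])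
    fix t assume t: "t \<in> ?S"
    then have "((\<lambda>t. qcnj (g t) \<odot> isotropy \<Phi> h t \<odot> g t) has_vector_derivative 0) (at t)"
      by (intro gauged_isotropy_const[OF _ g' a_su2] isotropy_deriv[OF \<Phi> pb h]) auto
    then show "((\<lambda>t. qcnj (g t) \<odot> isotropy \<Phi> h t \<odot> g t) has_vector_derivative 0) (at t within ?S)"
      by (rule has_vector_derivative_at_within)
  qed blast
  then obtain \<mu> where \<mu>: "\<And>h t. h \<in> SU2 \<Longrightarrow> t \<in> ?S \<Longrightarrow> qcnj (g t) \<odot> isotropy \<Phi> h t \<odot> g t = \<mu> h"
    by metis
  obtain t1 where t1: "t1 \<in> ?S"
    using ereal_dense2[OF R] by (auto simp: zero_ereal_def)
  have \<mu>_SU2: "\<mu> h \<in> SU2" if "h \<in> SU2" for h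
    using \<mu>[OF that t1] isotropy_SU2(1)[OF \<Phi> that, of t1] gS[OF t1] t1 by (auto simp flip: \<mu>[OF that t1])
  have iso: "isotropy \<Phi> h t = g t \<odot> \<mu> h \<odot> qcnj (g t)" if "h \<in> SU2" "t \<in> ?S" for h t
    using gS[OF that(2)] by (simp add: qmul_assoc flip: \<mu>[OF that])

  \<comment> \<open>The index (t, True) stands for the diagonal directions (x, x), whose image at
    the ray is (t x, 0), and (t, False) for the antidiagonal ones (x, - x), whose image is (t x, 2
    x).\<close>
  define M where "M i x = (case i of (t, b) \<Rightarrow>
      qcnj (g t) \<odot> A (?m t) (t *\<^sub>R x, if b then 0 else 2 *\<^sub>R x) \<odot> g t)" for i and x :: quat
  let ?I = "?S \<times> (UNIV :: bool set)"
  have M_lin: "linear (M i)" if i: "i \<in> ?I" for i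
  proof -
    obtain t b where ib: "i = (t, b)" "t \<in> ?S" using i by auto
    have "linear (\<lambda>x::quat. (t *\<^sub>R x, if b then 0 else 2 *\<^sub>R x))"
      by (rule linearI) (auto simp: algebra_simps)
    from linear_compose[OF this lin[OF ib(2)]]
    have "linear (\<lambda>x. A (?m t) (t *\<^sub>R x, if b then 0 else 2 *\<^sub>R x))"
      by (simp add: o_def)
    moreover have "linear (\<lambda>x. qcnj (g t) \<odot> x \<odot> g t)"
      by (rule bounded_linear.linear[OF bounded_linear_qmul_both])
    ultimately have "linear ((\<lambda>x. qcnj (g t) \<odot> x \<odot> g t) \<circ> (\<lambda>x. A (?m t) (t *\<^sub>R x, if b then 0 else 2 *\<^sub>R x)))"
      by (rule linear_compose)
    then show ?thesis by (simp add: M_def[abs_def] ib(1) o_def)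
  qed
  have M_su2: "M i x \<in> su2" if i: "i \<in> ?I" for i x
  proof -
    obtain t b where ib: "i = (t, b)" "t \<in> ?S" using i by auto
    show ?thesis
      using su2_conj[OF A_su2[OF ib(2)], of "qcnj (g t)"] by (simp only: M_def ib(1) case_prod_conv qcnj_qcnj)
  qed
  have M_equiv: "M i (h \<odot> x \<odot> qcnj h) = \<mu> h \<odot> M i x \<odot> qcnj (\<mu> h)"
    if i: "i \<in> ?I" and h: "h \<in> SU2" and x: "x \<in> su2" for i h x
  proof -
    obtain t b where ib: "i = (t, b)" "t \<in> ?S" using i by auto
    then have t: "0 < t" "ereal t < R" by auto
    let ?w = "if b then x else - x"
    have w: "?w \<in> su2" using x by (simp add: su2_def)
    have "A (?m t) (t *\<^sub>R (h \<odot> x \<odot> qcnj h), h \<odot> (x - ?w) \<odot> qcnj h)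
        = isotropy \<Phi> h t \<odot> A (?m t) (t *\<^sub>R x, x - ?w) \<odot> qcnj (isotropy \<Phi> h t)"
      by (rule isotropy_equivariant[OF \<Phi> pb h t x w])
    moreover have "x - ?w = (if b then 0 else 2 *\<^sub>R x)" by (simp add: scaleR_2)
    moreover have "h \<odot> (x - ?w) \<odot> qcnj h = (if b then 0 else 2 *\<^sub>R (h \<odot> x \<odot> qcnj h))"
      by (simp add: scaleR_2 qmul.zero_left qmul.zero_right qmul.add_left qmul.add_right)
    ultimately have eq: "A (?m t) (t *\<^sub>R (h \<odot> x \<odot> qcnj h), if b then 0 else 2 *\<^sub>R (h \<odot> x \<odot> qcnj h))
        = isotropy \<Phi> h t \<odot> A (?m t) (t *\<^sub>R x, if b then 0 else 2 *\<^sub>R x) \<odot> qcnj (isotropy \<Phi> h t)"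
      by (simp only:)
    show ?thesis
      unfolding M_def ib(1) case_prod_conv eq iso[OF h ib(2)]
      using gS[OF ib(2)] by (simp add: qmul_assoc qcnj_qmul)
  qed
  obtain c where c: "c \<in> SU2" and Mc: "\<forall>i\<in>?I. \<exists>r. \<forall>x\<in>su2. M i x = r *\<^sub>R (c \<odot> x \<odot> qcnj c)"
    by (rule equivariant_maps_scalar[OF M_lin M_su2 \<mu>_SU2 M_equiv])
  define e where "e = c \<odot> T_su2 1 \<odot> qcnj c"
  have ee: "e \<bullet> e = 1" using inner_conj[OF c, of "T_su2 1" "T_su2 1"] by (simp add: e_def inner_T_su2)
  \<comment> \<open>Pairing with the unit vector e turns the scalars given by Schur's lemma into
    explicit functions of t, whose differentiability can be proved.\<close>
  define \<rho> where "\<rho> i = M i (T_su2 1) \<bullet> e" for i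
  have M_eq: "M i x = \<rho> i *\<^sub>R (c \<odot> x \<odot> qcnj c)" if i: "i \<in> ?I" and "x \<in> su2" for i x
  proof -
    obtain r where r: "\<forall>x\<in>su2. M i x = r *\<^sub>R (c \<odot> x \<odot> qcnj c)"
      using Mc i by blast
    then have "\<rho> i = r"
      using T_su2_simps(1)[of 1] by (simp add: \<rho>_def e_def[symmetric] ee)
    then show ?thesis using r that by simp
  qed
  let ?\<phi> = "\<lambda>t. \<rho> (t, True)" and ?\<theta> = "\<lambda>t. \<rho> (t, False)"

  have form: "A (?m t) (\<tau> *\<^sub>R qone + t *\<^sub>R u, u - w) = \<tau> *\<^sub>R ?a t
      + (g t \<odot> c) \<odot> (?\<phi> t *\<^sub>R ((1 / 2) *\<^sub>R (u + w)) + ?\<theta> t *\<^sub>R ((1 / 2) *\<^sub>R (u - w))) \<odot> qcnj (g t \<odot> c)"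
    if t: "0 < t" "ereal t < R" and u: "u \<in> su2" "w \<in> su2" for t \<tau> u w
  proof -
    have tS: "t \<in> ?S" using t by simp
    define E where "E = (1 / 2) *\<^sub>R (u + w)"
    define F where "F = (1 / 2) *\<^sub>R (u - w)"
    have EF: "E \<in> su2" "F \<in> su2" using u by (simp_all add: E_def F_def su2_def)
    have uEF: "u = E + F" "u - w = 2 *\<^sub>R F"
      unfolding E_def F_def by (simp_all flip: scaleR_add_right add: scaleR_2[symmetric])
    have recover: "A (?m t) (t *\<^sub>R x, if b then 0 else 2 *\<^sub>R x) = g t \<odot> M (t, b) x \<odot> qcnj (g t)" for b x
      using gS[OF tS] by (simp add: M_def qmul_assoc)
    have "(\<tau> *\<^sub>R qone + t *\<^sub>R u, u - w) = \<tau> *\<^sub>R (qone, 0) + ((t *\<^sub>R E, 0) + (t *\<^sub>R F, 2 *\<^sub>R F))"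
      unfolding uEF(2) by (simp add: uEF(1) scaleR_add_right)
    then have "A (?m t) (\<tau> *\<^sub>R qone + t *\<^sub>R u, u - w)
        = \<tau> *\<^sub>R ?a t + (A (?m t) (t *\<^sub>R E, 0) + A (?m t) (t *\<^sub>R F, 2 *\<^sub>R F))"
      by (simp only: linear_add[OF lin[OF tS]] linear_scale[OF lin[OF tS]] radial_coef_def)
    also have "A (?m t) (t *\<^sub>R E, 0) = g t \<odot> (?\<phi> t *\<^sub>R (c \<odot> E \<odot> qcnj c)) \<odot> qcnj (g t)"
      using recover[of E True] M_eq[of "(t, True)" E] tS EF by simp
    also have "A (?m t) (t *\<^sub>R F, 2 *\<^sub>R F) = g t \<odot> (?\<theta> t *\<^sub>R (c \<odot> F \<odot> qcnj c)) \<odot> qcnj (g t)"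
      using recover[of F False] M_eq[of "(t, False)" F] tS EF by simp
    finally show ?thesis
      unfolding E_def[symmetric] F_def[symmetric]
      by (simp add: qmul.add_left qmul.add_right qmul.scaleR_left qmul.scaleR_right qmul_assoc qcnj_qmul)
  qed

  have diff: "\<exists>p. ((\<lambda>t. \<rho> (t, b)) has_real_derivative p) (at t)" if tS: "t \<in> ?S" for t b
  proof -
    have t: "0 < t" "ereal t < R" using tS by auto
    let ?T = "T_su2 1" let ?w = "(0, if b then 0 else 2 *\<^sub>R ?T)"
    \<comment> \<open>Linearity separates the t-dependence of the argument from that of the form,
      leaving the form on fixed vectors.\<close>
    let ?B = "\<lambda>s. s *\<^sub>R A (?m s) (?T, 0) + A (?m s) ?w"
    obtain d1 where d1: "((\<lambda>s. A (?m s) (?T, 0)) has_vector_derivative d1) (at t)"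
      by (rule ray_differentiable[OF conn t])
    obtain d2 where d2: "((\<lambda>s. A (?m s) ?w) has_vector_derivative d2) (at t)"
      by (rule ray_differentiable[OF conn t])
    have "((\<lambda>s. s) has_real_derivative 1) (at t)" by simp
    note B = has_vector_derivative_add[OF has_vector_derivative_scaleR[OF this d1] d2]
    note D = bounded_linear.has_vector_derivative[OF bounded_linear_inner_left
        qmul_vector_derivative[OF qmul_vector_derivative[OF qcnj_vector_derivative[OF g'[OF tS]] B] g'[OF tS]], of e]
    obtain p where p: "((\<lambda>s. (qcnj (g s) \<odot> ?B s \<odot> g s) \<bullet> e) has_real_derivative p) (at t)"
      using D unfolding has_real_derivative_iff_has_vector_derivative by blast
    have eq: "(qcnj (g s) \<odot> ?B s \<odot> g s) \<bullet> e = \<rho> (s, b)" if "s \<in> ?S" for s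
    proof -
      have "?B s = A (?m s) (s *\<^sub>R (?T, 0) + ?w)"
        by (simp only: linear_add[OF lin[OF that]] linear_scale[OF lin[OF that]])
      also have "s *\<^sub>R (?T, 0) + ?w = (s *\<^sub>R ?T, if b then 0 else 2 *\<^sub>R ?T)" by simp
      finally show ?thesis by (simp add: \<rho>_def M_def)
    qed
    have "\<forall>\<^sub>F s in at t. s \<in> ?S"
    proof -
      have "\<forall>\<^sub>F s in at t. ereal (norm s) < R" "\<forall>\<^sub>F s in at t. 0 < s"
        using t eventually_norm_less[where \<gamma> = "\<lambda>s. s" and ?s0.0 = t and R = R]
          order_tendstoD(1)[OF tendsto_ident_at t(1)] by auto
      then show ?thesis by eventually_elim auto
    qed
    then have "\<forall>\<^sub>F s in at t. (qcnj (g s) \<odot> ?B s \<odot> g s) \<bullet> e = \<rho> (s, b)"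
      by (rule eventually_mono) (rule eq)
    with p have "((\<lambda>s. \<rho> (s, b)) has_real_derivative p) (at t)"
      unfolding has_field_derivative_def
      by (rule has_derivative_transform_eventually) (use eq[OF tS] in simp_all)
    then show ?thesis by blast
  qed
  have ode: "(?\<phi> has_real_derivative instanton_rhs t (?\<phi> t) (?\<theta> t)) (at t)"
    "(?\<theta> has_real_derivative 2 * (?\<phi> t - 1) * ?\<theta> t / bs_A t) (at t)" if t: "0 < t" "ereal t < R" for t
  proof -
    have tS: "t \<in> ?S" using t by simp
    obtain p where p: "(?\<phi> has_real_derivative p) (at t)" using diff[OF tS] by blast
    obtain q where q: "(?\<theta> has_real_derivative q) (at t)" using diff[OF tS] by blast
    obtain a' where a': "(?a has_vector_derivative a') (at t)"
      unfolding radial_coef_def[abs_def] by (rule ray_differentiable[OF conn t])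
    have gc: "g t \<odot> c \<in> SU2" using gS[OF tS] c by simp
    have dgc: "((\<lambda>s. g s \<odot> c) has_vector_derivative - (?a t \<odot> (g t \<odot> c))) (at t)"
      using bounded_linear.has_vector_derivative[OF qmul.bounded_linear_left g'[OF tS], of c]
      by (simp add: qmul.minus_left qmul_assoc)
    have "p = instanton_rhs t (?\<phi> t) (?\<theta> t) \<and> q = 2 * (?\<phi> t - 1) * ?\<theta> t / bs_A t"
      using ansatz_instanton_ode[OF conn inv t form gc dgc a_su2[OF tS] a' p q G2] by blast
    with p q show "(?\<phi> has_real_derivative instanton_rhs t (?\<phi> t) (?\<theta> t)) (at t)"
      "(?\<theta> has_real_derivative 2 * (?\<phi> t - 1) * ?\<theta> t / bs_A t) (at t)" by auto
  qed

  have e1: "norm e = 1" using ee by (simp add: norm_eq_1)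
  have \<rho>_le: "\<bar>\<rho> (t, b)\<bar> \<le> norm (A (?m t) (t *\<^sub>R T_su2 1, if b then 0 else 2 *\<^sub>R T_su2 1))" if tS: "t \<in> ?S" for t b
  proof -
    have "\<bar>\<rho> (t, b)\<bar> \<le> norm (M (t, b) (T_su2 1)) * norm e"
      unfolding \<rho>_def by (rule Cauchy_Schwarz_ineq2)
    then show ?thesis
      using gS[OF tS] by (simp add: e1 M_def norm_qmul norm_SU2)
  qed
  have S_ev: "\<forall>\<^sub>F s in at_right 0. s \<in> ?S"
    using eventually_ray[OF R] by simp
  have lim: "((\<lambda>t. norm (A (?m t) (t *\<^sub>R T_su2 1, x))) \<longlongrightarrow> norm (A (0, qone) (0, x))) (at_right 0)" for x
  proof -
    have cont: "continuous_on {s. 0 \<le> s \<and> ereal s < R} (\<lambda>s. norm (s *\<^sub>R A (?m s) (T_su2 1, 0) + A (?m s) (0, x)))"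
      by (intro continuous_intros radial_ray_continuous[OF conn])
    have eq: "s *\<^sub>R A (?m s) (T_su2 1, 0) + A (?m s) (0, x) = A (?m s) (s *\<^sub>R T_su2 1, x)" if "s \<in> ?S" for s
    proof -
      have "s *\<^sub>R A (?m s) (T_su2 1, 0) + A (?m s) (0, x) = A (?m s) (s *\<^sub>R (T_su2 1, 0) + (0, x))"
        by (simp only: linear_add[OF lin[OF that]] linear_scale[OF lin[OF that]])
      then show ?thesis by simp
    qed
    have "\<forall>\<^sub>F s in at_right 0. norm (s *\<^sub>R A (?m s) (T_su2 1, 0) + A (?m s) (0, x)) = norm (A (?m s) (s *\<^sub>R T_su2 1, x))"
      using S_ev by (rule eventually_mono) (simp only: eq)
    from Lim_transform_eventually[OF at_right_0_ray[OF cont R] this] show ?thesis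
      by simp
  qed
  \<comment> \<open>The vector (t T_1, 0) tends to 0, and in the trivialisation of P_1 the form is
    continuous up to the singular orbit.\<close>
  have "(?\<phi> \<longlongrightarrow> 0) (at_right 0)"
  proof (rule Lim_null_comparison)
    show "\<forall>\<^sub>F t in at_right 0. norm (?\<phi> t) \<le> norm (A (?m t) (t *\<^sub>R T_su2 1, 0))"
      using S_ev by (rule eventually_mono) (use \<rho>_le[of _ True] in simp)
    have "A (0, qone) (0, 0) = 0"
      using connection_singular_orbit[OF conn inv R, of 0] by simp
    then show "((\<lambda>t. norm (A (?m t) (t *\<^sub>R T_su2 1, 0))) \<longlongrightarrow> 0) (at_right 0)"
      using lim[of 0] by simp
  qed
  \<comment> \<open>For \<theta> the vector tends to (0, 2 T_1), tangent to the singular orbit,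
    which gives only a bound: one more than the limiting norm.\<close>
  moreover define K where "K = norm (A (0, qone) (0, 2 *\<^sub>R T_su2 1)) + 1"
  have "\<forall>\<^sub>F t in at_right 0. norm (A (?m t) (t *\<^sub>R T_su2 1, 2 *\<^sub>R T_su2 1)) < K"
    by (rule order_tendstoD(2)[OF lim]) (simp add: K_def)
  then have "\<forall>\<^sub>F t in at_right 0. \<bar>?\<theta> t\<bar> \<le> K"
    using S_ev
  proof eventually_elim
    case (elim t)
    then show ?case using \<rho>_le[of t False] by simp
  qed
  ultimately obtain x1 where x1: "\<And>t. 0 < t \<Longrightarrow> ereal t < R \<Longrightarrow> clarke_denom x1 t \<noteq> 0"
    "\<And>t. 0 < t \<Longrightarrow> ereal t < R \<Longrightarrow> ?\<phi> t = bs_A t * clarke_x x1 t"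
    "\<And>t. 0 < t \<Longrightarrow> ereal t < R \<Longrightarrow> ?\<theta> t = 0"
    using instanton_ode_solution[OF R ode] by metis
  show thesis
    by (rule that[OF c, of x1]) (use x1 form in auto)
qed

lemma instanton_classification:
  assumes R: "0 < R" and conn: "connection_on R A" and inv3: "SU2_3_invariant R A" and G2: "G2_instanton R A"
  shows "\<exists>x1 f A' x y. invariant_gauge_on R f \<and> connection_on R A' \<and> pulls_back R f A A' \<and>
      restricts_to R {0<..} A' (ansatz x y) \<and>
      (\<forall>t. 0 < t \<and> ereal t < R \<longrightarrow> 1 + x1 * (bs_B t ^ 2 - 1 / 3) \<noteq> 0 \<and>
         x t = 2 * x1 * bs_A t / (1 + x1 * (bs_B t ^ 2 - 1 / 3)) \<and> y t = 0)"
proof -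
  note inv = SU2_3_invariant_left_invariant[OF inv3]
  obtain g where g_SU2: "\<forall>t. 0 \<le> t \<and> ereal t < R \<longrightarrow> g t \<in> SU2"
    and dg: "\<forall>t. 0 < t \<and> ereal t < R \<longrightarrow> (g has_vector_derivative - (radial_coef A t \<odot> g t)) (at t)"
    and dG: "\<forall>p::quat. ereal (norm p) < R \<longrightarrow>
      ((\<lambda>p. g (norm p)) has_derivative (\<lambda>v. - (radial_part A p v \<odot> g (norm p)))) (at p)"
    and Gk: "\<forall>k. Ck_on k {p::quat. ereal (norm p) < R} (\<lambda>p. g (norm p))"
    by (rule temporal_gauge[OF conn inv R])
  obtain c x1 where c: "c \<in> SU2" and denom: "\<forall>t. 0 < t \<and> ereal t < R \<longrightarrow> clarke_denom x1 t \<noteq> 0"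
    and form: "\<forall>t \<tau> u w. 0 < t \<and> ereal t < R \<and> u \<in> su2 \<and> w \<in> su2 \<longrightarrow>
      A (t *\<^sub>R qone, qone) (\<tau> *\<^sub>R qone + t *\<^sub>R u, u - w) = \<tau> *\<^sub>R radial_coef A t
        + (g t \<odot> c) \<odot> ((bs_A t * clarke_x x1 t) *\<^sub>R ((1 / 2) *\<^sub>R (u + w))) \<odot> qcnj (g t \<odot> c)"
    by (rule instanton_normal_form[OF R conn inv3 G2 g_SU2 dg])
  \<comment> \<open>The transport to temporal gauge combined with the constant rotation from Schur's
    lemma. It depends on |p| only and hence commutes with the action of SU(2)^2 on P_1.\<close>
  define G where "G p = g (norm p) \<odot> c" for p :: quat
  define f where "f z = (fst z, G (fst (fst z)) \<odot> snd z)" for z :: "(quat \<times> quat) \<times> quat"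
  \<comment> \<open>This is G^-1 A G + G^-1 dG, with dG = - (radial part) G inserted.\<close>
  define A' where "A' m v = qcnj (G (fst m)) \<odot> (A m v - radial_part A (fst m) (fst v)) \<odot> G (fst m)" for m v
  let ?U = "{p::quat. ereal (norm p) < R}"
  have G_SU2: "G p \<in> SU2" if "p \<in> ?U" for p
    using g_SU2 c that by (simp add: G_def)
  have G_k: "Ck_on k ?U G" for k
    unfolding G_def[abs_def]
    by (intro Ck_on_linear_compose[OF open_norm_less qmul.bounded_linear_left]) (use Gk in simp)
  have G_deriv: "(G has_derivative (\<lambda>v. - (radial_part A p v \<odot> G p))) (at p)" if "p \<in> ?U" for p
  proof -
    have "(G has_derivative (\<lambda>v. - (radial_part A p v \<odot> g (norm p)) \<odot> c)) (at p)"
      unfolding G_def[abs_def]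
      by (rule bounded_linear.has_derivative[OF qmul.bounded_linear_left dG[rule_format]]) (use that in simp)
    then show ?thesis
      by (simp add: G_def qmul.minus_left qmul_assoc)
  qed
  have fst_tube: "fst m \<in> ?U" if "m \<in> tube R" for m
    using that by (auto simp: tube_def)
  have U1: "open {m::quat \<times> quat. ereal (norm (fst m)) < R}"
    using open_vimage_fst[OF open_norm_less[of R]] by (simp add: vimage_def)
  have G_fst: "Ck_on k {m::quat \<times> quat. ereal (norm (fst m)) < R} (\<lambda>m. G (fst m))" for k
    by (rule Ck_on_compose[OF U1 open_norm_less _ Ck_on_bounded_linear[OF U1 bounded_linear_fst] G_k]) auto
  have G_tube: "smooth_map_on (tube R) (\<lambda>m. G (fst m))"
    by (rule smooth_map_onI[OF U1 _ G_fst]) (auto simp: tube_def)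
  have fst_k: "Ck_on k UNIV fst" "Ck_on k UNIV snd" for k
    by (simp_all add: Ck_on_bounded_linear bounded_linear_fst bounded_linear_snd)

  have gauge: "invariant_gauge_on R f"
    unfolding invariant_gauge_on_def
  proof (intro conjI ballI)
    let ?V = "{z::(quat \<times> quat) \<times> quat. ereal (norm (fst (fst z))) < R}"
    have V: "open ?V"
      using open_vimage_fst[OF U1] by (simp add: vimage_def)
    have Gz: "Ck_on k ?V (\<lambda>z. G (fst (fst z)))" for k
      by (rule Ck_on_compose[OF V U1 _ Ck_on_bounded_linear[OF V bounded_linear_fst] G_fst]) auto
    have "Ck_on k ?V f" for k
      unfolding f_def[abs_def]
      by (intro Ck_on_Pair V Ck_on_bilinear[OF V bounded_bilinear_qmul] Gz
          Ck_on_bounded_linear[OF V bounded_linear_fst] Ck_on_bounded_linear[OF V bounded_linear_snd])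
    then show "smooth_map_on (P1 R) f"
      by (rule smooth_map_onI[OF V, rotated]) (auto simp: P1_def tube_def)
  next
    fix z assume "z \<in> P1 R"
    then show "f z \<in> P1 R" "fst (f z) = fst z"
      using fst_tube by (auto simp: f_def P1_def G_SU2)
  next
    fix h1 h2 z assume h: "h1 \<in> SU2" "h2 \<in> SU2"
    have "norm (fst (act (h1, h2, qone) m)) = norm (fst m)" for m
      using h by (cases m) (simp add: act_def norm_qmul norm_SU2)
    then show "f (P1_act2 h1 h2 z) = P1_act2 h1 h2 (f z)"
      by (simp add: f_def P1_act2_def G_def split_beta)
  qed (simp add: f_def qmul_assoc)

  have conn': "connection_on R A'"
    unfolding connection_on_def one_form_on_def
  proof (intro conjI ballI allI)
    fix m assume m: "m \<in> tube R"
    have pU: "ereal (norm (fst m)) < R" using fst_tube[OF m] by simp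
    have "linear (\<lambda>v. A m v - radial_part A (fst m) (fst v))"
      using linear_compose_sub[OF connection_linear[OF conn m]
          linear_compose[OF linear_fst radial_part_linear[OF conn pU]]] by (simp add: o_def)
    from linear_compose[OF this bounded_linear.linear[OF bounded_linear_qmul_both]]
    show "linear (A' m)"
      by (simp add: A'_def[abs_def] o_def)
    have "A m v - radial_part A (fst m) (fst v) \<in> su2" for v
    proof (rule subspace_diff[OF subspace_su2 _ radial_part_su2[OF conn pU]])
      show "A m v \<in> su2"
        using conn m unfolding connection_on_def one_form_on_def by blast
    qed
    from su2_conj[OF this, of "qcnj (G (fst m))"] show "range (A' m) \<subseteq> su2"
      by (auto simp: A'_def)
  next
    fix v
    have A: "smooth_map_on (tube R) (\<lambda>m. A m v)"
      using conn unfolding connection_on_def one_form_on_def by blast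
    have "smooth_map_on (tube R) (\<lambda>m. radial_part A (fst m) (fst v))"
      by (rule smooth_map_on_compose[OF radial_part_smooth[OF conn] fst_k(1)]) (auto simp: tube_def)
    from smooth_map_on_add[OF A smooth_map_on_bilinear[OF bounded_bilinear_scaleR smooth_map_on_const[of _ "- 1"] this]]
    have "smooth_map_on (tube R) (\<lambda>m. A m v - radial_part A (fst m) (fst v))"
      by simp
    moreover have "smooth_map_on (tube R) (\<lambda>m. qcnj (G (fst m)))"
      by (rule smooth_map_onI[OF U1 _ Ck_on_linear_compose[OF U1 bounded_linear_qcnj G_fst]]) (auto simp: tube_def)
    ultimately show "smooth_map_on (tube R) (\<lambda>m. A' m v)"
      unfolding A'_def by (intro smooth_map_on_bilinear[OF bounded_bilinear_qmul] G_tube)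
  qed

  have pull: "pulls_back R f A A'"
    unfolding pulls_back_def
  proof (intro ballI)
    fix z w assume z: "z \<in> P1 R" and w: "w \<in> tangent_space (P1 R) z"
    obtain m u where zmu: "z = (m, u)" by (rule prod.exhaust)
    obtain v w' where wv: "w = (v, w')" by (rule prod.exhaust)
    have m: "m \<in> tube R" and u: "u \<in> SU2" using z by (auto simp: zmu P1_def)
    have pU: "fst m \<in> ?U" by (rule fst_tube[OF m])
    let ?r = "radial_part A (fst m) (fst v)" and ?G = "G (fst m)"
    have Gz: "((\<lambda>z::(quat \<times> quat) \<times> quat. G (fst (fst z))) has_derivative
        (\<lambda>w. - (radial_part A (fst m) (fst (fst w)) \<odot> ?G))) (at z)"
      by (rule has_derivative_compose[where g = G]) (use G_deriv[OF pU] in \<open>auto intro!: derivative_eq_intros simp: zmu\<close>)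
    have "(f has_derivative (\<lambda>w. (fst w, ?G \<odot> snd w + - (radial_part A (fst m) (fst (fst w)) \<odot> ?G) \<odot> u))) (at z)"
      unfolding f_def[abs_def]
      using has_derivative_Pair[OF has_derivative_fst[OF has_derivative_ident]
          qmul.FDERIV[OF Gz has_derivative_snd[OF has_derivative_ident]]]
      by (simp add: zmu)
    then have "(f has_derivative (\<lambda>w. (fst w, ?G \<odot> snd w + - (radial_part A (fst m) (fst (fst w)) \<odot> ?G) \<odot> u))) (at z within P1 R)"
      by (rule has_derivative_at_withinI)
    from differential_on_eq[OF this z w]
    have "differential_on (P1 R) f z w = (v, ?G \<odot> w' - ?r \<odot> ?G \<odot> u)"
      by (simp add: wv qmul.minus_left)
    then show "conn_form A (f z) (differential_on (P1 R) f z w) = conn_form A' z w"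
      using G_SU2[OF pU] u
      by (simp add: f_def zmu wv conn_form_def A'_def qcnj_qmul qmul_assoc qmul.diff_left qmul.diff_right)
  qed

  have inv': "left_invariant_on R A'"
    unfolding left_invariant_on_def
  proof (intro ballI)
    fix a b m v assume ab: "a \<in> SU2" "b \<in> SU2" and m: "m \<in> tube R" and v: "v \<in> tangent_space (tube R) m"
    let ?h = "(a, b, qone)"
    have pU: "ereal (norm (fst m)) < R" using fst_tube[OF m] by simp
    have fst_act: "fst (act ?h y) = a \<odot> fst y" for y
      by (cases y) (simp add: act_def)
    have n: "norm (a \<odot> x) = norm x" for x using ab by (simp add: norm_qmul norm_SU2)
    have "radial_part A (a \<odot> fst m) (a \<odot> fst v) = radial_part A (fst m) (fst v)"
    proof (cases "fst m = 0")
      case True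
      then show ?thesis by (simp add: radial_part_0[OF conn inv R] qmul.zero_right)
    next
      case False
      then have "a \<odot> fst m \<noteq> 0" using n[of "fst m"] by (metis norm_eq_zero)
      then show ?thesis
        using pU False ab by (simp add: radial_part_eq[OF conn inv] n inner_qmul_left norm_SU2)
    qed
    moreover have "A (act ?h m) (act ?h v) = A m v"
      using inv ab m v unfolding left_invariant_on_def by blast
    ultimately show "A' (act ?h m) (act ?h v) = A' m v"
      by (simp add: A'_def fst_act G_def n)
  qed
  have "restricts_to R {0<..} A' (ansatz (clarke_x x1) (\<lambda>t. 0))"
  proof (rule restricts_to_ansatz[OF inv'])
    fix s \<tau> u w assume s: "0 < s" "ereal s < R" and u: "u \<in> su2" "w \<in> su2"
    have "qone \<noteq> 0" using norm_qone by (metis norm_zero zero_neq_one)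
    moreover have "qone \<bullet> qone = 1" "qone \<bullet> u = 0"
      using u by (simp_all add: dot_square_norm inner_qone su2_def)
    ultimately have "radial_part A (s *\<^sub>R qone) (\<tau> *\<^sub>R qone + s *\<^sub>R u) = \<tau> *\<^sub>R radial_coef A s"
      using s by (subst radial_part_eq[OF conn inv]) (simp_all add: inner_add_right)
    moreover define k where "k = g s \<odot> c"
    have "G (s *\<^sub>R qone) = k" "k \<in> SU2" using g_SU2 c s by (simp_all add: G_def k_def)
    ultimately show "A' (s *\<^sub>R qone, qone) (\<tau> *\<^sub>R qone + s *\<^sub>R u, u - w)
        = (bs_A s * clarke_x x1 s) *\<^sub>R ((1 / 2) *\<^sub>R (u + w)) + (bs_B s * 0) *\<^sub>R ((1 / 2) *\<^sub>R (u - w))"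
      using form[rule_format, of s u w \<tau>, folded k_def] s u by (simp add: A'_def qmul_assoc)
  qed
  moreover have "\<forall>t. 0 < t \<and> ereal t < R \<longrightarrow> 1 + x1 * (bs_B t ^ 2 - 1 / 3) \<noteq> 0 \<and>
         clarke_x x1 t = 2 * x1 * bs_A t / (1 + x1 * (bs_B t ^ 2 - 1 / 3)) \<and> (\<lambda>t. 0::real) t = 0"
    using denom by (simp add: clarke_denom_def clarke_x_def)
  ultimately show ?thesis
    using gauge conn' pull by blast
qed

text \<open>The classification is made on tubes of every radius because connections with x_1 < 0
  live only near the singular orbit; the second conjunct says that every x_1 occurs. In the last
  conjunct the 1-form vanishes on tangent vectors in the trivialisation of P_1, which makes A the
  product connection.\<close>

theorem theorem4:
  shows "(\<forall>R A. 0 < R \<and> connection_on R A \<and> SU2_3_invariant R A \<and> G2_instanton R A \<longrightarrow>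
           (\<exists>x1 f A' x y. invariant_gauge_on R f \<and> connection_on R A' \<and> pulls_back R f A A' \<and>
              restricts_to R {0<..} A' (ansatz x y) \<and>
              (\<forall>t. 0 < t \<and> ereal t < R \<longrightarrow>
                 1 + x1 * (bs_B t ^ 2 - 1 / 3) \<noteq> 0 \<and>
                 x t = 2 * x1 * bs_A t / (1 + x1 * (bs_B t ^ 2 - 1 / 3)) \<and> y t = 0)))
    \<and> (\<forall>x1. \<exists>R>0. (\<forall>t. 0 < t \<and> ereal t < R \<longrightarrow> t \<in> clarke_interval x1) \<and> clarke_defined_on R x1)
    \<and> (\<forall>x1. clarke_defined_on \<infinity> x1 \<longleftrightarrow> 0 \<le> x1)
    \<and> (\<forall>A. connection_on \<infinity> A \<and> restricts_to \<infinity> {0<..} A (clarke 0) \<longrightarrow>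
          (\<forall>m\<in>tube \<infinity>. \<forall>v\<in>tangent_space (tube \<infinity>) m. \<forall>w\<in>tangent_space (tube \<infinity>) m.
             A m v = 0 \<and> curvature \<infinity> A m v w = 0))"
proof (intro conjI allI impI)
  fix R A
  assume "0 < R \<and> connection_on R A \<and> SU2_3_invariant R A \<and> G2_instanton R A"
  then show "\<exists>x1 f A' x y. invariant_gauge_on R f \<and> connection_on R A' \<and> pulls_back R f A A' \<and>
              restricts_to R {0<..} A' (ansatz x y) \<and>
              (\<forall>t. 0 < t \<and> ereal t < R \<longrightarrow>
                 1 + x1 * (bs_B t ^ 2 - 1 / 3) \<noteq> 0 \<and>
                 x t = 2 * x1 * bs_A t / (1 + x1 * (bs_B t ^ 2 - 1 / 3)) \<and> y t = 0)"
    using instanton_classification by blast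
next
  fix x1 :: real
  show "\<exists>R>0. (\<forall>t. 0 < t \<and> ereal t < R \<longrightarrow> t \<in> clarke_interval x1) \<and> clarke_defined_on R x1"
  proof (cases "0 \<le> x1")
    case True
    then have "clarke_denom x1 t \<noteq> 0" if "0 \<le> t" for t
      using clarke_denom_pos[OF True that] by simp
    then show ?thesis
      by (intro exI[of _ \<infinity>] conjI allI impI clarke_defined_onI) (auto simp: clarke_interval_def)
  next
    case False
    then have x1: "x1 < 0" by simp
    show ?thesis
    \<comment> \<open>For negative x_1 the tube reaches exactly to the zero of the
      denominator.\<close>
    proof (intro exI[of _ "ereal (clarke_t0 x1)"] conjI allI impI clarke_defined_onI)
      show "0 < ereal (clarke_t0 x1)"
        using clarke_t0(1)[OF x1] by (simp add: zero_ereal_def)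
      show "t \<in> clarke_interval x1" if "0 < t \<and> ereal t < ereal (clarke_t0 x1)" for t
        using that by (simp add: clarke_interval_neg[OF x1])
      show "clarke_denom x1 t \<noteq> 0" if "0 \<le> t" "ereal t < ereal (clarke_t0 x1)" for t
        using clarke_t0(3)[OF x1 that(1)] that(2) by simp
    qed
  qed
next
  fix x1 :: real
  have "clarke_defined_on \<infinity> x1" if "0 \<le> x1"
    by (rule clarke_defined_onI) (use clarke_denom_pos[OF that] in force)
  then show "clarke_defined_on \<infinity> x1 \<longleftrightarrow> 0 \<le> x1"
    using clarke_not_global[of x1] by force
next
  fix A
  assume A: "connection_on \<infinity> A \<and> restricts_to \<infinity> {0<..} A (clarke 0)"
  then have conn: "connection_on \<infinity> A" by simp
  have "A (emb n) (emb_diff n v) = 0" if "n \<in> cyl \<infinity>" "v \<in> tangent_space (cyl \<infinity>) n" for n v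
  proof -
    have "fst n \<in> {0<..}" using that(1) by (auto simp: cyl_def)
    then have "A (emb n) (emb_diff n v) = clarke 0 n v"
      using A that unfolding restricts_to_def by blast
    then show ?thesis
      by (simp add: clarke_def ansatz_def clarke_x_def)
  qed
  then have zero: "A m v = 0" if "m \<in> tube \<infinity>" "v \<in> tangent_space (tube \<infinity>) m" for m v
    using vanishing_connection[OF conn _ that] by blast
  then show "\<forall>m\<in>tube \<infinity>. \<forall>v\<in>tangent_space (tube \<infinity>) m. \<forall>w\<in>tangent_space (tube \<infinity>) m.
             A m v = 0 \<and> curvature \<infinity> A m v w = 0"
    using vanishing_curvature[OF conn zero] by blast
qed

end
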